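(* Let $n\ge 4$. Up to isomorphism there are four (families of) solvable indecomposable real right Leibniz algebras of dimension $n+1$ whose nilradical is the $n$-dimensional algebra $\mathcal{L}^2$; that is, the solvable indecomposable right Leibniz algebras with codimension one nilradical $\mathcal{L}^2$ are, up to isomorphism, the following algebras with basis $e_1,\dots,e_{n+1}$, where $e_1,\dots,e_n$ span the nilradical $\mathcal{L}^2$ with its defining brackets, and the only other nonzero brackets are among those listed: (i) $\mathfrak{g}_{n+1,1}$ (depending on a parameter $a\in\mathbb{R}$): $[e_1,e_{n+1}]=e_1+(a-2)e_3$, $[e_2,e_{n+1}]=ae_2$, $[e_i,e_{n+1}]=(a+i-4)e_i$ $(3\le i\le n)$, $[e_{n+1},e_1]=-e_1-(a-2)e_3$, $[e_{n+1},e_3]=(1-a)e_3$, $[e_{n+1},e_4]=e_2-ae_4$, $[e_{n+1},e_j]=(4-j-a)e_j$ $(5\le j\le n)$; $DS=[n+1,n,n-2,0]$, $LS=[n+1,n,n,\dots]$. (ii) $\mathfrak{g}_{n+1,2}$ (for $n\ge5$, $\delta=\pm1$): $[e_1,e_{n+1}]=e_1-2e_3+\delta e_5$, $[e_i,e_{n+1}]=(i-4)e_i$ $(3\le i\le n)$, $[e_{n+1},e_1]=-e_1+2e_3-\delta e_5$, $[e_{n+1},e_3]=e_3$, $[e_{n+1},e_4]=e_2$, $[e_{n+1},e_j]=(4-j)e_j$ $(5\le j\le n)$; $DS=[n+1,n,n-2,0]$, $LS=[n+1,n,n,\dots]$. (iii) $\mathfrak{g}_{n+1,3}$ (for $n\ge5$,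 $\delta=\pm1$): $[e_1,e_{n+1}]=e_1+(2-n)e_3$, $[e_2,e_{n+1}]=(4-n)e_2$, $[e_i,e_{n+1}]=(i-n)e_i$ $(3\le i\le n-1)$, $[e_{n+1},e_{n+1}]=\delta e_n$, $[e_{n+1},e_1]=-e_1+(n-2)e_3$, $[e_{n+1},e_3]=(n-3)e_3$, $[e_{n+1},e_4]=e_2+(n-4)e_4$, $[e_{n+1},e_j]=(n-j)e_j$ $(5\le j\le n-1)$; $DS=[n+1,n,n-2,0]$, $LS=[n+1,n,n,\dots]$. (iv) $\mathfrak{g}_{n+1,4}$ (with $\epsilon\in\{0,1,-1\}$ and parameters $b_1,\dots,b_{n-5}\in\mathbb{R}$): $[e_1,e_{n+1}]=e_3$, $[e_2,e_{n+1}]=e_2$, $[e_i,e_{n+1}]=e_i+\epsilon e_{i+2}+\sum_{k=i+3}^n b_{k-i-2}e_k$, $[e_{n+1},e_1]=-e_3$, $[e_{n+1},e_i]=-e_i-\epsilon e_{i+2}-\sum_{k=i+3}^n b_{k-i-2}e_k$ $(3\le i\le n)$, where the term $\epsilon e_{i+2}$ is omitted when $i+2>n$; $DS=[n+1,n-1,0]$, $LS=[n+1,n-1,n-1,\dots]$.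
   Context: All algebras are finite dimensional over $\mathbb{R}$; brackets not listed are zero. A right Leibniz algebra is a vector space with a bilinear bracket satisfying $[[x,y],z]=[[x,z],y]+[x,[y,z]]$. For a Leibniz algebra $L$: $L^0=L$, $L^{k+1}=[L^k,L]$ (lower central series) and $L^{(0)}=L$, $L^{(k+1)}=[L^{(k)},L^{(k)}]$ (derived series); $L$ is nilpotent (resp. solvable) if some $L^m=0$ (resp. $L^{(m)}=0$). $LS$ and $DS$ denote the lists of dimensions of the terms of the lower central and derived series. The nilradical of a solvable Leibniz algebra is its unique maximal nilpotent ideal. An algebra is indecomposable if it is not a direct sum of two nonzero ideals. For $n\ge4$, $\mathcal{L}^2$ is the $n$-dimensional nilpotent Leibniz algebra with basis $e_1,\dots,e_n$ and only nonzero brackets $[e_1,e_1]=e_2$, $[e_i,e_1]=e_{i+1}$ $(3\le i\le n-1)$, $[e_1,e_3]=e_2-e_4$, $[e_1,e_j]=-e_{j+1}$ $(4\le j\le n-1)$.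
   Formalization: In (i) the stated DS and LS fail at a=1, where they are DS=[n+1,n-1,n-4,0] and LS=[n+1,n-1,n-1,...]; the printed values are proved for a≠1. Families are shown pairwise non-isomorphic except (i) with n=4, a=1, which is isomorphic to (iv). *)

theory Defs
  imports "HOL-Analysis.Analysis" "HOL-Analysis.Finite_Function_Topology"
begin

section \<open>Finite-dimensional real algebras\<close>

text \<open>
  An algebra is a pair of a carrier, which is a linear subspace of an ambient real vector space,
  and a bracket, of which only the values on the carrier matter.
\<close>

record 'a alg =
  car :: "'a set"
  brk :: "'a \<Rightarrow> 'a \<Rightarrow> 'a"

definition algebra_on :: "('a::real_vector) alg \<Rightarrow> bool" where
  "algebra_on L \<longleftrightarrow>
     subspace (car L) \<and>
     (\<exists>B. finite B \<and> span B = car L) \<and>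
     (\<forall>x\<in>car L. \<forall>y\<in>car L. brk L x y \<in> car L) \<and>
     (\<forall>x\<in>car L. \<forall>y\<in>car L. \<forall>z\<in>car L.
        brk L (x + y) z = brk L x z + brk L y z \<and>
        brk L x (y + z) = brk L x y + brk L x z) \<and>
     (\<forall>c. \<forall>x\<in>car L. \<forall>y\<in>car L.
        brk L (c *\<^sub>R x) y = c *\<^sub>R brk L x y \<and>
        brk L x (c *\<^sub>R y) = c *\<^sub>R brk L x y)"

definition right_leibniz :: "('a::real_vector) alg \<Rightarrow> bool" where
  "right_leibniz L \<longleftrightarrow> algebra_on L \<and>
     (\<forall>x\<in>car L. \<forall>y\<in>car L. \<forall>z\<in>car L.
        brk L (brk L x y) z = brk L (brk L x z) y + brk L x (brk L y z))"

definition alg_iso :: "('a::real_vector) alg \<Rightarrow> ('b::real_vector) alg \<Rightarrow> bool" (infix "\<cong>\<^sub>L" 50) where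
  "L \<cong>\<^sub>L M \<longleftrightarrow> (\<exists>f. bij_betw f (car L) (car M) \<and>
     (\<forall>x\<in>car L. \<forall>y\<in>car L. f (x + y) = f x + f y) \<and>
     (\<forall>c. \<forall>x\<in>car L. f (c *\<^sub>R x) = c *\<^sub>R f x) \<and>
     (\<forall>x\<in>car L. \<forall>y\<in>car L. f (brk L x y) = brk M (f x) (f y)))"

definition brk_span :: "('a::real_vector) alg \<Rightarrow> 'a set \<Rightarrow> 'a set \<Rightarrow> 'a set" where
  "brk_span L A B = span {brk L x y | x y. x \<in> A \<and> y \<in> B}"

primrec lower_central :: "('a::real_vector) alg \<Rightarrow> nat \<Rightarrow> 'a set" where
  "lower_central L 0 = car L"
| "lower_central L (Suc k) = brk_span L (lower_central L k) (car L)"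

primrec derived :: "('a::real_vector) alg \<Rightarrow> nat \<Rightarrow> 'a set" where
  "derived L 0 = car L"
| "derived L (Suc k) = brk_span L (derived L k) (derived L k)"

definition nilpotent_alg :: "('a::real_vector) alg \<Rightarrow> bool" where
  "nilpotent_alg L \<longleftrightarrow> (\<exists>m. lower_central L m = {0})"

definition solvable_alg :: "('a::real_vector) alg \<Rightarrow> bool" where
  "solvable_alg L \<longleftrightarrow> (\<exists>m. derived L m = {0})"

text \<open>
  Dimension lists are written in the usual abbreviated form: the last entry of \<open>ds\<close> is
  repeated forever.
\<close>

definition stable_list :: "(nat \<Rightarrow> nat) \<Rightarrow> nat list \<Rightarrow> bool" where
  "stable_list d ds \<longleftrightarrow> ds \<noteq> [] \<and> (\<forall>k. d k = (if k < length ds then ds ! k else last ds))"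

definition has_DS :: "('a::real_vector) alg \<Rightarrow> nat list \<Rightarrow> bool" where
  "has_DS L ds \<longleftrightarrow> stable_list (\<lambda>k. dim (derived L k)) ds"

definition has_LS :: "('a::real_vector) alg \<Rightarrow> nat list \<Rightarrow> bool" where
  "has_LS L ds \<longleftrightarrow> stable_list (\<lambda>k. dim (lower_central L k)) ds"

definition ideal_of :: "('a::real_vector) alg \<Rightarrow> 'a set \<Rightarrow> bool" where
  "ideal_of L I \<longleftrightarrow> subspace I \<and> I \<subseteq> car L \<and>
     (\<forall>x\<in>I. \<forall>y\<in>car L. brk L x y \<in> I \<and> brk L y x \<in> I)"

text \<open>A subspace closed under the bracket, regarded as an algebra in its own right.\<close>

definition sub_alg :: "'a alg \<Rightarrow> 'a set \<Rightarrow> 'a alg" where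
  "sub_alg L I = L\<lparr>car := I\<rparr>"

definition maximal_nilpotent_ideal :: "('a::real_vector) alg \<Rightarrow> 'a set \<Rightarrow> bool" where
  "maximal_nilpotent_ideal L I \<longleftrightarrow>
     ideal_of L I \<and> nilpotent_alg (sub_alg L I) \<and>
     (\<forall>J. ideal_of L J \<and> nilpotent_alg (sub_alg L J) \<and> I \<subseteq> J \<longrightarrow> J = I)"

definition is_nilradical :: "('a::real_vector) alg \<Rightarrow> 'a set \<Rightarrow> bool" where
  "is_nilradical L N \<longleftrightarrow>
     maximal_nilpotent_ideal L N \<and> (\<forall>M. maximal_nilpotent_ideal L M \<longrightarrow> M = N)"

definition indecomposable :: "('a::real_vector) alg \<Rightarrow> bool" where
  "indecomposable L \<longleftrightarrow> \<not> (\<exists>I J. ideal_of L I \<and> ideal_of L J \<and> I \<noteq> {0} \<and> J \<noteq> {0} \<and>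
     I \<inter> J = {0} \<and> {x + y | x y. x \<in> I \<and> y \<in> J} = car L)"


section \<open>Algebras given by structure constants\<close>

type_synonym vec0 = "nat \<Rightarrow>\<^sub>0 real"

definition e :: "nat \<Rightarrow> vec0" where
  "e i = Poly_Mapping.single i 1"

text \<open>
  The algebra with basis \<open>e 1, \<dots>, e m\<close> and brackets \<open>[e i, e j] = c i j\<close>, extended bilinearly.
\<close>

definition table_alg :: "nat \<Rightarrow> (nat \<Rightarrow> nat \<Rightarrow> vec0) \<Rightarrow> vec0 alg" where
  "table_alg m c = \<lparr>car = span (e ` {1..m}),
     brk = (\<lambda>u v. \<Sum>i=1..m. \<Sum>j=1..m.
       (Poly_Mapping.lookup u i * Poly_Mapping.lookup v j) *\<^sub>R c i j)\<rparr>"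

definition L2_table :: "nat \<Rightarrow> nat \<Rightarrow> nat \<Rightarrow> vec0" where
  "L2_table n i j =
     (if i = 1 \<and> j = 1 then e 2
      else if 3 \<le> i \<and> i \<le> n - 1 \<and> j = 1 then e (i + 1)
      else if i = 1 \<and> j = 3 then e 2 - e 4
      else if i = 1 \<and> 4 \<le> j \<and> j \<le> n - 1 then - e (j + 1)
      else 0)"

definition L2 :: "nat \<Rightarrow> vec0 alg" where
  "L2 n = table_alg n (L2_table n)"

text \<open>
  One-dimensional extension of \<open>L2 n\<close> by \<open>e (n + 1)\<close>, where
  \<open>[e i, e (n + 1)] = r i\<close>, \<open>[e (n + 1), e j] = l j\<close> and \<open>[e (n + 1), e (n + 1)] = s\<close>.
\<close>

definition L2_ext :: "nat \<Rightarrow> (nat \<Rightarrow> vec0) \<Rightarrow> (nat \<Rightarrow> vec0) \<Rightarrow> vec0 \<Rightarrow> vec0 alg" where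
  "L2_ext n r l s = table_alg (n + 1) (\<lambda>i j.
     if i \<le> n \<and> j \<le> n then L2_table n i j
     else if i \<le> n then r i
     else if j \<le> n then l j
     else s)"

definition g1 :: "nat \<Rightarrow> real \<Rightarrow> vec0 alg" where
  "g1 n a = L2_ext n
     (\<lambda>i. if i = 1 then e 1 + (a - 2) *\<^sub>R e 3
          else if i = 2 then a *\<^sub>R e 2
          else (a + real i - 4) *\<^sub>R e i)
     (\<lambda>j. if j = 1 then - e 1 - (a - 2) *\<^sub>R e 3
          else if j = 2 then 0
          else if j = 3 then (1 - a) *\<^sub>R e 3
          else if j = 4 then e 2 - a *\<^sub>R e 4
          else (4 - real j - a) *\<^sub>R e j)
     0"

definition g2 :: "nat \<Rightarrow> real \<Rightarrow> vec0 alg" where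
  "g2 n \<delta> = L2_ext n
     (\<lambda>i. if i = 1 then e 1 - 2 *\<^sub>R e 3 + \<delta> *\<^sub>R e 5
          else if i = 2 then 0
          else (real i - 4) *\<^sub>R e i)
     (\<lambda>j. if j = 1 then - e 1 + 2 *\<^sub>R e 3 - \<delta> *\<^sub>R e 5
          else if j = 2 then 0
          else if j = 3 then e 3
          else if j = 4 then e 2
          else (4 - real j) *\<^sub>R e j)
     0"

definition g3 :: "nat \<Rightarrow> real \<Rightarrow> vec0 alg" where
  "g3 n \<delta> = L2_ext n
     (\<lambda>i. if i = 1 then e 1 + (2 - real n) *\<^sub>R e 3
          else if i = 2 then (4 - real n) *\<^sub>R e 2
          else if i \<le> n - 1 then (real i - real n) *\<^sub>R e i
          else 0)
     (\<lambda>j. if j = 1 then - e 1 + (real n - 2) *\<^sub>R e 3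
          else if j = 2 then 0
          else if j = 3 then (real n - 3) *\<^sub>R e 3
          else if j = 4 then e 2 + (real n - 4) *\<^sub>R e 4
          else if j \<le> n - 1 then (real n - real j) *\<^sub>R e j
          else 0)
     (\<delta> *\<^sub>R e n)"

text \<open>Only the values \<open>b 1, \<dots>, b (n - 5)\<close> of the parameter sequence are used.\<close>

definition g4 :: "nat \<Rightarrow> real \<Rightarrow> (nat \<Rightarrow> real) \<Rightarrow> vec0 alg" where
  "g4 n \<epsilon> b = L2_ext n
     (\<lambda>i. if i = 1 then e 3
          else if i = 2 then e 2
          else e i + (if i + 2 \<le> n then \<epsilon> *\<^sub>R e (i + 2) else 0)
                   + (\<Sum>k=i+3..n. b (k - i - 2) *\<^sub>R e k))
     (\<lambda>j. if j = 1 then - e 3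
          else if j = 2 then 0
          else - e j - (if j + 2 \<le> n then \<epsilon> *\<^sub>R e (j + 2) else 0)
                     - (\<Sum>k=j+3..n. b (k - j - 2) *\<^sub>R e k))
     0"


section \<open>The class of algebras to be classified\<close>

definition solvable_L2_extension :: "nat \<Rightarrow> ('a::real_vector) alg \<Rightarrow> bool" where
  "solvable_L2_extension n L \<longleftrightarrow>
     right_leibniz L \<and> dim (car L) = n + 1 \<and> solvable_alg L \<and> indecomposable L \<and>
     (\<exists>N. is_nilradical L N \<and> sub_alg L N \<cong>\<^sub>L L2 n)"

text \<open>
  For the listed algebras the nilradical is not merely isomorphic to \<open>L2 n\<close>: it is spanned by
  \<open>e 1, \<dots>, e n\<close>, on which the bracket is that of \<open>L2 n\<close>.
\<close>

definition standard_nilradical :: "nat \<Rightarrow> vec0 alg \<Rightarrow> bool" where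
  "standard_nilradical n L \<longleftrightarrow>
     is_nilradical L (span (e ` {1..n})) \<and>
     (\<forall>i\<in>{1..n}. \<forall>j\<in>{1..n}. brk L (e i) (e j) = brk (L2 n) (e i) (e j))"

end

theory Submission
  imports Defs
begin

text \<open>
  Write \<open>x = e (n + 1)\<close> and let \<open>D = [\<cdot>, x]\<close>, \<open>\<Lambda> = [x, \<cdot>]\<close> act on the nilradical.  By the Leibniz identity
  \<open>D\<close> is a derivation and \<open>D + \<Lambda>\<close> maps into the annihilator, spanned by \<open>e 2\<close> and \<open>e n\<close>.  As \<open>e 1\<close> and
  \<open>e 3\<close> generate \<open>L2 n\<close>, everything is determined by \<open>D\<close>, \<open>\<Lambda>\<close> on these two vectors and by \<open>[x, x]\<close>,
  and the eigenvalues of \<open>D\<close> by the coordinates \<open>a 1\<close>, \<open>a 3\<close> of \<open>D (e 1)\<close>; both vanish only if the whole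
  algebra is nilpotent.  If \<open>a 1 \<noteq> 0\<close>, the eigenvalues on \<open>e 3, e 4, \<dots>\<close> are distinct, so \<open>e 3\<close> may be taken
  to be an eigenvector, and adding elements of the nilradical to \<open>x\<close> simplifies \<open>D (e 1)\<close>.  The square
  \<open>[x, x]\<close> can then be removed except in two resonant cases, which give \<open>g2\<close> (the square is traded for an
  \<open>e 5\<close>-component of \<open>D (e 1)\<close>) and \<open>g3\<close>.  If \<open>a 1 = 0\<close>, then \<open>D\<close> commutes with the shift
  \<open>[\<cdot>, e 1]\<close> and its coefficients can only be rescaled, which gives \<open>g4\<close>.
\<close>

text \<open>Let \<open>sh\<close> be the shift of \<open>e k\<close> to \<open>e (k + 1)\<close> for
  3 \<le> k < n. Then [u,v] = u_1 (v_1 + v_3) \<open>e 2\<close> + v_1 sh(u) - u_1 sh(v), so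
  identities are checked in coordinates. The relation [\<open>e 1\<close>,\<open>e 3\<close>] =
  \<open>e 2\<close> - \<open>e 4\<close> ties the weights (diagonal entries) of D together: they
  are a_3 + (k-2) a_1 on \<open>e k\<close> for k \<ge> 3 and 2 a_1 + a_3 on \<open>e 2\<close>. For
  a_1 \<noteq> 0 three zeros matter. Weight 0 on \<open>e 2\<close>: adding a multiple of
  \<open>e 2\<close> to x no longer changes [x,x]. Weight 0 on \<open>e n\<close>: only then does
  the Leibniz identity permit an \<open>e n\<close>-component of [x,x]. Weight 0 on
  \<open>e 3\<close>: no new family arises, but \<open>g1\<close> with a = 1 gets different derived
  and lower central series. The families are separated by invariants. Vanishing of all products of
  two brackets singles out \<open>g4\<close>, with one coincidence for n = 4. Squares not confined
  to a line single out \<open>g3\<close>. The weight on the line of squares separates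
  \<open>g1\<close> from \<open>g2\<close> except when a = 0.\<close>

abbreviation coord :: "vec0 \<Rightarrow> nat \<Rightarrow> real" (infixl "$$" 90) where
  "u $$ k \<equiv> Poly_Mapping.lookup u k"

lemma coord_scaleR [simp]: "(c *\<^sub>R u) $$ k = c * u $$ k" for u :: vec0
proof -
  have "{i. c *\<^sub>R u $$ i \<noteq> 0} \<subseteq> {i. u $$ i \<noteq> 0}" by auto
  hence "finite {i. c *\<^sub>R u $$ i \<noteq> 0}" using finite_lookup finite_subset by blast
  thus ?thesis by (simp add: scaleR_poly_mapping_def)
qed

lemma coord_simps [simp]:
  fixes u v :: vec0
  shows "(u + v) $$ k = u $$ k + v $$ k" "(u - v) $$ k = u $$ k - v $$ k"
    "(\<Sum>x\<in>A. F x) $$ k = (\<Sum>x\<in>A. F x $$ k)"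
  by (simp_all add: lookup_add lookup_minus lookup_sum)

lemma coord_e: "e i $$ k = (if k = i then 1 else 0)"
  by (simp add: e_def lookup_single when_def)

lemma vec0_eqI: "(\<And>k. u $$ k = v $$ k) \<Longrightarrow> u = v" for u v :: vec0
  by (rule poly_mapping_eqI)

lemma inj_e: "inj e"
  by (rule injI) (metis coord_e zero_neq_one)

lemma sum_coord_e:
  assumes "finite S" "\<And>k. k \<notin> S \<Longrightarrow> u $$ k = 0"
  shows "(\<Sum>i\<in>S. u $$ i *\<^sub>R e i) = u"
  using assms by (intro vec0_eqI) (auto simp: coord_e if_distrib cong: if_cong)

lemma mem_span_e:
  assumes "finite S"
  shows "u \<in> span (e ` S) \<longleftrightarrow> (\<forall>k. k \<notin> S \<longrightarrow> u $$ k = 0)"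
proof
  assume "u \<in> span (e ` S)"
  thus "\<forall>k. k \<notin> S \<longrightarrow> u $$ k = 0"
    by (induction rule: span_induct_alt) (auto simp: coord_e split: if_splits)
next
  assume "\<forall>k. k \<notin> S \<longrightarrow> u $$ k = 0"
  hence "u = (\<Sum>i\<in>S. u $$ i *\<^sub>R e i)" using sum_coord_e[OF assms] by metis
  also have "\<dots> \<in> span (e ` S)" by (intro span_sum span_scale span_base) auto
  finally show "u \<in> span (e ` S)" .
qed

lemma independent_e:
  assumes "finite S"
  shows "independent (e ` S)"
proof (rule independent_if_scalars_zero)
  show "finite (e ` S)" using assms by simp
  fix f x assume s: "(\<Sum>x\<in>e ` S. f x *\<^sub>R x) = 0" and x: "x \<in> e ` S"
  then obtain i where i: "x = e i" "i \<in> S" by auto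
  have "(\<Sum>x\<in>e ` S. f x *\<^sub>R x) = (\<Sum>j\<in>S. f (e j) *\<^sub>R e j)"
    using inj_e by (simp add: sum.reindex inj_on_subset)
  hence "0 = (\<Sum>j\<in>S. f (e j) *\<^sub>R e j) $$ i" using s by simp
  also have "\<dots> = f (e i)" using i assms by (simp add: coord_e if_distrib cong: if_cong)
  finally show "f x = 0" using i by simp
qed

lemma dim_span_e: "finite S \<Longrightarrow> dim (span (e ` S)) = card S"
  using dim_span_eq_card_independent[OF independent_e] card_image[of e S] inj_e
  by (metis inj_on_subset subset_UNIV)


section \<open>Bases and isomorphisms\<close>

text \<open>The ambient space may be infinite dimensional, so the count goes through a basis
  extracted from \<open>S\<close>, which exhausts \<open>S\<close> by cardinality.\<close>

lemma independent_of_spanning: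
  fixes V :: "'a::real_vector set"
  assumes "finite S" "span S = V" "card S \<le> dim V"
  shows "independent S"
proof -
  obtain B where B: "B \<subseteq> S" "independent B" "S \<subseteq> span B"
    using maximal_independent_subset[of S] by blast
  have "span B = V" using B assms(2) by (metis span_eq span_superset subset_trans)
  hence "card B = dim V" using B dim_span_eq_card_independent by metis
  hence "B = S" using assms B by (metis card_seteq)
  thus ?thesis using B by simp
qed

lemma span_of_independent:
  fixes V :: "'a::real_vector set"
  assumes "subspace V" "finite B0" "span B0 = V" "independent S" "S \<subseteq> V" "card S = dim V"
  shows "span S = V"
proof -
  obtain B where B: "S \<subseteq> B" "B \<subseteq> V" "independent B" "V \<subseteq> span B"
    using maximal_independent_subset_extend[OF assms(5,4)] by blast
  have sB: "span B = V" using B assms(1) by (simp add: span_minimal subset_antisym)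
  have "finite B" using independent_span_bound[of B0 B] B assms by auto
  moreover have "card B = dim V" using sB B dim_span_eq_card_independent by metis
  ultimately have "S = B" using B assms(6) by (metis card_seteq order_refl)
  thus ?thesis using sB by simp
qed

text \<open>The linear map sending \<open>e i\<close> to \<open>w i\<close> for 1 \<le> i \<le> m
  and all other basis vectors to 0. It serves as a change of basis and, for \<open>w = r\<close> or
  \<open>w = l\<close>, as the operator D or \<Lambda>.\<close>

definition comb :: "nat \<Rightarrow> (nat \<Rightarrow> 'a::real_vector) \<Rightarrow> vec0 \<Rightarrow> 'a" where
  "comb m w u = (\<Sum>i=1..m. u $$ i *\<^sub>R w i)"

lemma linear_comb: "linear (comb m w)"
  by (rule linearI) (simp_all add: comb_def sum.distrib scaleR_left.add scaleR_sum_right)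

lemma comb_e: "i \<in> {1..m} \<Longrightarrow> comb m w (e i) = w i"
  by (simp add: comb_def coord_e if_distrib[of "\<lambda>c. c *\<^sub>R _"] cong: if_cong)

lemma comb_image: "comb m w ` span (e ` {1..m}) = span (w ` {1..m})"
proof -
  have "comb m w ` e ` {1..m} = w ` {1..m}" by (force simp: comb_e image_iff)
  thus ?thesis using linear_span_image[OF linear_comb] by metis
qed

lemma comb_inj:
  assumes "independent (w ` {1..m})" "inj_on w {1..m}"
  shows "inj_on (comb m w) (span (e ` {1..m}))"
proof -
  have "u = 0" if u: "u \<in> span (e ` {1..m})" "comb m w u = 0" for u
  proof -
    define f where "f = (\<lambda>x. u $$ (the_inv_into {1..m} w x))"
    have "(\<Sum>x\<in>w ` {1..m}. f x *\<^sub>R x) = comb m w u"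
      using assms(2) by (simp add: comb_def sum.reindex f_def the_inv_into_f_f)
    hence "f x = 0" if "x \<in> w ` {1..m}" for x
      using independentD[OF assms(1) finite_imageI[OF finite_atLeastAtMost] subset_refl _ that] u by simp
    hence "f (w i) = 0" if "i \<in> {1..m}" for i using that by blast
    hence "u $$ i = 0" if "i \<in> {1..m}" for i
      using that the_inv_into_f_f[OF assms(2)] by (simp add: f_def)
    moreover have "u $$ k = 0" if "k \<notin> {1..m}" for k using u that mem_span_e[of "{1..m}" u] by blast
    ultimately show ?thesis by (intro vec0_eqI) (metis lookup_zero)
  qed
  thus ?thesis
    using linear_injective_on_subspace_0[OF linear_comb subspace_span] by blast
qed

section \<open>Isomorphisms and algebras given by tables\<close>

lemma algebra_onD:
  assumes "algebra_on L"
  shows "subspace (car L)" "x \<in> car L \<Longrightarrow> y \<in> car L \<Longrightarrow> brk L x y \<in> car L"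
  using assms unfolding algebra_on_def by blast+

lemma right_leibnizD:
  assumes "right_leibniz L"
  shows "algebra_on L" "x \<in> car L \<Longrightarrow> y \<in> car L \<Longrightarrow> z \<in> car L \<Longrightarrow>
    brk L (brk L x y) z = brk L (brk L x z) y + brk L x (brk L y z)"
  using assms unfolding right_leibniz_def by blast+

lemma alg_iso_sym:
  assumes "algebra_on L" "L \<cong>\<^sub>L M"
  shows "M \<cong>\<^sub>L L"
proof -
  obtain f where f: "bij_betw f (car L) (car M)"
     "\<And>x y. x\<in>car L \<Longrightarrow> y\<in>car L \<Longrightarrow> f (x + y) = f x + f y"
     "\<And>c x. x\<in>car L \<Longrightarrow> f (c *\<^sub>R x) = c *\<^sub>R f x"
     "\<And>x y. x\<in>car L \<Longrightarrow> y\<in>car L \<Longrightarrow> f (brk L x y) = brk M (f x) (f y)"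
    using assms(2) unfolding alg_iso_def by blast
  define g where "g = the_inv_into (car L) f"
  have inj: "inj_on f (car L)" using f(1) by (rule bij_betw_imp_inj_on)
  have g: "bij_betw g (car M) (car L)" unfolding g_def using f(1) by (rule bij_betw_the_inv_into)
  have gL: "g y \<in> car L" if "y \<in> car M" for y using g that by (rule bij_betwE[rule_format])
  have fg: "f (g y) = y" if "y \<in> car M" for y
    using f_the_inv_into_f_bij_betw[OF f(1)] that unfolding g_def by blast
  have gf: "g (f x) = x" if "x \<in> car L" for x
    using the_inv_into_f_f[OF inj that] unfolding g_def .
  have cl: "x + y \<in> car L" "c *\<^sub>R x \<in> car L" "brk L x y \<in> car L" if "x \<in> car L" "y \<in> car L" for x y c
    using algebra_onD[OF assms(1)] that by (simp_all add: subspace_add subspace_scale)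
  show ?thesis unfolding alg_iso_def
  proof (intro exI[of _ g] conjI ballI allI)
    show "bij_betw g (car M) (car L)" by (rule g)
    fix x y assume xy: "x \<in> car M" "y \<in> car M"
    show "g (x + y) = g x + g y" using f(2)[OF gL gL, OF xy] gf[OF cl(1)[OF gL gL, OF xy]] fg xy by simp
    show "g (brk M x y) = brk L (g x) (g y)" using f(4)[OF gL gL, OF xy] gf[OF cl(3)[OF gL gL, OF xy]] fg xy by simp
  next
    fix c x assume x: "x \<in> car M"
    show "g (c *\<^sub>R x) = c *\<^sub>R g x" using f(3)[OF gL, OF x, of c] gf[OF cl(2)[OF gL gL, OF x x, of c]] fg x by simp
  qed
qed

lemma alg_iso_trans:
  assumes "L \<cong>\<^sub>L M" "M \<cong>\<^sub>L K"
  shows "L \<cong>\<^sub>L K"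
proof -
  obtain f where f: "bij_betw f (car L) (car M)"
     "\<And>x y. x\<in>car L \<Longrightarrow> y\<in>car L \<Longrightarrow> f (x + y) = f x + f y"
     "\<And>c x. x\<in>car L \<Longrightarrow> f (c *\<^sub>R x) = c *\<^sub>R f x"
     "\<And>x y. x\<in>car L \<Longrightarrow> y\<in>car L \<Longrightarrow> f (brk L x y) = brk M (f x) (f y)"
    using assms(1) unfolding alg_iso_def by blast
  obtain g where g: "bij_betw g (car M) (car K)"
     "\<And>x y. x\<in>car M \<Longrightarrow> y\<in>car M \<Longrightarrow> g (x + y) = g x + g y"
     "\<And>c x. x\<in>car M \<Longrightarrow> g (c *\<^sub>R x) = c *\<^sub>R g x"
     "\<And>x y. x\<in>car M \<Longrightarrow> y\<in>car M \<Longrightarrow> g (brk M x y) = brk K (g x) (g y)"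
    using assms(2) unfolding alg_iso_def by blast
  have fM: "f x \<in> car M" if "x \<in> car L" for x using f(1) that by (rule bij_betwE[rule_format])
  show ?thesis unfolding alg_iso_def
    by (rule exI[of _ "g \<circ> f"]) (auto intro: bij_betw_trans[OF f(1) g(1)] simp: f g fM)
qed

lemma right_leibniz_iso:
  assumes "right_leibniz L" "L \<cong>\<^sub>L M" "algebra_on M"
  shows "right_leibniz M"
proof -
  note aL = right_leibnizD(1)[OF assms(1)]
  obtain f where f: "bij_betw f (car L) (car M)"
     "\<And>x y. x\<in>car L \<Longrightarrow> y\<in>car L \<Longrightarrow> f (x + y) = f x + f y"
     "\<And>x y. x\<in>car L \<Longrightarrow> y\<in>car L \<Longrightarrow> f (brk L x y) = brk M (f x) (f y)"
    using assms(2) unfolding alg_iso_def by blast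
  have cl: "x + y \<in> car L" "brk L x y \<in> car L" if "x \<in> car L" "y \<in> car L" for x y
    using algebra_onD[OF aL] that by (simp_all add: subspace_add)
  have "brk M (brk M x y) z = brk M (brk M x z) y + brk M x (brk M y z)"
    if xyz: "x \<in> car M" "y \<in> car M" "z \<in> car M" for x y z
  proof -
    obtain x' y' z' where d: "x = f x'" "y = f y'" "z = f z'" and c: "x' \<in> car L" "y' \<in> car L" "z' \<in> car L"
      using xyz bij_betw_imp_surj_on[OF f(1)] by blast
    have "f (brk L (brk L x' y') z') = f (brk L (brk L x' z') y' + brk L x' (brk L y' z'))"
      using right_leibnizD(2)[OF assms(1) c] by simp
    thus ?thesis using c by (simp add: d f(2,3) cl)
  qed
  thus ?thesis using assms(3) unfolding right_leibniz_def by blast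
qed

lemma table_alg_brk_add [simp]:
  "brk (table_alg m c) (u + v) z = brk (table_alg m c) u z + brk (table_alg m c) v z"
  "brk (table_alg m c) z (u + v) = brk (table_alg m c) z u + brk (table_alg m c) z v"
  by (simp_all add: table_alg_def algebra_simps sum.distrib)

lemma table_alg_brk_scale [simp]:
  "brk (table_alg m c) (a *\<^sub>R u) z = a *\<^sub>R brk (table_alg m c) u z"
  "brk (table_alg m c) z (a *\<^sub>R u) = a *\<^sub>R brk (table_alg m c) z u"
  by (simp_all add: table_alg_def scaleR_sum_right ac_simps)

lemma table_alg_brk_e:
  assumes "i \<in> {1..m}" "j \<in> {1..m}"
  shows "brk (table_alg m c) (e i) (e j) = c i j"
proof -
  have "brk (table_alg m c) (e i) (e j) =
    (\<Sum>i'=1..m. \<Sum>j'=1..m. if j' = j then (if i' = i then c i' j' else 0) else 0)"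
    unfolding table_alg_def alg.simps by (rule sum.cong[OF refl sum.cong[OF refl]]) (simp add: coord_e)
  also have "\<dots> = c i j" using assms by simp
  finally show ?thesis .
qed

lemma car_table_alg [simp]: "car (table_alg m c) = span (e ` {1..m})"
  by (simp add: table_alg_def)

lemma algebra_on_table:
  assumes "\<And>i j. i \<in> {1..m} \<Longrightarrow> j \<in> {1..m} \<Longrightarrow> c i j \<in> span (e ` {1..m})"
  shows "algebra_on (table_alg m c)"
proof -
  have "brk (table_alg m c) x y \<in> span (e ` {1..m})" for x y
    unfolding table_alg_def alg.simps by (intro span_sum span_scale assms)
  thus ?thesis unfolding algebra_on_def by (auto intro!: exI[of _ "e ` {1..m}"])
qed

lemma table_alg_cong:
  assumes "\<And>i j. i \<in> {1..m} \<Longrightarrow> j \<in> {1..m} \<Longrightarrow> c i j = c' i j"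
  shows "table_alg m c = table_alg m c'"
proof -
  have "(\<Sum>i=1..m. \<Sum>j=1..m. (u $$ i * v $$ j) *\<^sub>R c i j) = (\<Sum>i=1..m. \<Sum>j=1..m. (u $$ i * v $$ j) *\<^sub>R c' i j)"
    for u v by (rule sum.cong[OF refl sum.cong[OF refl]]) (simp only: assms)
  thus ?thesis by (simp only: table_alg_def)
qed

text \<open>Agreement on basis vectors extends bilinearly. It holds for all \<open>u\<close> and
  \<open>v\<close>, because \<open>comb\<close> and the table bracket both ignore coordinates
  outside 1, ..., \<open>m\<close>.\<close>

lemma comb_brk:
  fixes L :: "('a::real_vector) alg"
  assumes L: "algebra_on L" and w: "w ` {1..m} \<subseteq> car L"
    and br: "\<And>i j. i \<in> {1..m} \<Longrightarrow> j \<in> {1..m} \<Longrightarrow> brk L (w i) (w j) = comb m w (c i j)"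
  shows "comb m w (brk (table_alg m c) u v) = brk L (comb m w u) (comb m w v)"
proof -
  have sub: "subspace (car L)" using L algebra_on_def by blast
  have add: "brk L (x + y) z = brk L x z + brk L y z" "brk L x (y + z) = brk L x y + brk L x z"
     and sc: "brk L (a *\<^sub>R x) y = a *\<^sub>R brk L x y" "brk L x (a *\<^sub>R y) = a *\<^sub>R brk L x y"
     if "x \<in> car L" "y \<in> car L" "z \<in> car L" for x y z a
    using L that unfolding algebra_on_def by auto
  have z: "0 \<in> car L" using sub by (rule subspace_0)
  have zl: "brk L 0 y = 0" "brk L y 0 = 0" if "y \<in> car L" for y
    using sc(1)[OF z that z, of 0] sc(2)[OF that z z, of 0] by simp_all
  have suml: "brk L (\<Sum>i\<in>A. a i *\<^sub>R w i) y = (\<Sum>i\<in>A. a i *\<^sub>R brk L (w i) y)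
     \<and> (\<Sum>i\<in>A. a i *\<^sub>R w i) \<in> car L"
    if "finite A" "A \<subseteq> {1..m}" "y \<in> car L" for A a y
    using that
  proof (induction A)
    case empty
    thus ?case using z zl by simp
  next
    case (insert i A)
    have "w i \<in> car L" using w insert by auto
    moreover from this have "a i *\<^sub>R w i \<in> car L" by (rule subspace_scale[OF sub])
    ultimately show ?case using insert add(1)[of "a i *\<^sub>R w i" "\<Sum>i\<in>A. a i *\<^sub>R w i" y] sc
      by (auto intro: subspace_add[OF sub])
  qed
  have sumr: "brk L y (\<Sum>i\<in>A. a i *\<^sub>R w i) = (\<Sum>i\<in>A. a i *\<^sub>R brk L y (w i))"
    if "finite A" "A \<subseteq> {1..m}" "y \<in> car L" for A a y
    using that
  proof (induction A)
    case empty
    thus ?case using z zl by simp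
  next
    case (insert i A)
    have "w i \<in> car L" using w insert by auto
    moreover from this have "a i *\<^sub>R w i \<in> car L" by (rule subspace_scale[OF sub])
    ultimately show ?case using insert add(2)[of y "a i *\<^sub>R w i" "\<Sum>i\<in>A. a i *\<^sub>R w i"] sc suml
      by auto
  qed
  have cv: "comb m w v \<in> car L" for v
    unfolding comb_def using w by (intro subspace_sum[OF sub] subspace_scale[OF sub]) auto
  have "brk L (comb m w u) (comb m w v) = (\<Sum>i=1..m. u $$ i *\<^sub>R brk L (w i) (comb m w v))"
    unfolding comb_def[of m w u] using suml cv by blast
  also have "\<dots> = (\<Sum>i=1..m. u $$ i *\<^sub>R (\<Sum>j=1..m. v $$ j *\<^sub>R brk L (w i) (w j)))"
  proof (rule sum.cong)
    fix i assume "i \<in> {1..m}"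
    hence "w i \<in> car L" using w by auto
    thus "u $$ i *\<^sub>R brk L (w i) (comb m w v) = u $$ i *\<^sub>R (\<Sum>j=1..m. v $$ j *\<^sub>R brk L (w i) (w j))"
      unfolding comb_def using sumr[of "{1..m}"] by simp
  qed simp
  also have "\<dots> = (\<Sum>i=1..m. \<Sum>j=1..m. (u $$ i * v $$ j) *\<^sub>R comb m w (c i j))"
    by (simp add: scaleR_sum_right br)
  also have "\<dots> = comb m w (brk (table_alg m c) u v)"
    by (simp add: table_alg_def linear_sum[OF linear_comb] linear_scale[OF linear_comb])
  finally show ?thesis by simp
qed

text \<open>A spanning family of \<open>m = dim (car L)\<close> vectors is a basis, so
  \<open>comb m w\<close> is bijective; \<open>comb_brk\<close> makes it a homomorphism.\<close>

lemma table_alg_iso: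
  fixes L :: "('a::real_vector) alg"
  assumes L: "algebra_on L" and sp: "span (w ` {1..m}) = car L" and dimL: "dim (car L) = m"
    and cE: "\<And>i j. i \<in> {1..m} \<Longrightarrow> j \<in> {1..m} \<Longrightarrow> c i j \<in> span (e ` {1..m})"
    and br: "\<And>i j. i \<in> {1..m} \<Longrightarrow> j \<in> {1..m} \<Longrightarrow> brk L (w i) (w j) = comb m w (c i j)"
  shows "inj_on (comb m w) (span (e ` {1..m}))" "table_alg m c \<cong>\<^sub>L L" "L \<cong>\<^sub>L table_alg m c"
proof -
  have le: "card (w ` {1..m}) \<le> m" using card_image_le[of "{1..m}" w] by simp
  have ind: "independent (w ` {1..m})"
    by (rule independent_of_spanning[OF finite_imageI[OF finite_atLeastAtMost] sp]) (simp only: dimL le)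
  have "card (w ` {1..m}) = m" using dim_span_eq_card_independent[OF ind] unfolding sp dimL by (rule sym)
  hence "inj_on w {1..m}" by (intro eq_card_imp_inj_on) simp_all
  with ind show i: "inj_on (comb m w) (span (e ` {1..m}))" by (rule comb_inj)
  have w: "w ` {1..m} \<subseteq> car L" using span_superset[of "w ` {1..m}"] unfolding sp .
  have "bij_betw (comb m w) (span (e ` {1..m})) (car L)"
    unfolding bij_betw_def by (intro conjI i) (rule trans[OF comb_image sp])
  thus "table_alg m c \<cong>\<^sub>L L" unfolding alg_iso_def
    using comb_brk[where c = c, OF L w br]
    by (intro exI[of _ "comb m w"] conjI ballI allI)
      (simp_all add: linear_add[OF linear_comb] linear_scale[OF linear_comb])
  thus "L \<cong>\<^sub>L table_alg m c"
    using alg_iso_sym[OF algebra_on_table] cE by blast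
qed

lemma brk_span_subset:
  assumes "subspace V" "\<And>x y. x \<in> A \<Longrightarrow> y \<in> B \<Longrightarrow> brk L x y \<in> V"
  shows "brk_span L A B \<subseteq> V"
  unfolding brk_span_def using assms by (intro span_minimal) auto

lemma brk_in_brk_span: "x \<in> A \<Longrightarrow> y \<in> B \<Longrightarrow> brk L x y \<in> brk_span L A B"
  unfolding brk_span_def by (rule span_base) blast

lemma brk_span_mono: "X \<subseteq> X' \<Longrightarrow> Y \<subseteq> Y' \<Longrightarrow> brk_span L X Y \<subseteq> brk_span L X' Y'"
  unfolding brk_span_def by (intro span_mono) blast

lemma subspace_brk_span: "subspace (brk_span L A B)"
  by (simp add: brk_span_def subspace_span)

text \<open>Linear maps commute with spans. This carries nilpotency of a table algebra over to an
  abstract algebra.\<close>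

lemma lower_central_image:
  assumes g: "linear g" and c: "g ` car T = car L" and b: "\<And>x y. g (brk T x y) = brk L (g x) (g y)"
  shows "lower_central L k = g ` lower_central T k"
proof (induction k)
  case (Suc k)
  have "{brk L x y |x y. x \<in> g ` lower_central T k \<and> y \<in> g ` car T}
     = g ` {brk T x y |x y. x \<in> lower_central T k \<and> y \<in> car T}"
  proof (intro subset_antisym subsetI)
    fix z assume "z \<in> {brk L x y |x y. x \<in> g ` lower_central T k \<and> y \<in> g ` car T}"
    then obtain x y where "z = brk L (g x) (g y)" "x \<in> lower_central T k" "y \<in> car T" by blast
    thus "z \<in> g ` {brk T x y |x y. x \<in> lower_central T k \<and> y \<in> car T}"
      using b[of x y] by (intro image_eqI[of _ _ "brk T x y"]) auto
  next
    fix z assume "z \<in> g ` {brk T x y |x y. x \<in> lower_central T k \<and> y \<in> car T}"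
    thus "z \<in> {brk L x y |x y. x \<in> g ` lower_central T k \<and> y \<in> g ` car T}" using b by blast
  qed
  thus ?case
    using linear_span_image[OF g] by (simp add: brk_span_def Suc.IH c)
qed (simp add: c)

declare One_nat_def [simp del]

section \<open>The algebra \<open>L2 n\<close> and its one-dimensional extensions\<close>

abbreviation nb :: "nat \<Rightarrow> vec0 \<Rightarrow> vec0 \<Rightarrow> vec0" where
  "nb n \<equiv> brk (L2 n)"

lemma nb_linear [simp]:
  "nb n (u + v) z = nb n u z + nb n v z" "nb n z (u + v) = nb n z u + nb n z v"
  "nb n (a *\<^sub>R u) z = a *\<^sub>R nb n u z" "nb n z (a *\<^sub>R u) = a *\<^sub>R nb n z u"
  by (simp_all add: L2_def)

text \<open>Four delta terms, in the shape that \<open>double_sum_delta\<close> collapses. The value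
  \<open>e 2 - e 4\<close> of [\<open>e 1\<close>,\<open>e 3\<close>] is split: its
  \<open>e 4\<close> part belongs to the fourth term (k = 4). The guard 4 \<le> k makes the
  truncated \<open>k - 1\<close> harmless.\<close>

lemma coord_L2_table:
  assumes "n \<ge> 4"
  shows "L2_table n i j $$ k =
     (if i = 1 \<and> j = 1 then (if k = 2 then 1 else 0) else 0)
   + (if i = k - 1 \<and> j = 1 then (if 4 \<le> k \<and> k \<le> n then 1 else 0) else 0)
   + (if i = 1 \<and> j = 3 then (if k = 2 then 1 else 0) else 0)
   + (if i = 1 \<and> j = k - 1 then (if 4 \<le> k \<and> k \<le> n then - 1 else 0) else 0)"
proof -
  have k: "i = k - 1 \<and> 4 \<le> k \<and> k \<le> n \<longleftrightarrow> k = i + 1 \<and> 3 \<le> i \<and> i \<le> n - 1" for i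
    using assms by arith
  have A: "(if i = k - 1 \<and> j = 1 then (if 4 \<le> k \<and> k \<le> n then 1 else 0) else 0)
     = (if j = 1 \<and> 3 \<le> i \<and> i \<le> n - 1 then e (i + 1) $$ k else 0)"
  proof (cases "i = k - 1 \<and> 4 \<le> k \<and> k \<le> n")
    case True
    with k[of i] have "k = i + 1" "3 \<le> i" "i \<le> n - 1" by blast+
    with True show ?thesis by (simp add: coord_e)
  next
    case False
    with k[of i] have "\<not> (k = i + 1 \<and> 3 \<le> i \<and> i \<le> n - 1)" by blast
    with False show ?thesis unfolding coord_e by (auto simp del: One_nat_def)
  qed
  have B: "(if i = 1 \<and> j = k - 1 then (if 4 \<le> k \<and> k \<le> n then - 1 else 0) else 0)
     = (if i = 1 \<and> 3 \<le> j \<and> j \<le> n - 1 then - e (j + 1) $$ k else 0)"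
  proof (cases "j = k - 1 \<and> 4 \<le> k \<and> k \<le> n")
    case True
    with k[of j] have "k = j + 1" "3 \<le> j" "j \<le> n - 1" by blast+
    with True show ?thesis by (simp add: coord_e)
  next
    case False
    with k[of j] have "\<not> (k = j + 1 \<and> 3 \<le> j \<and> j \<le> n - 1)" by blast
    with False show ?thesis unfolding coord_e by (auto simp del: One_nat_def)
  qed
  have e2: "e 2 $$ k = (if k = 2 then 1 else 0)" by (simp add: coord_e)
  consider "i = 1" "j = 1" | "i \<noteq> 1" "j = 1" | "i = 1" "j = 3" | "i = 1" "j \<noteq> 1" "j \<noteq> 3" | "i \<noteq> 1" "j \<noteq> 1"
    by blast
  thus ?thesis
  proof cases
    case 4
    hence "3 \<le> j \<longleftrightarrow> 4 \<le> j" by auto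
    with 4 show ?thesis unfolding A B by (simp add: L2_table_def del: One_nat_def)
  qed (unfold A B e2[symmetric], use assms in \<open>simp_all add: L2_table_def\<close>)
qed

lemma double_sum_delta:
  fixes u v :: "nat \<Rightarrow> real"
  assumes "a \<in> {1..m}" "b \<in> {1..m}"
  shows "(\<Sum>i=1..m. \<Sum>j=1..m. u i * v j * (if i = a \<and> j = b then c else 0)) = u a * v b * c"
proof -
  have "(\<Sum>j=1..m. u i * v j * (if i = a \<and> j = b then c else 0)) = (if i = a then u a * v b * c else 0)" for i
  proof -
    have "(\<Sum>j=1..m. u i * v j * (if i = a \<and> j = b then c else 0))
      = (\<Sum>j=1..m. if j = b then (if i = a then u a * v b * c else 0) else 0)"
      by (rule sum.cong) simp_all
    thus ?thesis using assms by simp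
  qed
  thus ?thesis using assms by simp
qed

text \<open>The working formula for all brackets in \<open>L2 n\<close>. In particular a product has
  no coordinates 1 and 3, and it vanishes when both factors have coordinate 1 equal to 0.\<close>

lemma coord_nb:
  assumes n: "n \<ge> 4"
  shows "nb n u v $$ k = (if k = 2 then u $$ 1 * (v $$ 1 + v $$ 3)
    else if 4 \<le> k \<and> k \<le> n then u $$ (k - 1) * v $$ 1 - u $$ 1 * v $$ (k - 1) else 0)"
proof -
  let ?S = "\<lambda>a b c. \<Sum>i=1..n. \<Sum>j=1..n. u $$ i * v $$ j * (if i = a \<and> j = b then c else 0 :: real)"
  have *: "nb n u v $$ k = ?S 1 1 (if k = 2 then 1 else 0) + ?S (k - 1) 1 (if 4 \<le> k \<and> k \<le> n then 1 else 0)
     + ?S 1 3 (if k = 2 then 1 else 0) + ?S 1 (k - 1) (if 4 \<le> k \<and> k \<le> n then - 1 else 0)"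
    unfolding L2_def table_alg_def alg.simps
    by (simp only: coord_simps coord_scaleR coord_L2_table[OF n] distrib_left sum.distrib)
  have m: "1 \<in> {1..n}" "3 \<in> {1..n}" using n by auto
  show ?thesis
  proof (cases "4 \<le> k \<and> k \<le> n")
    case True
    hence "k - 1 \<in> {1..n}" by auto
    note d = double_sum_delta[OF m(1,1)] double_sum_delta[OF m(1,2)]
      double_sum_delta[OF this m(1)] double_sum_delta[OF m(1) this]
    show ?thesis unfolding * d using True by simp
  next
    case False
    note d = double_sum_delta[OF m(1,1)] double_sum_delta[OF m(1,2)]
    have z: "(\<Sum>i=1..n. \<Sum>j=1..n. u $$ i * v $$ j * (if P i j then 0 else 0)) = 0" for P by simp
    show ?thesis unfolding * d if_not_P[OF False] z using False by (simp add: distrib_left)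
  qed
qed

lemma brk_L2_ext:
  "brk (L2_ext n r l s) u v = nb n u v + v $$ (n + 1) *\<^sub>R comb n r u
     + u $$ (n + 1) *\<^sub>R comb n l v + (u $$ (n + 1) * v $$ (n + 1)) *\<^sub>R s"
proof -
  define c where "c = (\<lambda>i j. if i \<le> n \<and> j \<le> n then L2_table n i j
     else if i \<le> n then r i else if j \<le> n then l j else s)"
  have un: "{1..n + 1} = insert (n + 1) {1..n}" by auto
  have split: "(\<Sum>i=1..n + 1. F i) = (\<Sum>i=1..n. F i) + F (n + 1)" for F :: "nat \<Rightarrow> vec0"
    unfolding un by (subst sum.insert) auto
  have "brk (L2_ext n r l s) u v =
    (\<Sum>i=1..n + 1. \<Sum>j=1..n + 1. (u $$ i * v $$ j) *\<^sub>R c i j)"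
    by (simp only: L2_ext_def table_alg_def alg.simps c_def)
  also have "\<dots> = (\<Sum>i=1..n. \<Sum>j=1..n. (u $$ i * v $$ j) *\<^sub>R c i j)
     + (\<Sum>i=1..n. (u $$ i * v $$ (n + 1)) *\<^sub>R c i (n + 1))
     + (\<Sum>j=1..n. (u $$ (n + 1) * v $$ j) *\<^sub>R c (n + 1) j)
     + (u $$ (n + 1) * v $$ (n + 1)) *\<^sub>R c (n + 1) (n + 1)"
    unfolding split sum.distrib by (simp only: add.assoc add.left_commute)
  also have "(\<Sum>i=1..n. \<Sum>j=1..n. (u $$ i * v $$ j) *\<^sub>R c i j) = nb n u v"
    unfolding L2_def table_alg_def alg.simps
    by (rule sum.cong[OF refl sum.cong[OF refl]]) (simp add: c_def)
  also have "(\<Sum>i=1..n. (u $$ i * v $$ (n + 1)) *\<^sub>R c i (n + 1)) = v $$ (n + 1) *\<^sub>R comb n r u"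
    unfolding comb_def scaleR_sum_right by (rule sum.cong[OF refl]) (simp add: c_def)
  also have "(\<Sum>j=1..n. (u $$ (n + 1) * v $$ j) *\<^sub>R c (n + 1) j) = u $$ (n + 1) *\<^sub>R comb n l v"
    unfolding comb_def scaleR_sum_right by (rule sum.cong[OF refl]) (simp add: c_def)
  also have "c (n + 1) (n + 1) = s" by (simp add: c_def)
  finally show ?thesis .
qed

lemma car_L2_ext [simp]: "car (L2_ext n r l s) = span (e ` {1..n + 1})"
  by (simp add: L2_ext_def)

lemma car_L2 [simp]: "car (L2 n) = span (e ` {1..n})"
  by (simp add: L2_def)

text \<open>That the square \<open>s\<close> lies in the nilradical is automatic for a Leibniz
  extension; \<open>xx\<close> in \<open>extension_presentation\<close> proves it.\<close>

definition ext_data :: "nat \<Rightarrow> (nat \<Rightarrow> vec0) \<Rightarrow> (nat \<Rightarrow> vec0) \<Rightarrow> vec0 \<Rightarrow> bool" where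
  "ext_data n r l s \<longleftrightarrow> (\<forall>i\<in>{1..n}. r i \<in> span (e ` {1..n}) \<and> l i \<in> span (e ` {1..n}))
     \<and> s \<in> span (e ` {1..n})"

lemma span_e_mono: "S \<subseteq> S' \<Longrightarrow> span (e ` S) \<subseteq> span (e ` S')"
  by (rule span_mono) auto

lemma comb_in_span: "(\<And>i. i \<in> {1..m} \<Longrightarrow> w i \<in> span B) \<Longrightarrow> comb m w u \<in> span B"
  unfolding comb_def by (intro span_sum span_scale)

lemma nb_in_span: "n \<ge> 4 \<Longrightarrow> nb n u v \<in> span (e ` {1..n})"
  by (subst mem_span_e) (auto simp: coord_nb)

lemma brk_ext_in_span:
  assumes "n \<ge> 4" "ext_data n r l s"
  shows "brk (L2_ext n r l s) u v \<in> span (e ` {1..n})"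
  using assms unfolding brk_L2_ext ext_data_def
  by (intro span_add span_scale nb_in_span comb_in_span) auto

lemma algebra_on_L2_ext:
  assumes "n \<ge> 4" "ext_data n r l s"
  shows "algebra_on (L2_ext n r l s)"
proof -
  have "brk (L2_ext n r l s) u v \<in> span (e ` {1..n + 1})" for u v
    using brk_ext_in_span[OF assms] span_e_mono[of "{1..n}" "{1..n + 1}"] by auto
  thus ?thesis
    unfolding algebra_on_def using table_alg_brk_add table_alg_brk_scale
    by (auto simp: L2_ext_def intro!: exI[of _ "e ` {1..n + 1}"])
qed

lemma brk_table_restrict:
  assumes "\<And>k. k \<in> {1..m} \<Longrightarrow> u $$ k = u' $$ k" "\<And>k. k \<in> {1..m} \<Longrightarrow> v $$ k = v' $$ k"
  shows "brk (table_alg m c) u v = brk (table_alg m c) u' v'"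
  unfolding table_alg_def alg.simps by (rule sum.cong[OF refl sum.cong[OF refl]]) (simp add: assms)

text \<open>The bracket of a table algebra only sees the coordinates \<open>1, \<dots>, m\<close>, so the Leibniz identity
  extends from the carrier to all of \<^typ>\<open>vec0\<close>.\<close>

lemma leibniz_global:
  assumes "right_leibniz (table_alg m c)"
  shows "brk (table_alg m c) (brk (table_alg m c) x y) z
    = brk (table_alg m c) (brk (table_alg m c) x z) y + brk (table_alg m c) x (brk (table_alg m c) y z)"
proof -
  define P where "P = comb m e"
  have Pc: "P u $$ k = u $$ k" if "k \<in> {1..m}" for u k
    unfolding P_def comb_def using that by (simp add: coord_e if_distrib cong: if_cong)
  have P: "P u \<in> span (e ` {1..m})" for u
    unfolding P_def by (rule comb_in_span) (auto intro: span_base)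
  let ?B = "brk (table_alg m c)"
  have l: "?B (P u) v = ?B u v" and r: "?B u (P v) = ?B u v" for u v
    by (rule brk_table_restrict; simp add: Pc)+
  have "?B (?B (P x) (P y)) (P z) = ?B (?B (P x) (P z)) (P y) + ?B (P x) (?B (P y) (P z))"
    by (rule right_leibnizD(2)[OF assms]) (simp_all only: car_table_alg P)
  thus ?thesis by (simp only: l r)
qed

lemma L2_ext_leibniz:
  assumes "right_leibniz (L2_ext n r l s)"
  shows "brk (L2_ext n r l s) (brk (L2_ext n r l s) x y) z = brk (L2_ext n r l s) (brk (L2_ext n r l s) x z) y
     + brk (L2_ext n r l s) x (brk (L2_ext n r l s) y z)"
  using assms unfolding L2_ext_def by (rule leibniz_global)

text \<open>Write \<open>D = [\<cdot>, e (n+1)]\<close> and \<open>\<Lambda> = [e (n+1), \<cdot>]\<close>.  The Leibniz identity splits into the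
  coefficients of the products of the coordinates \<open>n + 1\<close> of its three arguments.\<close>

lemma right_leibniz_L2_extI:
  assumes n: "n \<ge> 4" and d: "ext_data n r l s"
  defines "D \<equiv> comb n r" and "\<Lambda> \<equiv> comb n l"
  assumes D: "\<And>x y. D (nb n x y) = nb n (D x) y + nb n x (D y)"
    and L1: "\<And>x y. nb n x (\<Lambda> y) = - nb n x (D y)" and L2: "\<And>x y. nb n (\<Lambda> x) y = - nb n (D x) y"
    and L3: "\<And>x y. \<Lambda> (nb n x y) = nb n (D y) x - nb n (D x) y"
    and s: "\<And>x. nb n x s = 0" "\<And>x. nb n s x = 0" "\<Lambda> s = 0"
    and DL: "\<And>u. D (\<Lambda> u) = \<Lambda> (D u)" "\<And>u. \<Lambda> (\<Lambda> u) = - \<Lambda> (D u)"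
  shows "right_leibniz (L2_ext n r l s)"
proof -
  have lD: "D (u + v) = D u + D v" "D (a *\<^sub>R u) = a *\<^sub>R D u"
    and lL: "\<Lambda> (u + v) = \<Lambda> u + \<Lambda> v" "\<Lambda> (a *\<^sub>R u) = a *\<^sub>R \<Lambda> u" for a u v
    unfolding D_def \<Lambda>_def by (simp_all add: linear_add[OF linear_comb] linear_scale[OF linear_comb])
  let ?B = "brk (L2_ext n r l s)"
  have B: "?B u v = nb n u v + v $$ (n + 1) *\<^sub>R D u + u $$ (n + 1) *\<^sub>R \<Lambda> v + (u $$ (n + 1) * v $$ (n + 1)) *\<^sub>R s" for u v
    unfolding D_def \<Lambda>_def by (rule brk_L2_ext)
  have B0: "?B u v $$ (n + 1) = 0" for u v
    using brk_ext_in_span[OF n d, of u v] by (simp add: mem_span_e)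
  have F0: "nb n (nb n x y) z = nb n (nb n x z) y + nb n x (nb n y z)" for x y z
    by (rule vec0_eqI) (use n in \<open>auto simp: coord_nb algebra_simps\<close>)
  have "?B (?B x y) z = ?B (?B x z) y + ?B x (?B y z)" for x y z
  proof -
    define x' y' z' where "x' = x $$ (n + 1)" and "y' = y $$ (n + 1)" and "z' = z $$ (n + 1)"
    have lhs: "?B (?B x y) z = nb n (?B x y) z + z' *\<^sub>R D (?B x y)"
      if "z' = z $$ (n + 1)" for x y z z' using that unfolding B[of "?B x y"] B0 by simp
    have rhs: "?B x (?B y z) = nb n x (?B y z) + x' *\<^sub>R \<Lambda> (?B y z)"
      unfolding B[of x "?B y z"] B0 x'_def by simp
    have Bxy: "?B x y = nb n x y + y' *\<^sub>R D x + x' *\<^sub>R \<Lambda> y + (x' * y') *\<^sub>R s"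
         "?B x z = nb n x z + z' *\<^sub>R D x + x' *\<^sub>R \<Lambda> z + (x' * z') *\<^sub>R s"
         "?B y z = nb n y z + z' *\<^sub>R D y + y' *\<^sub>R \<Lambda> z + (y' * z') *\<^sub>R s"
      unfolding x'_def y'_def z'_def by (rule B)+
    show ?thesis unfolding lhs[OF z'_def] lhs[OF y'_def] rhs unfolding Bxy nb_linear lD lL s L1 L2 L3 D DL F0[of x y z]
      by (simp add: algebra_simps)
  qed
  thus ?thesis unfolding right_leibniz_def using algebra_on_L2_ext[OF n d] by blast
qed

lemma comb_Suc: "z $$ (n + 1) = 0 \<Longrightarrow> comb (n + 1) w z = comb n w z"
proof -
  assume z: "z $$ (n + 1) = 0"
  have "{1..n + 1} = insert (n + 1) {1..n}" by auto
  thus ?thesis using z by (simp add: comb_def)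
qed

lemma L2_table_in_span: "n \<ge> 4 \<Longrightarrow> L2_table n i j \<in> span (e ` {1..n})"
  unfolding mem_span_e[OF finite_atLeastAtMost] by (simp add: coord_L2_table)

lemma L2_ext_of_basis:
  fixes L :: "('a::real_vector) alg"
  assumes n: "n \<ge> 4" and L: "algebra_on L" "dim (car L) = n + 1" "span (w ` {1..n + 1}) = car L"
    and data: "ext_data n r l s"
    and br: "\<And>i j. i \<in> {1..n} \<Longrightarrow> j \<in> {1..n} \<Longrightarrow> brk L (w i) (w j) = comb n w (L2_table n i j)"
      "\<And>i. i \<in> {1..n} \<Longrightarrow> brk L (w i) (w (n + 1)) = comb n w (r i)"
      "\<And>i. i \<in> {1..n} \<Longrightarrow> brk L (w (n + 1)) (w i) = comb n w (l i)"
      "brk L (w (n + 1)) (w (n + 1)) = comb n w s"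
  shows "L \<cong>\<^sub>L L2_ext n r l s" "inj_on (comb n w) (span (e ` {1..n}))"
    "comb (n + 1) w (brk (L2_ext n r l s) u v) = brk L (comb (n + 1) w u) (comb (n + 1) w v)"
proof -
  define c where "c = (\<lambda>i j. if i \<le> n \<and> j \<le> n then L2_table n i j
     else if i \<le> n then r i else if j \<le> n then l j else s)"
  have T: "L2_ext n r l s = table_alg (n + 1) c" unfolding L2_ext_def c_def ..
  have c: "c i j \<in> span (e ` {1..n})" if "i \<in> {1..n + 1}" "j \<in> {1..n + 1}" for i j
    using that L2_table_in_span[OF n] data unfolding c_def ext_data_def by auto
  have cz: "comb (n + 1) w z = comb n w z" if "z \<in> span (e ` {1..n})" for z
    using that by (intro comb_Suc) (simp add: mem_span_e)
  have c': "c i j \<in> span (e ` {1..n + 1})" if "i \<in> {1..n + 1}" "j \<in> {1..n + 1}" for i j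
    using c[OF that] span_e_mono[of "{1..n}" "{1..n + 1}"] by auto
  have wc: "brk L (w i) (w j) = comb (n + 1) w (c i j)" if ij: "i \<in> {1..n + 1}" "j \<in> {1..n + 1}" for i j
  proof -
    have "i = n + 1 \<or> i \<in> {1..n} \<and> i \<noteq> n + 1" "j = n + 1 \<or> j \<in> {1..n} \<and> j \<noteq> n + 1" using ij by auto
    thus ?thesis unfolding cz[OF c[OF ij]] using br by (auto simp: c_def)
  qed
  show "L \<cong>\<^sub>L L2_ext n r l s" unfolding T by (rule table_alg_iso(3)[OF L(1,3,2) c' wc])
  have "inj_on (comb (n + 1) w) (span (e ` {1..n + 1}))" by (rule table_alg_iso(1)[OF L(1,3,2) c' wc])
  hence "inj_on (comb (n + 1) w) (span (e ` {1..n}))" by (rule inj_on_subset) (rule span_e_mono, simp)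
  thus "inj_on (comb n w) (span (e ` {1..n}))" by (simp add: inj_on_def cz)
  have wL: "w ` {1..n + 1} \<subseteq> car L" using span_superset[of "w ` {1..n + 1}"] unfolding L(3) .
  show "comb (n + 1) w (brk (L2_ext n r l s) u v) = brk L (comb (n + 1) w u) (comb (n + 1) w v)"
    unfolding T by (rule comb_brk[OF L(1) wL wc])
qed

section \<open>A family containing the listed algebras\<close>

lemma nb_e2 [simp]: "n \<ge> 4 \<Longrightarrow> nb n u (e 2) = 0" "n \<ge> 4 \<Longrightarrow> nb n (e 2) u = 0"
  by (rule vec0_eqI; auto simp: coord_nb coord_e)+

lemma nb_en [simp]: "n \<ge> 4 \<Longrightarrow> nb n u (e n) = 0" "n \<ge> 4 \<Longrightarrow> nb n (e n) u = 0"
  by (rule vec0_eqI; auto simp: coord_nb coord_e)+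

lemma nb_uminus [simp]: "nb n (- u) v = - nb n u v" "nb n u (- v) = - nb n u v"
  using nb_linear(3)[where a = "-1"] nb_linear(4)[where a = "-1"] by simp_all

lemma nb_diff [simp]: "nb n (u - v) z = nb n u z - nb n v z" "nb n z (u - v) = nb n z u - nb n z v"
  unfolding diff_conv_add_uminus[of u v] by (simp_all only: nb_linear nb_uminus) simp_all

text \<open>Here \<open>\<alpha>\<close> and \<open>d k\<close> are the coordinates of \<open>[e 1, x]\<close>, and \<open>c m\<close> is the coefficient of \<open>e (i + m)\<close> in
  \<open>[e i, x]\<close>.  The families \<open>g1\<close>, \<open>g2\<close>, \<open>g3\<close> have \<open>\<alpha> = 1\<close> and \<open>c = 0\<close>, while \<open>g4\<close> has \<open>\<alpha> = 0\<close>.\<close>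

locale std_ext =
  fixes n :: nat and \<alpha> \<sigma> :: real and d c :: "nat \<Rightarrow> real" and r l :: "nat \<Rightarrow> vec0" and s :: vec0
  assumes n: "n \<ge> 4"
    and r1: "\<And>k. r 1 $$ k = (if k = 1 then \<alpha> else if 3 \<le> k \<and> k \<le> n then d k else 0)"
    and r2: "r 2 = (2 * \<alpha> + d 3) *\<^sub>R e 2"
    and r3: "\<And>i k. 3 \<le> i \<Longrightarrow> i \<le> n \<Longrightarrow>
       r i $$ k = (if k = i then \<alpha> + d 3 + (real i - 3) * \<alpha> else if i < k \<and> k \<le> n then c (k - i) else 0)"
    and l: "l 1 = - r 1" "l 2 = 0" "l 3 = - r 3" "l 4 = \<alpha> *\<^sub>R e 2 - r 4"
       "\<And>i. 5 \<le> i \<Longrightarrow> i \<le> n \<Longrightarrow> l i = - r i"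
    and s: "s = \<sigma> *\<^sub>R e n"
    and c1: "c 1 = 0" and d4: "d 4 = 0"
    and \<sigma>: "\<sigma> * (\<alpha> + d 3 + (real n - 3) * \<alpha>) = 0" "n = 4 \<Longrightarrow> \<sigma> = 0"
    and nz: "\<alpha> \<noteq> 0 \<or> d 3 \<noteq> 0"
begin

abbreviation "T \<equiv> L2_ext n r l s"
abbreviation "D \<equiv> comb n r"
abbreviation "\<Lambda> \<equiv> comb n l"
abbreviation "B \<equiv> brk T"
abbreviation "N \<equiv> span (e ` {1..n})"
text \<open>The linear form with D + \<Lambda> = \<phi> times \<open>e 2\<close>. The coefficient of
  coordinate 2 comes from \<open>l 2 = 0\<close>, that of coordinate 4 from the \<open>e 2\<close>
  term of \<open>l 4\<close>.\<close>

definition "\<phi> u = (2 * \<alpha> + d 3) * u $$ 2 + \<alpha> * u $$ 4" for u :: vec0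
text \<open>The strictly triangular part of D, a convolution with \<open>c\<close>.\<close>

definition "S u k = (\<Sum>i=3..<k. c (k - i) * u $$ i)" for u :: vec0 and k

lemma split12: "(\<Sum>i=1..n. F i) = F 1 + (F 2 + (\<Sum>i=3..n. F i))" for F :: "nat \<Rightarrow> 'b::comm_monoid_add"
proof -
  have "{1..n} = insert 1 (insert 2 {3..n})" using n by auto
  thus ?thesis by simp
qed

lemma coord_D: "D u $$ k = (if k = 1 then \<alpha> * u $$ 1 else if k = 2 then (2 * \<alpha> + d 3) * u $$ 2
  else if 3 \<le> k \<and> k \<le> n then (\<alpha> + d 3 + (real k - 3) * \<alpha>) * u $$ k + d k * u $$ 1 + S u k else 0)"
proof -
  have "D u $$ k = u $$ 1 * r 1 $$ k + (u $$ 2 * r 2 $$ k + (\<Sum>i=3..n. u $$ i * r i $$ k))"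
    unfolding comb_def by (simp add: split12)
  also have "(\<Sum>i=3..n. u $$ i * r i $$ k) =
    (\<Sum>i=3..n. (if i = k then (\<alpha> + d 3 + (real k - 3) * \<alpha>) * u $$ k else 0)
       + (if i < k then (if k \<le> n then c (k - i) * u $$ i else 0) else 0))"
    by (rule sum.cong) (auto simp: r3)
  also have "\<dots> = (if 3 \<le> k \<and> k \<le> n then (\<alpha> + d 3 + (real k - 3) * \<alpha>) * u $$ k else 0)
     + (if k \<le> n then S u k else 0)"
  proof -
    have "(\<Sum>i=3..n. if i < k then (if k \<le> n then c (k - i) * u $$ i else 0) else 0)
      = (if k \<le> n then S u k else 0)"
    proof (cases "k \<le> n")
      case True
      have "(\<Sum>i=3..n. if i < k then c (k - i) * u $$ i else 0) = S u k"
        unfolding S_def using True by (intro sum.mono_neutral_cong_right) auto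
      with True show ?thesis by (simp cong: if_cong)
    qed simp
    thus ?thesis by (simp add: sum.distrib)
  qed
  finally show ?thesis by (auto simp: r1 r2 coord_e S_def)
qed

lemma \<Lambda>_eq: "\<Lambda> u = - D u + \<phi> u *\<^sub>R e 2"
proof -
  have li: "l i = - r i + ((if i = 2 then 2 * \<alpha> + d 3 else 0) + (if i = 4 then \<alpha> else 0)) *\<^sub>R e 2" if "i \<in> {1..n}" for i
  proof -
    from that have "i = 1 \<or> i = 2 \<or> i = 3 \<or> i = 4 \<or> 5 \<le> i \<and> i \<le> n" by (simp, arith)
    then consider "i = 1" | "i = 2" | "i = 3" | "i = 4" | "5 \<le> i" "i \<le> n" by blast
    thus ?thesis by cases (simp_all add: l r2)
  qed
  have "\<Lambda> u = (\<Sum>i=1..n. - (u $$ i *\<^sub>R r i) + (u $$ i * ((if i = 2 then 2 * \<alpha> + d 3 else 0) + (if i = 4 then \<alpha> else 0))) *\<^sub>R e 2)"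
    unfolding comb_def by (rule sum.cong[OF refl]) (simp add: li algebra_simps)
  also have "\<dots> = - D u + (\<Sum>i=1..n. u $$ i * ((if i = 2 then 2 * \<alpha> + d 3 else 0) + (if i = 4 then \<alpha> else 0))) *\<^sub>R e 2"
    by (simp add: sum_subtractf comb_def scaleR_sum_left)
  also have "(\<Sum>i=1..n. u $$ i * ((if i = 2 then 2 * \<alpha> + d 3 else 0) + (if i = 4 then \<alpha> else 0))) = \<phi> u"
  proof -
    have "(\<Sum>i=1..n. u $$ i * ((if i = 2 then 2 * \<alpha> + d 3 else 0) + (if i = 4 then \<alpha> else 0)))
      = (\<Sum>i=1..n. (if i = 2 then (2 * \<alpha> + d 3) * u $$ 2 else 0) + (if i = 4 then \<alpha> * u $$ 4 else 0))"
      by (rule sum.cong) auto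
    thus ?thesis using n by (simp add: sum.distrib \<phi>_def)
  qed
  finally show ?thesis .
qed

text \<open>A convolution commutes with the shift: \<open>c (k - i)\<close> depends only on the
  difference, and the boundary term at i = 3 vanishes because products have no coordinate 3.\<close>

lemma S_nb:
  assumes "4 \<le> k" "k \<le> n"
  shows "S (nb n x y) k = S x (k - 1) * y $$ 1 - x $$ 1 * S y (k - 1)"
proof -
  obtain m where k: "k = Suc m" using assms by (cases k) auto
  with assms have m: "3 \<le> m" by simp
  have "S (nb n x y) k = c (Suc m - 3) * nb n x y $$ 3 + (\<Sum>i=Suc 3..<Suc m. c (Suc m - i) * nb n x y $$ i)"
    unfolding S_def k using m by (subst sum.atLeast_Suc_lessThan) auto
  also have "(\<Sum>i=Suc 3..<Suc m. c (Suc m - i) * nb n x y $$ i) = (\<Sum>i=3..<m. c (m - i) * nb n x y $$ (Suc i))"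
    by (subst sum.shift_bounds_Suc_ivl) simp
  also have "\<dots> = (\<Sum>i=3..<m. c (m - i) * x $$ i * y $$ 1 - x $$ 1 * (c (m - i) * y $$ i))"
    by (rule sum.cong[OF refl]) (use assms k n in \<open>auto simp: coord_nb algebra_simps\<close>)
  also have "\<dots> = S x m * y $$ 1 - x $$ 1 * S y m"
    unfolding S_def by (simp add: sum_subtractf sum_distrib_left sum_distrib_right)
  finally show ?thesis using n k by (simp add: coord_nb)
qed

lemma S_low [simp]: "S u 3 = 0" "S u 4 = 0"
proof -
  have "{3..<4} = {3::nat}" by auto
  thus "S u 3 = 0" "S u 4 = 0" by (simp_all add: S_def c1[unfolded One_nat_def])
qed

lemma ext_data: "ext_data n r l s"
proof -
  have ri: "r i \<in> N" if i: "i \<in> {1..n}" for i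
  proof -
    from i have "i = 1 \<or> i = 2 \<or> 3 \<le> i \<and> i \<le> n" by (simp, arith)
    then consider "i = 1" | "i = 2" | "3 \<le> i" "i \<le> n" by blast
    thus ?thesis
      by cases (use n in \<open>auto simp: mem_span_e r1 r2 r3 coord_e\<close>)
  qed
  have e2: "e 2 \<in> N" and en: "e n \<in> N" using n by (auto simp: mem_span_e coord_e)
  have "l i \<in> N" if i: "i \<in> {1..n}" for i
  proof -
    from i have "i = 1 \<or> i = 2 \<or> i = 3 \<or> i = 4 \<or> 5 \<le> i \<and> i \<le> n" by (simp, arith)
    then consider "i = 1" | "i = 2" | "i = 3" | "i = 4" | "5 \<le> i" "i \<le> n" by blast
    thus ?thesis
      by cases (use i in \<open>auto simp: l intro!: span_neg span_diff span_scale span_zero e2 ri\<close>)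
  qed
  with ri en show ?thesis unfolding ext_data_def s by (auto intro: span_scale)
qed

text \<open>The shift raises the weight by \<alpha>, the weight of \<open>e 1\<close>, and
  \<open>S\<close> commutes with the shift. The \<open>d (k - 1)\<close> terms of the two summands
  cancel, so D \<open>e 1\<close> may have arbitrary higher coordinates here.\<close>

lemma D_derivation: "D (nb n x y) = nb n (D x) y + nb n x (D y)"
proof (rule vec0_eqI)
  fix k
  have "k < 2 \<or> k = 2 \<or> k = 3 \<or> 4 \<le> k \<and> k \<le> n \<or> k > n \<and> k > 3" by arith
  then consider "k < 2" | "k = 2" | "k = 3" | "4 \<le> k" "k \<le> n" | "k > n" "k > 3" by blast
  thus "D (nb n x y) $$ k = (nb n (D x) y + nb n x (D y)) $$ k"
  proof cases
    case 4
    consider "k = 4" | "5 \<le> k" using 4 by linarith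
    thus ?thesis
    proof cases
      case 1
      thus ?thesis using 4 n d4 by (simp add: coord_D coord_nb algebra_simps)
    next
      case 2
      hence "real (k - 1) = real k - 1" "3 \<le> k - 1" "k - 1 \<le> n" "k - 1 \<noteq> 1" "k - 1 \<noteq> 2"
        using 4 by auto
      with 4 2 n show ?thesis using S_nb[OF 4] by (simp add: coord_D coord_nb algebra_simps)
    qed
  qed (use n in \<open>auto simp: coord_D coord_nb algebra_simps\<close>)
qed

lemma \<phi>_nb: "\<phi> (nb n x y) *\<^sub>R e 2 = nb n (D y) x + nb n x (D y)"
  by (rule vec0_eqI) (use n in \<open>auto simp: \<phi>_def coord_e coord_D coord_nb algebra_simps\<close>)

text \<open>The weights on \<open>e 2\<close> and \<open>e 4\<close> agree, and
  \<open>c 1 = 0\<close>, \<open>d 4 = 0\<close> keep all other coordinates out of the fourth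
  one.\<close>

lemma \<phi>_D: "\<phi> (D u) = (2 * \<alpha> + d 3) * \<phi> u"
  using n d4 by (simp add: \<phi>_def coord_D algebra_simps)

lemma D_linear: "D (u + v) = D u + D v" "D (u - v) = D u - D v" "D (a *\<^sub>R u) = a *\<^sub>R D u" "D (- u) = - D u"
  by (simp_all add: linear_add[OF linear_comb] linear_diff[OF linear_comb] linear_scale[OF linear_comb] linear_neg[OF linear_comb])

lemma \<phi>_linear: "\<phi> (u + v) = \<phi> u + \<phi> v" "\<phi> (u - v) = \<phi> u - \<phi> v" "\<phi> (a *\<^sub>R u) = a * \<phi> u" "\<phi> (- u) = - \<phi> u" "\<phi> (e 2) = 2 * \<alpha> + d 3"
  by (simp_all add: \<phi>_def algebra_simps coord_e)

lemma D_e2: "D (e 2) = (2 * \<alpha> + d 3) *\<^sub>R e 2"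
  using comb_e[of 2 n r] n by (simp add: r2)

lemma right_leibniz: "right_leibniz T"
proof (rule right_leibniz_L2_extI[OF n ext_data])
  show "D (nb n x y) = nb n (D x) y + nb n x (D y)" for x y by (rule D_derivation)
  show "nb n x (\<Lambda> y) = - nb n x (D y)" "nb n (\<Lambda> x) y = - nb n (D x) y" for x y
    using n by (simp_all add: \<Lambda>_eq)
  show "\<Lambda> (nb n x y) = nb n (D y) x - nb n (D x) y" for x y
    unfolding \<Lambda>_eq D_derivation \<phi>_nb by simp
  show "nb n x s = 0" "nb n s x = 0" for x using n by (simp_all add: s)
  \<comment> \<open>The conditions on \<sigma> enter here: D \<open>s\<close> is the weight of
    \<open>e n\<close> times \<open>s\<close>, and for n = 4 the form \<phi> would see
    \<open>e n\<close>.\<close>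
  show "\<Lambda> s = 0"
  proof (cases "\<sigma> = 0")
    case True
    thus ?thesis using linear_0[OF linear_comb] by (simp add: s)
  next
    case False
    have S: "S (\<sigma> *\<^sub>R e n) k = 0" if "k \<le> n" for k using that
      unfolding S_def by (intro sum.neutral) (auto simp: coord_e)
    show ?thesis
      by (rule vec0_eqI) (use False n \<sigma> S in \<open>auto simp: \<Lambda>_eq s \<phi>_def coord_D coord_e\<close>)
  qed
  show "D (\<Lambda> u) = \<Lambda> (D u)" for u
    by (simp add: \<Lambda>_eq D_linear \<phi>_D D_e2)
  show "\<Lambda> (\<Lambda> u) = - \<Lambda> (D u)" for u
    unfolding \<Lambda>_eq[of "\<Lambda> u"] by (simp add: \<Lambda>_eq D_linear \<phi>_D D_e2 \<phi>_linear)
qed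

lemma coord_B: "B u v $$ k = nb n u v $$ k + v $$ (n + 1) * D u $$ k
    + u $$ (n + 1) * (- D v $$ k + (if k = 2 then \<phi> v else 0)) + (u $$ (n + 1) * v $$ (n + 1)) * (if k = n then \<sigma> else 0)"
  by (simp add: brk_L2_ext \<Lambda>_eq s coord_e)

lemma B_in_N: "B u v \<in> N"
  by (rule brk_ext_in_span[OF n ext_data])

text \<open>The linear form \<open>f\<close> makes \<open>(f, coordinate n + 1)\<close> a homomorphism onto the two-dimensional
  nonabelian Lie algebra; this is what obstructs larger nilpotent ideals and decompositions.\<close>

definition f :: "vec0 \<Rightarrow> real" where "f u = (if \<alpha> \<noteq> 0 then u $$ 1 else u $$ 1 + u $$ 3)"
definition "\<nu> = (if \<alpha> \<noteq> 0 then \<alpha> else d 3)"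

text \<open>Products inside \<open>L2 n\<close> have no coordinates 1 and 3, while D multiplies
  \<open>f\<close> by \<nu> and \<Lambda> multiplies it by -\<nu>.\<close>

lemma f_B: "f (B u v) = \<nu> * (f u * v $$ (n + 1) - u $$ (n + 1) * f v)"
  using n by (simp add: f_def \<nu>_def coord_B coord_nb coord_D algebra_simps)

lemma \<nu>: "\<nu> \<noteq> 0" using nz by (auto simp: \<nu>_def)

lemma f_add: "f (u + v) = f u + f v" by (simp add: f_def)
lemma f_e1: "f (e 1) = 1" by (simp add: f_def coord_e)

end

section \<open>Nilradical, solvability and indecomposability of the family\<close>

lemma sub_alg_simps [simp]: "car (sub_alg L I) = I" "brk (sub_alg L I) = brk L"
  "brk_span (sub_alg L I) = brk_span L"
  by (auto simp: sub_alg_def brk_span_def fun_eq_iff)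

lemma brk_span_zero:
  assumes "\<And>x y. x \<in> A \<Longrightarrow> y \<in> B \<Longrightarrow> brk L x y = 0"
  shows "brk_span L A B = {0}"
proof -
  have "brk_span L A B \<subseteq> {0}" by (rule brk_span_subset) (auto simp: assms subspace_0)
  thus ?thesis using subspace_0[OF subspace_brk_span, of L A B] by blast
qed

lemma subspace_coords: "subspace {u :: vec0. \<forall>k. P k \<longrightarrow> u $$ k = 0}"
  by (rule subspaceI) auto

context std_ext
begin

lemma B_N: "u $$ (n + 1) = 0 \<Longrightarrow> v $$ (n + 1) = 0 \<Longrightarrow> B u v = nb n u v"
  by (simp add: brk_L2_ext)

lemma N_iff: "u \<in> N \<longleftrightarrow> (\<forall>k. k \<notin> {1..n} \<longrightarrow> u $$ k = 0)"
  by (rule mem_span_e) simp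

lemma N_coord: "u \<in> N \<Longrightarrow> u $$ (n + 1) = 0"
  by (simp add: N_iff)

lemma B_coord [simp]: "B u v $$ (n + 1) = 0"
  using B_in_N N_coord by blast

lemma N_car: "N \<subseteq> span (e ` {1..n + 1})"
  by (rule span_e_mono) auto

lemma car_N: "u \<in> span (e ` {1..n + 1}) \<Longrightarrow> u $$ (n + 1) = 0 \<Longrightarrow> u \<in> N"
  unfolding N_iff mem_span_e[OF finite_atLeastAtMost]
  by (metis Suc_eq_plus1 atLeastAtMost_iff le_Suc_eq)

lemma ideal_N: "ideal_of T N"
  unfolding ideal_of_def using N_car B_in_N by auto

text \<open>Each bracketing shifts the surviving coordinates up by one. Coordinate 2 occurs only at
  the first step, since \<open>e 2\<close> annihilates \<open>L2 n\<close>.\<close>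

lemma lower_central_N:
  "lower_central (sub_alg T N) (Suc m) \<subseteq>
    {u. \<forall>k. \<not> (m = 0 \<and> k = 2 \<or> m + 4 \<le> k \<and> k \<le> n) \<longrightarrow> u $$ k = 0}"
proof (induction m)
  case 0
  have "B x y $$ k = 0" if "x \<in> N" "y \<in> N" "k \<noteq> 2 \<and> \<not> (4 \<le> k \<and> k \<le> n)" for x y k
    using that n by (auto simp: B_N N_coord coord_nb)
  thus ?case unfolding lower_central.simps
    by (intro brk_span_subset subspace_coords) auto
next
  case (Suc m)
  have "B x y $$ k = 0" if x: "x \<in> lower_central (sub_alg T N) (Suc m)" and y: "y \<in> N"
     and k: "\<not> (Suc m + 4 \<le> k \<and> k \<le> n)" for x y k
  proof -
    have x0: "x $$ i = 0" if "\<not> (m = 0 \<and> i = 2 \<or> m + 4 \<le> i \<and> i \<le> n)" for i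
      using Suc.IH x that by blast
    have "x $$ (n + 1) = 0" "x $$ 1 = 0" by (rule x0; use n in simp)+
    moreover have "x $$ (k - 1) = 0" if "4 \<le> k" "k \<le> n" by (rule x0) (use that k in auto)
    ultimately show ?thesis using y k n by (simp add: B_N N_coord coord_nb)
  qed
  thus ?case unfolding lower_central.simps(2)[of _ "Suc m"] sub_alg_simps
    by (intro brk_span_subset subspace_coords) auto
qed

lemma nilpotent_N: "nilpotent_alg (sub_alg T N)"
proof -
  have "lower_central (sub_alg T N) (Suc n) \<subseteq> {0}"
  proof
    fix u assume "u \<in> lower_central (sub_alg T N) (Suc n)"
    hence "\<forall>k. \<not> (n = 0 \<and> k = 2 \<or> n + 4 \<le> k \<and> k \<le> n) \<longrightarrow> u $$ k = 0"
      using lower_central_N[of n] by blast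
    hence "u = 0" using n by (intro vec0_eqI) auto
    thus "u \<in> {0}" by simp
  qed
  moreover have "0 \<in> lower_central (sub_alg T N) (Suc n)"
    by (simp add: brk_span_def span_zero)
  ultimately show ?thesis unfolding nilpotent_alg_def by blast
qed

text \<open>Right multiplication by \<open>x\<close> scales \<open>f\<close> by \<nu> times
  coordinate n + 1 of \<open>x\<close> on vectors without that coordinate. If this factor is
  nonzero, iterates starting at \<open>e 1\<close> never vanish, although they descend the lower
  central series of \<open>J\<close>.\<close>

lemma nilpotent_ideal_subset:
  assumes J: "ideal_of T J" and nil: "nilpotent_alg (sub_alg T J)"
  shows "J \<subseteq> N"
proof
  fix x assume x: "x \<in> J"
  have xc: "x \<in> span (e ` {1..n + 1})" using J x unfolding ideal_of_def by auto
  show "x \<in> N"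
  proof (rule car_N[OF xc], rule ccontr)
    assume nzx: "x $$ (n + 1) \<noteq> 0"
    \<comment> \<open>One application more than the index, because \<open>e 1\<close> need not lie
      in \<open>J\<close> while [\<open>e 1\<close>,\<open>x\<close>] does.\<close>
    define y where "y k = ((\<lambda>z. B z x) ^^ Suc k) (e 1)" for k
    have e1: "e 1 \<in> span (e ` {1..n + 1})" by (rule span_base) simp
    have y: "y k \<in> lower_central (sub_alg T J) k \<and> f (y k) = (\<nu> * x $$ (n + 1)) ^ Suc k" for k
    proof (induction k)
      case 0
      have "y 0 \<in> J" using J x e1 unfolding ideal_of_def y_def by simp
      moreover have "f (y 0) = \<nu> * x $$ (n + 1)"
        using n by (simp add: y_def f_B f_e1 coord_e)
      ultimately show ?case by simp
    next
      case (Suc k)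
      have yS: "y (Suc k) = B (y k) x" by (simp add: y_def)
      have y0: "y k $$ (n + 1) = 0" by (simp add: y_def)
      have "f (y (Suc k)) = \<nu> * x $$ (n + 1) * f (y k)" unfolding yS f_B y0 by simp
      also have "\<dots> = (\<nu> * x $$ (n + 1)) ^ Suc (Suc k)" using Suc.IH by simp
      finally have "f (y (Suc k)) = (\<nu> * x $$ (n + 1)) ^ Suc (Suc k)" .
      moreover have "y (Suc k) \<in> lower_central (sub_alg T J) (Suc k)"
        unfolding lower_central.simps sub_alg_simps yS
        using Suc.IH x by (intro brk_in_brk_span) simp_all
      ultimately show ?case by blast
    qed
    obtain m where m: "lower_central (sub_alg T J) m = {0}" using nil unfolding nilpotent_alg_def by blast
    have "y m = 0" using y[of m] unfolding m by blast
    hence "f 0 = (\<nu> * x $$ (n + 1)) ^ Suc m" using y[of m] by simp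
    moreover have "f 0 = 0" by (simp add: f_def)
    ultimately have "\<nu> * x $$ (n + 1) = 0" by (metis power_not_zero)
    thus False using nzx \<nu> by simp
  qed
qed

lemma nilradical: "is_nilradical T N"
proof -
  have "maximal_nilpotent_ideal T N"
    unfolding maximal_nilpotent_ideal_def using ideal_N nilpotent_N nilpotent_ideal_subset by blast
  moreover have "M = N" if "maximal_nilpotent_ideal T M" for M
  proof -
    have "ideal_of T M" "nilpotent_alg (sub_alg T M)" using that unfolding maximal_nilpotent_ideal_def by blast+
    hence "M \<subseteq> N" by (rule nilpotent_ideal_subset)
    with that ideal_N nilpotent_N show "M = N" unfolding maximal_nilpotent_ideal_def by blast
  qed
  ultimately show ?thesis unfolding is_nilradical_def by blast
qed

lemma B_e: "i \<in> {1..n} \<Longrightarrow> j \<in> {1..n} \<Longrightarrow> B (e i) (e j) = nb n (e i) (e j)"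
  by (rule B_N) (auto simp: coord_e)

lemma standard: "standard_nilradical n T"
  unfolding standard_nilradical_def using nilradical B_e by auto

lemma sub_alg_iso: "sub_alg T N \<cong>\<^sub>L L2 n"
  unfolding alg_iso_def
  by (rule exI[of _ id]) (auto simp: B_N N_coord)

lemma solvable: "solvable_alg T"
proof -
  have 1: "derived T (Suc 0) \<subseteq> N"
    unfolding derived.simps by (rule brk_span_subset[OF subspace_span B_in_N])
  have "B x y $$ k = 0" if "x \<in> derived T (Suc 0)" "y \<in> derived T (Suc 0)" "k \<in> {1,3,n+1}" for x y k
  proof -
    have "x \<in> N" "y \<in> N" using 1 that by blast+
    thus ?thesis using n that(3) by (auto simp: B_N[OF N_coord N_coord] coord_nb)
  qed
  hence 2: "derived T (Suc (Suc 0)) \<subseteq> {u. \<forall>k. k \<in> {1,3,n+1} \<longrightarrow> u $$ k = 0}"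
    unfolding derived.simps(2)[of T "Suc 0"]
    by (intro brk_span_subset[OF subspace_coords]) blast
  have "B x y = 0" if "x \<in> derived T (Suc (Suc 0))" "y \<in> derived T (Suc (Suc 0))" for x y
  proof -
    have "x $$ k = 0" "y $$ k = 0" if "k \<in> {1,3,n+1}" for k
      using subsetD[OF 2 \<open>x \<in> derived T (Suc (Suc 0))\<close>] subsetD[OF 2 \<open>y \<in> derived T (Suc (Suc 0))\<close>] that by blast+
    thus ?thesis using n by (intro vec0_eqI) (auto simp: B_N coord_nb)
  qed
  hence "derived T (Suc (Suc (Suc 0))) = {0}" unfolding derived.simps(2)[of T "Suc (Suc 0)"] by (rule brk_span_zero)
  thus ?thesis unfolding solvable_alg_def by blast
qed

lemma e_car: "i \<in> {1..n + 1} \<Longrightarrow> e i \<in> car T"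
  by (simp add: span_base)

lemma f_zero: "f 0 = 0" by (simp add: f_def)

text \<open>The ideals annihilate each other, so \<open>f_B\<close> makes the pairs
  (\<open>f\<close>, coordinate n + 1) on \<open>I\<close> and on \<open>J\<close> proportional.
  This places \<open>J\<close> in the kernel of \<open>f\<close> inside N. The cases \<alpha>
  \<noteq> 0 and \<alpha> = 0 then finish differently.\<close>

lemma decomposition_trivial:
  assumes I: "ideal_of T I" and J: "ideal_of T J" and IJ: "I \<inter> J = {0}"
    and sum: "{x + y | x y. x \<in> I \<and> y \<in> J} = car T"
    and x: "x \<in> I" "x $$ (n + 1) \<noteq> 0"
  shows "J = {0}"
proof -
  have sub: "subspace I" "subspace J" and IN: "I \<subseteq> car T" "J \<subseteq> car T"
    using I J unfolding ideal_of_def by blast+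
  have zero: "B u v = 0" "B v u = 0" if "u \<in> I" "v \<in> J" for u v
  proof -
    have "u \<in> car T" "v \<in> car T" using that IN by blast+
    hence "B u v \<in> I \<inter> J" "B v u \<in> I \<inter> J" using that I J unfolding ideal_of_def by blast+
    thus "B u v = 0" "B v u = 0" using IJ by blast+
  qed
  have fz: "f u * v $$ (n + 1) = u $$ (n + 1) * f v" if "u \<in> I" "v \<in> J" for u v
    using f_B[of u v] zero[OF that] \<nu> by (simp add: f_zero)
  have dec: "\<exists>i\<in>I. \<exists>j\<in>J. z = i + j" if "z \<in> car T" for z
    using that unfolding sum[symmetric] by blast
  have J1: "v $$ (n + 1) = 0 \<and> f v = 0" if v: "v \<in> J" for v
  proof -
    define t where "t = f x / x $$ (n + 1)"
    have fJ: "f w = w $$ (n + 1) * t" if "w \<in> J" for w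
      using fz[OF x(1) that] x(2) by (simp add: t_def field_simps)
    have "v $$ (n + 1) = 0"
    \<comment> \<open>Otherwise all of \<open>I\<close> and \<open>J\<close>, hence the whole
      algebra, would satisfy \<open>f\<close> = t times coordinate n + 1, which fails at
      \<open>e 1\<close>.\<close>
    proof (rule ccontr)
      assume v': "v $$ (n + 1) \<noteq> 0"
      have fI: "f w = w $$ (n + 1) * t" if "w \<in> I" for w
        using fz[OF that v] fJ[OF v] v' by simp
      obtain i j where ij: "i \<in> I" "j \<in> J" "e 1 = i + j"
        using dec[OF e_car[of 1]] by auto
      have "f (e 1) = e 1 $$ (n + 1) * t"
        unfolding ij(3) using fI[OF ij(1)] fJ[OF ij(2)] by (simp add: f_add algebra_simps)
      thus False using f_e1 n by (simp add: coord_e)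
    qed
    thus ?thesis using fJ[OF v] by simp
  qed
  have Jc: "v $$ k = 0" if "v \<in> J" "k \<notin> {1..n}" for v k
    using J1[OF that(1)] that IN(2) car_N[of v] N_iff[of v] by auto
  show ?thesis
  proof (cases "\<alpha> = 0")
    case False
    hence J2: "v $$ 1 = 0" if "v \<in> J" for v using J1[OF that] by (simp add: f_def)
    have ab: "B u v = 0" if "u \<in> J" "v \<in> J" for u v
      using that J1 J2 n by (intro vec0_eqI) (auto simp: B_N coord_nb)
    \<comment> \<open>Since \<open>J\<close> is abelian and annihilated by \<open>I\<close>, all
      brackets of the algebra lie in \<open>I\<close>. This captures \<open>e 2\<close> and
      \<open>e n\<close>, and what commutes with \<open>e 1\<close> in \<open>J\<close> is a
      combination of these two.\<close>
    have sq: "B (i + j) (i' + j') \<in> I" if "i \<in> I" "j \<in> J" "i' \<in> I" "j' \<in> J" for i j i' j'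
    proof -
      have "i' \<in> car T" using that IN by blast
      hence "B i i' \<in> I" using I that unfolding ideal_of_def by blast
      moreover have "B (i + j) (i' + j') = B i i'"
        using zero ab that by (simp add: L2_ext_def)
      ultimately show ?thesis by simp
    qed
    have inI: "B z z' \<in> I" if "z \<in> car T" "z' \<in> car T" for z z'
      using dec[OF that(1)] dec[OF that(2)] sq by blast
    have eI: "e 2 \<in> I" "e n \<in> I"
    proof -
      have "B (e 1) (e 1) = e 2"
        by (rule vec0_eqI) (use n in \<open>auto simp: B_e coord_nb coord_e\<close>)
      moreover have "B (e (n - 1)) (e 1) = e n"
        by (rule vec0_eqI) (use n in \<open>auto simp: B_e coord_nb coord_e\<close>)
      moreover have "B (e 1) (e 1) \<in> I" "B (e (n - 1)) (e 1) \<in> I"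
        by (rule inI; rule e_car; use n in auto)+
      ultimately show "e 2 \<in> I" "e n \<in> I" by simp_all
    qed
    have "v = 0" if v: "v \<in> J" for v
    proof -
      obtain i j where ij: "i \<in> I" "j \<in> J" "e 1 = i + j"
        using dec[OF e_car[of 1]] by auto
      have "B v (e 1) = 0" unfolding ij(3) using zero(2)[OF ij(1) v] ab[OF v ij(2)] by (simp add: L2_ext_def)
      hence *: "nb n v (e 1) = 0" using J1[OF v] n by (subst (asm) B_N) (auto simp: coord_e)
      have mid: "v $$ k = 0" if "3 \<le> k" "k \<le> n - 1" for k
        using arg_cong[OF *, of "\<lambda>u. u $$ (Suc k)"] that n J2[OF v] by (auto simp: coord_nb coord_e split: if_splits)
      have "v = v $$ 2 *\<^sub>R e 2 + v $$ n *\<^sub>R e n"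
      proof (rule vec0_eqI)
        fix k
        have "k = 0 \<or> k = 1 \<or> k = 2 \<or> 3 \<le> k \<and> k \<le> n - 1 \<or> k = n \<or> k > n" by arith
        thus "v $$ k = (v $$ 2 *\<^sub>R e 2 + v $$ n *\<^sub>R e n) $$ k"
          using n mid[of k] Jc[OF v, of k] J2[OF v] by (auto simp: coord_e)
      qed
      also have "\<dots> \<in> I" using eI sub(1) by (intro subspace_add subspace_scale)
      finally show ?thesis using v IJ by blast
    qed
    thus ?thesis using subspace_0[OF sub(2)] by blast
  next
    case True
    hence d3: "d 3 \<noteq> 0" using nz by simp
    have J2: "v $$ 3 = - v $$ 1" if "v \<in> J" for v using J1[OF that] True unfolding f_def by simp
    obtain i j where ij: "i \<in> I" "j \<in> J" "e (n + 1) = i + j"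
      using dec[OF e_car[of "n + 1"]] by auto
    \<comment> \<open>The \<open>I\<close>-part of \<open>e (n + 1)\<close> acts trivially on
      \<open>J\<close>, so D restricted to \<open>J\<close> is right multiplication by an element of
      \<open>J\<close>.\<close>
    have D_eq: "D v = nb n v j" if v: "v \<in> J" for v
    proof -
      have "B v (e (n + 1)) = B v j" unfolding ij(3) using zero(2)[OF ij(1) v] by (simp add: L2_ext_def)
      moreover have "B v (e (n + 1)) = D v"
        using J1[OF v] n by (intro vec0_eqI) (auto simp: coord_B coord_nb coord_e)
      ultimately show ?thesis using J1[OF v] J1[OF ij(2)] by (simp add: B_N)
    qed
    have J3: "v $$ 2 = 0" if v: "v \<in> J" for v
      using arg_cong[OF D_eq[OF v], of "\<lambda>u. u $$ 2"] d3 n J2[OF ij(2)] True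
      by (auto simp: coord_nb coord_D)
    \<comment> \<open>Coordinate 2 of [v,\<open>e 1\<close>] is coordinate 1 of v, and
      [v,\<open>e 1\<close>] lies in \<open>J\<close>, where \<open>J3\<close> applies.\<close>
    have J4: "v $$ 1 = 0" if v: "v \<in> J" for v
    proof -
      have "e 1 \<in> car T" by (rule e_car) simp
      hence "B v (e 1) \<in> J" using J v unfolding ideal_of_def by blast
      hence "B v (e 1) $$ 2 = 0" by (rule J3)
      thus ?thesis using J1[OF v] n by (subst (asm) B_N) (auto simp: coord_nb coord_e)
    qed
    have "v = 0" if v: "v \<in> J" for v
    proof -
      \<comment> \<open>With coordinates 1 gone the inner action vanishes, whereas D is triangular
        with diagonal entry \<open>d 3\<close> \<noteq> 0 on \<open>e 3\<close>, ...,
        \<open>e n\<close>.\<close>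
      have D0: "D v $$ k = 0" for k
        unfolding D_eq[OF v] using J4[OF v] J4[OF ij(2)] n by (auto simp: coord_nb)
      have "v $$ k = 0" for k
      proof (induction k rule: less_induct)
        case (less k)
        show ?case
        proof (cases "3 \<le> k \<and> k \<le> n")
          case True
          have "S v k = 0" unfolding S_def using less by (intro sum.neutral) auto
          with D0[of k] True d3 \<open>\<alpha> = 0\<close> J4[OF v] show ?thesis by (auto simp: coord_D)
        next
          case False
          hence "k \<notin> {1..n} \<or> k = 1 \<or> k = 2" by (simp, arith)
          thus ?thesis using Jc[OF v, of k] J3[OF v] J4[OF v] by blast
        qed
      qed
      thus ?thesis by (intro vec0_eqI) simp
    qed
    thus ?thesis using subspace_0[OF sub(2)] by blast
  qed
qed

lemma indecomposable: "indecomposable T"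
proof -
  have False if I: "ideal_of T I" and J: "ideal_of T J" and nz: "I \<noteq> {0}" "J \<noteq> {0}"
    and IJ: "I \<inter> J = {0}" and sum: "{x + y | x y. x \<in> I \<and> y \<in> J} = car T" for I J
  proof -
    have sum': "{x + y | x y. x \<in> J \<and> y \<in> I} = car T"
    proof -
      have "{x + y | x y. x \<in> J \<and> y \<in> I} = {x + y | x y. x \<in> I \<and> y \<in> J}"
        by (auto; metis add.commute)
      thus ?thesis using sum by simp
    qed
    have "e (n + 1) \<in> car T" by (rule e_car) simp
    then obtain i j where ij: "i \<in> I" "j \<in> J" "e (n + 1) = i + j" unfolding sum[symmetric] by blast
    hence "i $$ (n + 1) + j $$ (n + 1) = 1" by (metis coord_e coord_simps(1))
    then consider "i $$ (n + 1) \<noteq> 0" | "j $$ (n + 1) \<noteq> 0" by fastforce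
    thus False
    proof cases
      case 1
      thus ?thesis using decomposition_trivial[OF I J IJ sum ij(1)] nz by blast
    next
      case 2
      thus ?thesis using decomposition_trivial[OF J I _ sum' ij(2)] nz IJ by blast
    qed
  qed
  thus ?thesis unfolding indecomposable_def by blast
qed

lemma extension: "solvable_L2_extension n T"
  unfolding solvable_L2_extension_def
  using right_leibniz solvable indecomposable nilradical sub_alg_iso dim_span_e[of "{1..n + 1}"] by auto

end

section \<open>Derived and lower central series\<close>

text \<open>Back substitution from k = n downwards: the given vector with leading coordinate k is
  corrected by the basis vectors already obtained.\<close>

lemma e_in_subspace_triangular:
  assumes V: "subspace V"
    and tri: "\<And>k. m \<le> k \<Longrightarrow> k \<le> n \<Longrightarrow> \<exists>u\<in>V. u $$ k \<noteq> 0 \<and> (\<forall>j. j \<notin> {k..n} \<longrightarrow> u $$ j = 0)"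
    and k: "m \<le> k" "k \<le> n"
  shows "e k \<in> V"
  using k
proof (induction "n - k" arbitrary: k rule: less_induct)
  case less
  obtain u where u: "u \<in> V" "u $$ k \<noteq> 0" "\<And>j. j \<notin> {k..n} \<Longrightarrow> u $$ j = 0" using tri less.prems by blast
  have ej: "e j \<in> V" if "j \<in> {k<..n}" for j using less that by auto
  define w where "w = (\<Sum>j\<in>{k<..n}. u $$ j *\<^sub>R e j)"
  have w: "w \<in> V" unfolding w_def using ej V by (intro subspace_sum subspace_scale)
  have wc: "w $$ j = (if j \<in> {k<..n} then u $$ j else 0)" for j
    unfolding w_def by (simp add: coord_e if_distrib cong: if_cong)
  have "e k = (1 / u $$ k) *\<^sub>R (u - w)"
  proof (rule vec0_eqI)
    fix j
    have "j = k \<or> j \<in> {k<..n} \<or> j \<notin> {k..n}" by auto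
    thus "e k $$ j = ((1 / u $$ k) *\<^sub>R (u - w)) $$ j"
      using u(2) u(3)[of j] less.prems by (auto simp: wc coord_e)
  qed
  also have "\<dots> \<in> V" using V u(1) w by (intro subspace_scale subspace_diff)
  finally show ?case .
qed

lemma dim_zero: "dim {0 :: 'a::real_vector} = 0"
  using dim_span_eq_card_independent[OF independent_empty, where 'a = 'a] by (simp add: span_empty del: dim_span)

lemma stable_DS:
  assumes "derived L (Suc 0) = V1" "brk_span L V1 V1 = V2" "brk_span L V2 V2 = {0}"
  shows "has_DS L [dim (car L), dim V1, dim V2, 0]"
proof -
  have d: "derived L (Suc (Suc 0)) = V2" using assms(1,2) by (metis derived.simps(2))
  have z: "derived L (Suc (Suc (Suc k))) = {0}" for k
  proof (induction k)
    case 0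
    show ?case using d assms(3) by (metis derived.simps(2))
  next
    case (Suc k)
    have "0 \<in> V2" unfolding assms(2)[symmetric] by (rule subspace_0[OF subspace_brk_span])
    hence "brk L 0 0 \<in> {0}" unfolding assms(3)[symmetric] by (intro brk_in_brk_span)
    hence "brk_span L {0} {0} = {0}" by (intro brk_span_zero) simp
    thus ?case unfolding derived.simps(2)[of L "Suc (Suc (Suc k))"] Suc.IH .
  qed
  have "dim (derived L k) = (if k < 4 then [dim (car L), dim V1, dim V2, 0] ! k else 0)" for k
  proof -
    consider "k = 0" | "k = Suc 0" | "k = Suc (Suc 0)" | j where "k = Suc (Suc (Suc j))"
      by (metis not0_implies_Suc)
    thus ?thesis
    proof cases
      case (4 j)
      thus ?thesis unfolding 4 z dim_zero by (cases j) auto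
    qed (simp_all add: d assms(1) del: derived.simps(2))
  qed
  thus ?thesis by (simp add: has_DS_def stable_list_def)
qed

text \<open>\<open>stable_DS\<close> with second term {0} ends in a doubled 0, which denotes the
  same sequence.\<close>

lemma stable_DS2:
  assumes "derived L (Suc 0) = V1" "brk_span L V1 V1 = {0}"
  shows "has_DS L [dim (car L), dim V1, 0]"
proof -
  have "0 \<in> V1" unfolding assms(1)[symmetric] derived.simps by (rule subspace_0[OF subspace_brk_span])
  hence "brk L 0 0 \<in> {0}" unfolding assms(2)[symmetric] by (intro brk_in_brk_span)
  hence "brk_span L {0} {0} = {0}" by (intro brk_span_zero) simp
  with assms have "has_DS L [dim (car L), dim V1, dim {0::'a}, 0]" by (intro stable_DS)
  thus ?thesis unfolding has_DS_def stable_list_def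
    by (auto simp: nth_Cons' dim_zero split: if_splits)
qed

lemma stable_LS:
  assumes "lower_central L (Suc 0) = V" "brk_span L V (car L) = V"
  shows "has_LS L [dim (car L), dim V, dim V]"
proof -
  have z: "lower_central L (Suc k) = V" for k
  proof (induction k)
    case (Suc k)
    thus ?case unfolding lower_central.simps(2)[of L "Suc k"] Suc.IH assms(2) by simp
  qed (rule assms(1))
  have "dim (lower_central L k) = (if k < 3 then [dim (car L), dim V, dim V] ! k else dim V)" for k
  proof -
    consider "k = 0" | "k = Suc 0" | "k = Suc (Suc 0)" | j where "k = Suc (Suc (Suc j))"
      by (metis not0_implies_Suc)
    thus ?thesis by cases (simp_all add: z del: lower_central.simps(2))
  qed
  thus ?thesis by (simp add: has_LS_def stable_list_def)
qed

context std_ext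
begin

abbreviation "W \<equiv> span (e ` ({1..n} - {1,3}))"

lemma B_ex: "i \<in> {1..n} \<Longrightarrow> B (e i) (e (n + 1)) = r i"
  by (rule vec0_eqI) (use n in \<open>auto simp: brk_L2_ext comb_e coord_e coord_nb\<close>)

lemma B_ee: "B (e 1) (e 1) = e 2" "4 \<le> k \<Longrightarrow> k \<le> n \<Longrightarrow> B (e (k - 1)) (e 1) = e k"
proof -
  show "B (e 1) (e 1) = e 2" by (rule vec0_eqI) (use n in \<open>auto simp: B_e coord_nb coord_e\<close>)
  assume k: "4 \<le> k" "k \<le> n"
  hence "B (e (k - 1)) (e 1) = nb n (e (k - 1)) (e 1)" by (intro B_e) auto
  also have "\<dots> = e k" by (rule vec0_eqI) (use n k in \<open>auto simp: coord_nb coord_e\<close>)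
  finally show "B (e (k - 1)) (e 1) = e k" .
qed

lemma mem_W: "u \<in> W \<longleftrightarrow> (\<forall>k. k \<notin> {1..n} - {1,3} \<longrightarrow> u $$ k = 0)"
  by (rule mem_span_e) simp

lemma dim_car: "dim (car T) = n + 1" using dim_span_e[of "{1..n + 1}"] by simp
lemma dim_N: "dim N = n" using dim_span_e[of "{1..n}"] by simp

lemma dim_W: "dim W = n - 2"
proof -
  have "card ({1..n} - {1,3}) = n - 2" using n by (subst card_Diff_subset) auto
  thus ?thesis using dim_span_e[of "{1..n} - {1,3}"] by simp
qed

lemma W_subset: "subspace V \<Longrightarrow> B (e 1) (e 1) \<in> V \<Longrightarrow> (\<And>k. 4 \<le> k \<Longrightarrow> k \<le> n \<Longrightarrow> B (e (k - 1)) (e 1) \<in> V) \<Longrightarrow> W \<subseteq> V"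
proof (rule span_minimal)
  assume V: "B (e 1) (e 1) \<in> V" "\<And>k. 4 \<le> k \<Longrightarrow> k \<le> n \<Longrightarrow> B (e (k - 1)) (e 1) \<in> V"
  show "e ` ({1..n} - {1, 3}) \<subseteq> V"
  proof safe
    fix k assume "k \<in> {1..n}" "e k \<notin> V" "k \<noteq> 1"
    show "k = 3"
    proof (rule ccontr)
      assume "k \<noteq> 3"
      hence "k = 2 \<or> 4 \<le> k \<and> k \<le> n" using \<open>k \<in> {1..n}\<close> \<open>k \<noteq> 1\<close> by (simp, arith)
      thus False using V B_ee \<open>e k \<notin> V\<close> by auto
    qed
  qed
qed

lemma e_N: "i \<in> {1..n} \<Longrightarrow> e i \<in> N" by (simp add: span_base)

text \<open>Brackets in N give \<open>W\<close>. The missing \<open>e 3\<close> and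
  \<open>e 1\<close> come from \<open>r 3\<close> and \<open>r 1\<close>, whose leading coefficients
  are the two quantities assumed nonzero.\<close>

lemma series_nondegenerate:
  assumes "\<alpha> \<noteq> 0" "\<alpha> + d 3 \<noteq> 0"
  shows "has_DS T [n + 1, n, n - 2, 0]" "has_LS T [n + 1, n, n]"
proof -
  let ?V = "brk_span T N (car T)"
  have sV: "subspace ?V" by (rule subspace_brk_span)
  have WV: "W \<subseteq> ?V"
    by (rule W_subset[OF sV]; rule brk_in_brk_span; (rule e_N | rule e_car); use n in auto)
  have rV: "r i \<in> ?V" if "i \<in> {1..n}" for i
    using brk_in_brk_span[OF e_N[OF that] e_car[of "n + 1"], of T] B_ex[OF that] by simp
  have "r 3 - (\<alpha> + d 3) *\<^sub>R e 3 \<in> W" unfolding mem_W using n by (auto simp: r3 coord_e)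
  moreover have "r 3 \<in> ?V" by (rule rV) (use n in simp)
  ultimately have "(\<alpha> + d 3) *\<^sub>R e 3 \<in> ?V" using subspace_diff[OF sV _ subsetD[OF WV], of "r 3" "r 3 - (\<alpha> + d 3) *\<^sub>R e 3"] by simp
  hence e3: "e 3 \<in> ?V" using assms subspace_scale[OF sV, of _ "1 / (\<alpha> + d 3)"] by fastforce
  have "r 1 - \<alpha> *\<^sub>R e 1 - d 3 *\<^sub>R e 3 \<in> W" unfolding mem_W using n by (auto simp: r1 coord_e)
  hence "r 1 - \<alpha> *\<^sub>R e 1 - d 3 *\<^sub>R e 3 + d 3 *\<^sub>R e 3 \<in> ?V"
    using WV sV e3 by (intro subspace_add subspace_scale) blast+
  moreover have "r 1 \<in> ?V" by (rule rV) (use n in simp)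
  ultimately have "\<alpha> *\<^sub>R e 1 \<in> ?V" using subspace_diff[OF sV, of "r 1" "r 1 - \<alpha> *\<^sub>R e 1"] by simp
  hence e1: "e 1 \<in> ?V" using assms subspace_scale[OF sV, of _ "1 / \<alpha>"] by fastforce
  have "N \<subseteq> ?V"
  proof (rule span_minimal[OF _ sV])
    show "e ` {1..n} \<subseteq> ?V"
    proof safe
      fix k assume "k \<in> {1..n}"
      thus "e k \<in> ?V"
        using e1 e3 WV span_base[of "e k" "e ` ({1..n} - {1,3})"] by (cases "k = 1 \<or> k = 3") auto
    qed
  qed
  moreover have "?V \<subseteq> N" by (rule brk_span_subset[OF subspace_span B_in_N])
  ultimately have V: "?V = N" by blast
  have C: "brk_span T (car T) (car T) = N"
  proof
    show "brk_span T (car T) (car T) \<subseteq> N" by (rule brk_span_subset[OF subspace_span B_in_N])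
    have "?V \<subseteq> brk_span T (car T) (car T)" using N_car by (intro brk_span_mono) simp_all
    thus "N \<subseteq> brk_span T (car T) (car T)" unfolding V .
  qed
  have NN: "brk_span T N N = W"
  proof
    show "brk_span T N N \<subseteq> W"
      by (rule brk_span_subset[OF subspace_span])
        (use n in \<open>auto simp: mem_W B_N[OF N_coord N_coord] coord_nb\<close>)
    show "W \<subseteq> brk_span T N N"
      by (rule W_subset[OF subspace_brk_span]; rule brk_in_brk_span; rule e_N; use n in auto)
  qed
  have WW: "brk_span T W W = {0}"
  proof (rule brk_span_zero)
    fix x y assume xy: "x \<in> W" "y \<in> W"
    have "x $$ k = 0" "y $$ k = 0" if "k \<in> {1,3,n+1}" for k using xy that by (auto simp: mem_W)
    thus "B x y = 0" using n by (intro vec0_eqI) (auto simp: B_N coord_nb)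
  qed
  have "derived T (Suc 0) = N" using C by simp
  from stable_DS[OF this NN WW] show "has_DS T [n + 1, n, n - 2, 0]" by (simp only: dim_car dim_N dim_W)
  have "lower_central T (Suc 0) = N" using C by simp
  from stable_LS[OF this V] show "has_LS T [n + 1, n, n]" by (simp only: dim_car dim_N)
qed

text \<open>The kernel in N of the form u_1 + u_3, which annihilates every bracket when the weight
  \<alpha> + \<open>d 3\<close> of \<open>e 3\<close> is 0.\<close>

abbreviation "U \<equiv> span (insert (e 1 - e 3) (e ` ({1..n} - {1,3})))"

lemma mem_U: "u \<in> U \<longleftrightarrow> u \<in> N \<and> u $$ 1 + u $$ 3 = 0"
proof
  assume "u \<in> U"
  then obtain t where "u - t *\<^sub>R (e 1 - e 3) \<in> W" unfolding span_insert by blast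
  hence *: "u $$ k = t * (e 1 $$ k - e 3 $$ k)" if "k \<notin> {1..n} - {1,3}" for k
    using that unfolding mem_W by force
  have "u $$ k = 0" if "k \<notin> {1..n}" for k using *[of k] that n by (auto simp: coord_e)
  moreover have "u $$ 1 + u $$ 3 = 0" using *[of 1] *[of 3] by (simp add: coord_e)
  ultimately show "u \<in> N \<and> u $$ 1 + u $$ 3 = 0" unfolding N_iff by blast
next
  assume u: "u \<in> N \<and> u $$ 1 + u $$ 3 = 0"
  have "u - u $$ 1 *\<^sub>R (e 1 - e 3) \<in> W" unfolding mem_W
    using u n by (auto simp: N_iff coord_e)
  thus "u \<in> U" unfolding span_insert by blast
qed

lemma dim_U: "dim U = n - 1"
proof -
  have notin: "e 1 - e 3 \<notin> W"
  proof
    assume "e 1 - e 3 \<in> W"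
    hence "(e 1 - e 3) $$ 1 = 0" unfolding mem_W by blast
    thus False by (simp add: coord_e)
  qed
  have "independent (insert (e 1 - e 3) (e ` ({1..n} - {1,3})))"
    by (rule independent_insertI[OF notin]) (rule independent_e, simp)
  hence "dim U = card (insert (e 1 - e 3) (e ` ({1..n} - {1,3})))"
    by (rule dim_span_eq_card_independent)
  also have "\<dots> = Suc (card (e ` ({1..n} - {1,3})))"
    using notin span_base[of "e 1 - e 3" "e ` ({1..n} - {1,3})"] by (intro card_insert_disjoint) auto
  also have "card (e ` ({1..n} - {1,3})) = card ({1..n} - {1,3})"
    by (rule card_image) (rule inj_on_subset[OF inj_e], simp)
  also have "card ({1..n} - {1,3}) = n - 2" using n by (subst card_Diff_subset) auto
  finally show ?thesis using n by simp
qed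

text \<open>With weight 0 on \<open>e 3\<close>, D sends \<open>e 1\<close> to \<alpha>
  (\<open>e 1\<close> - \<open>e 3\<close>) modulo \<open>W\<close>, so \<open>e 3\<close> is never
  reached by itself and the first derived algebra drops to \<open>U\<close>. This is the case a = 1
  of \<open>g1\<close>.\<close>

lemma series_degenerate:
  assumes "\<alpha> \<noteq> 0" "\<alpha> + d 3 = 0"
  shows "has_DS T [n + 1, n - 1, n - 4, 0]" "has_LS T [n + 1, n - 1, n - 1]"
proof -
  let ?V = "brk_span T U (car T)"
  let ?W5 = "span (e ` {5..n})"
  have d3: "d 3 = - \<alpha>" using assms by simp
  have sV: "subspace ?V" by (rule subspace_brk_span)
  have UN: "U \<subseteq> N" using mem_U by blast
  have eU: "e k \<in> U" if "k \<in> {1..n} - {1,3}" for k using that by (simp add: span_base)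
  have CU: "brk_span T (car T) (car T) \<subseteq> U"
  proof (rule brk_span_subset[OF subspace_span])
    fix x y
    show "B x y \<in> U" unfolding mem_U using B_in_N n d3
      by (simp add: coord_B coord_nb coord_D algebra_simps)
  qed
  have rV: "r i \<in> ?V" if "i \<in> {1..n} - {1,3}" for i
    using brk_in_brk_span[OF eU[OF that] e_car[of "n + 1"], of T] B_ex[of i] that by simp
  have "(1 / \<alpha>) *\<^sub>R r 2 \<in> ?V" using sV rV[of 2] n by (intro subspace_scale) auto
  hence e2: "e 2 \<in> ?V" using assms by (simp add: r2 d3)
  have e4: "e k \<in> ?V" if "4 \<le> k" "k \<le> n" for k
  proof (rule e_in_subspace_triangular[OF sV _ that])
    fix k assume k: "4 \<le> k" "k \<le> n"
    show "\<exists>u\<in>?V. u $$ k \<noteq> 0 \<and> (\<forall>j. j \<notin> {k..n} \<longrightarrow> u $$ j = 0)"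
      by (rule bexI[of _ "r k"]) (use k assms rV[of k] in \<open>auto simp: r3 d3\<close>)
  qed
  have WV: "W \<subseteq> ?V"
  proof (rule span_minimal[OF _ sV], safe)
    fix k assume "k \<in> {1..n}" "e k \<notin> ?V" "k \<noteq> 1"
    hence "k = 2 \<or> 3 = k \<or> 4 \<le> k \<and> k \<le> n" by (simp, arith)
    thus "k = 3" using e2 e4 \<open>e k \<notin> ?V\<close> by blast
  qed
  have e13: "e 1 - e 3 \<in> U" by (simp add: span_base)
  have "r 1 - r 3 \<in> ?V"
  proof -
    have "B (e 1 - e 3) (e (n + 1)) = r 1 - r 3"
      using n B_ex[of 1] B_ex[of 3] table_alg_brk_add(1)[of "n + 1" _ "e 1 - e 3" "e 3" "e (n + 1)"]
      unfolding L2_ext_def by (auto simp: algebra_simps)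
    thus ?thesis using brk_in_brk_span[OF e13 e_car[of "n + 1"], of T] by simp
  qed
  moreover have "r 1 - r 3 - \<alpha> *\<^sub>R (e 1 - e 3) \<in> W" unfolding mem_W using n d3
    by (auto simp: r1 r3 coord_e)
  ultimately have "\<alpha> *\<^sub>R (e 1 - e 3) \<in> ?V"
    using subspace_diff[OF sV _ subsetD[OF WV], of "r 1 - r 3" "r 1 - r 3 - \<alpha> *\<^sub>R (e 1 - e 3)"] by simp
  hence "e 1 - e 3 \<in> ?V" using assms subspace_scale[OF sV, of _ "1 / \<alpha>"] by fastforce
  hence "U \<subseteq> ?V" using WV span_superset[of "e ` ({1..n} - {1,3})"] by (intro span_minimal[OF _ sV]) auto
  moreover have VC: "?V \<subseteq> brk_span T (car T) (car T)" using UN N_car by (intro brk_span_mono) auto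
  ultimately have V: "?V = U" and C: "brk_span T (car T) (car T) = U" using CU by blast+
  have UU: "brk_span T U U = ?W5"
  proof
    show "brk_span T U U \<subseteq> ?W5"
    proof (rule brk_span_subset[OF subspace_span])
      fix x y assume "x \<in> U" "y \<in> U"
      hence "x $$ 3 = - x $$ 1" "y $$ 3 = - y $$ 1" "B x y = nb n x y"
        by (auto simp: mem_U B_N N_coord)
      \<comment> \<open>On \<open>U\<close> coordinate 2 of a product vanishes because y_1 + y_3 =
        0, and coordinate 4 equals x_3 y_1 - x_1 y_3 = 0; only coordinates from 5 on remain.\<close>
      moreover have "k - 1 = 3" if "4 \<le> k" "\<not> 5 \<le> k" for k :: nat using that by simp
      ultimately show "B x y \<in> ?W5" using n by (auto simp: mem_span_e coord_nb)
    qed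
    show "?W5 \<subseteq> brk_span T U U"
    proof (rule span_minimal[OF _ subspace_brk_span], safe)
      fix k assume k: "k \<in> {5..n}"
      have "B (e (k - 1)) (e 1 - e 3) = e k"
      proof -
        have "B (e (k - 1)) (e 1 - e 3) = nb n (e (k - 1)) (e 1 - e 3)"
          by (rule B_N) (use k in \<open>auto simp: coord_e\<close>)
        also have "\<dots> = e k" using k n by (intro vec0_eqI) (auto simp: coord_nb coord_e)
        finally show ?thesis .
      qed
      moreover have "e (k - 1) \<in> U" by (rule eU) (use k in auto)
      ultimately show "e k \<in> brk_span T U U" using brk_in_brk_span[OF _ e13, of "e (k - 1)" U T] by simp
    qed
  qed
  have WW: "brk_span T ?W5 ?W5 = {0}"
  proof (rule brk_span_zero)
    fix x y assume xy: "x \<in> ?W5" "y \<in> ?W5"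
    have "x $$ k = 0" "y $$ k = 0" if "k \<in> {1,3,n+1}" for k using xy that by (auto simp: mem_span_e)
    thus "B x y = 0" using n by (intro vec0_eqI) (auto simp: B_N coord_nb)
  qed
  have d5: "dim ?W5 = n - 4" using dim_span_e[of "{5..n}"] by simp
  have "derived T (Suc 0) = U" using C by simp
  from stable_DS[OF this UU WW] show "has_DS T [n + 1, n - 1, n - 4, 0]" by (simp only: dim_car dim_U d5)
  have "lower_central T (Suc 0) = U" using C by simp
  from stable_LS[OF this V] show "has_LS T [n + 1, n - 1, n - 1]" by (simp only: dim_car dim_U)
qed

text \<open>No bracket has coordinate 1, D has diagonal \<open>d 3\<close> \<noteq> 0 on
  \<open>e 2\<close>, ..., \<open>e n\<close>, and these vectors span an abelian subalgebra.\<close>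

lemma series_abelian:
  assumes "\<alpha> = 0"
  shows "has_DS T [n + 1, n - 1, 0]" "has_LS T [n + 1, n - 1, n - 1]"
proof -
  let ?U = "span (e ` {2..n})"
  let ?V = "brk_span T ?U (car T)"
  have d3: "d 3 \<noteq> 0" using nz assms by simp
  have sV: "subspace ?V" by (rule subspace_brk_span)
  have CU: "brk_span T (car T) (car T) \<subseteq> ?U"
  proof (rule brk_span_subset[OF subspace_span])
    fix x y
    have "B x y $$ 1 = 0" using assms n by (simp add: coord_B coord_nb coord_D)
    moreover have "B x y $$ k = 0" if "k \<notin> {1..n}" for k using B_in_N that N_iff by blast
    ultimately show "B x y \<in> ?U" unfolding mem_span_e[OF finite_atLeastAtMost]
      by (metis One_nat_def Suc_1 atLeastAtMost_iff not_less_eq_eq le_antisym)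
  qed
  have rV: "r i \<in> ?V" if "2 \<le> i" "i \<le> n" for i
  proof -
    have "e i \<in> ?U" using that by (simp add: span_base)
    thus ?thesis using brk_in_brk_span[OF _ e_car[of "n + 1"], of "e i" ?U T] B_ex[of i] that by simp
  qed
  have "(1 / d 3) *\<^sub>R r 2 \<in> ?V" using sV rV[of 2] n by (intro subspace_scale) auto
  hence e2: "e 2 \<in> ?V" using assms d3 by (simp add: r2)
  have e3: "e k \<in> ?V" if "3 \<le> k" "k \<le> n" for k
  proof (rule e_in_subspace_triangular[OF sV _ that])
    fix k assume k: "3 \<le> k" "k \<le> n"
    show "\<exists>u\<in>?V. u $$ k \<noteq> 0 \<and> (\<forall>j. j \<notin> {k..n} \<longrightarrow> u $$ j = 0)"
      by (rule bexI[of _ "r k"]) (use k assms d3 rV[of k] in \<open>auto simp: r3\<close>)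
  qed
  have "?U \<subseteq> ?V"
  proof (rule span_minimal[OF _ sV], safe)
    fix k assume "k \<in> {2..n}"
    hence "k = 2 \<or> 3 \<le> k \<and> k \<le> n" by (simp, arith)
    thus "e k \<in> ?V" using e2 e3 by blast
  qed
  moreover have "?V \<subseteq> brk_span T (car T) (car T)"
    using span_e_mono[of "{2..n}" "{1..n + 1}"] by (intro brk_span_mono) auto
  ultimately have V: "?V = ?U" and C: "brk_span T (car T) (car T) = ?U" using CU by blast+
  have UU: "brk_span T ?U ?U = {0}"
  proof (rule brk_span_zero)
    fix x y assume xy: "x \<in> ?U" "y \<in> ?U"
    have "x $$ k = 0" "y $$ k = 0" if "k \<in> {1,n+1}" for k using xy that by (auto simp: mem_span_e)
    thus "B x y = 0" using n by (intro vec0_eqI) (auto simp: B_N coord_nb)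
  qed
  have dU: "dim ?U = n - 1" using dim_span_e[of "{2..n}"] by simp
  have "derived T (Suc 0) = ?U" using C by simp
  from stable_DS2[OF this UU] show "has_DS T [n + 1, n - 1, 0]" by (simp only: dim_car dU)
  have "lower_central T (Suc 0) = ?U" using C by simp
  from stable_LS[OF this V] show "has_LS T [n + 1, n - 1, n - 1]" by (simp only: dim_car dU)
qed

end


section \<open>The listed algebras as members of the family\<close>

lemma std_ext_g1:
  assumes "n \<ge> 4"
  shows "std_ext n 1 0 (\<lambda>k. if k = 3 then a - 2 else 0) (\<lambda>_. 0)
     (\<lambda>i. if i = 1 then e 1 + (a - 2) *\<^sub>R e 3
          else if i = 2 then a *\<^sub>R e 2
          else (a + real i - 4) *\<^sub>R e i)
     (\<lambda>j. if j = 1 then - e 1 - (a - 2) *\<^sub>R e 3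
          else if j = 2 then 0
          else if j = 3 then (1 - a) *\<^sub>R e 3
          else if j = 4 then e 2 - a *\<^sub>R e 4
          else (4 - real j - a) *\<^sub>R e j) 0"
  using assms
  by unfold_locales (auto simp: coord_e algebra_simps intro!: vec0_eqI)

lemma std_ext_g2:
  assumes "n \<ge> 5"
  shows "std_ext n 1 0 (\<lambda>k. if k = 3 then - 2 else if k = 5 then \<delta> else 0) (\<lambda>_. 0)
     (\<lambda>i. if i = 1 then e 1 - 2 *\<^sub>R e 3 + \<delta> *\<^sub>R e 5
          else if i = 2 then 0
          else (real i - 4) *\<^sub>R e i)
     (\<lambda>j. if j = 1 then - e 1 + 2 *\<^sub>R e 3 - \<delta> *\<^sub>R e 5
          else if j = 2 then 0
          else if j = 3 then e 3
          else if j = 4 then e 2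
          else (4 - real j) *\<^sub>R e j) 0"
  using assms
  by unfold_locales (auto simp: coord_e algebra_simps intro!: vec0_eqI)

lemma std_ext_g3:
  assumes "n \<ge> 5"
  shows "std_ext n 1 \<delta> (\<lambda>k. if k = 3 then 2 - real n else 0) (\<lambda>_. 0)
     (\<lambda>i. if i = 1 then e 1 + (2 - real n) *\<^sub>R e 3
          else if i = 2 then (4 - real n) *\<^sub>R e 2
          else if i \<le> n - 1 then (real i - real n) *\<^sub>R e i
          else 0)
     (\<lambda>j. if j = 1 then - e 1 + (real n - 2) *\<^sub>R e 3
          else if j = 2 then 0
          else if j = 3 then (real n - 3) *\<^sub>R e 3
          else if j = 4 then e 2 + (real n - 4) *\<^sub>R e 4
          else if j \<le> n - 1 then (real n - real j) *\<^sub>R e j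
          else 0) (\<delta> *\<^sub>R e n)"
proof -
  have j: "j = n" if "j \<le> n" "\<not> j \<le> n - 1" for j using that by simp
  show ?thesis using assms
    by unfold_locales (auto simp: coord_e algebra_simps intro!: vec0_eqI dest!: j)
qed

lemma std_ext_g4:
  assumes "n \<ge> 4"
  shows "std_ext n 0 0 (\<lambda>k. if k = 3 then 1 else 0)
     (\<lambda>m. if m = 2 then \<epsilon> else if m \<ge> 3 then b (m - 2) else 0)
     (\<lambda>i. if i = 1 then e 3
          else if i = 2 then e 2
          else e i + (if i + 2 \<le> n then \<epsilon> *\<^sub>R e (i + 2) else 0)
                   + (\<Sum>k=i+3..n. b (k - i - 2) *\<^sub>R e k))
     (\<lambda>j. if j = 1 then - e 3
          else if j = 2 then 0
          else - e j - (if j + 2 \<le> n then \<epsilon> *\<^sub>R e (j + 2) else 0)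
                     - (\<Sum>k=j+3..n. b (k - j - 2) *\<^sub>R e k)) 0"
proof -
  have s: "(\<Sum>k=i+3..n. b (k - i - 2) *\<^sub>R e k) $$ m = (if i + 3 \<le> m \<and> m \<le> n then b (m - i - 2) else 0)" for i m
    by (simp add: coord_e if_distrib cong: if_cong)
  have c: "(if i + 2 \<le> n then \<epsilon> *\<^sub>R e (i + 2) else 0) $$ m = (if i + 2 \<le> n \<and> m = i + 2 then \<epsilon> else 0)" for i m
    by (simp add: coord_e)
  show ?thesis
  proof
    fix i k :: nat assume i: "3 \<le> i" "i \<le> n"
    have k: "k < i \<or> k = i \<or> k = i + 1 \<or> k = i + 2 \<or> i + 3 \<le> k" by arith
    have m: "k - i = 2 \<longleftrightarrow> k = i + 2" "3 \<le> k - i \<longleftrightarrow> i + 3 \<le> k" by arith+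
    show "(if i = 1 then e 3
          else if i = 2 then e 2
          else e i + (if i + 2 \<le> n then \<epsilon> *\<^sub>R e (i + 2) else 0)
                   + (\<Sum>k=i+3..n. b (k - i - 2) *\<^sub>R e k)) $$ k =
       (if k = i then 0 + (if (3::nat) = 3 then 1 else 0) + (real i - 3) * 0
        else if i < k \<and> k \<le> n then if k - i = 2 then \<epsilon> else if 3 \<le> k - i then b (k - i - 2) else 0 else 0)"
    proof -
      have "i \<noteq> 1" "i \<noteq> 2" using i by auto
      thus ?thesis unfolding m using k i by (elim disjE) (simp_all only: if_False coord_simps(1) s c coord_e, simp_all)
    qed
  qed (use assms in \<open>auto simp: coord_e\<close>)
qed

section \<open>The structure of an arbitrary extension\<close>

locale leib_ext =
  fixes n :: nat and r l :: "nat \<Rightarrow> vec0" and s :: vec0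
  assumes n: "n \<ge> 4" and data: "ext_data n r l s" and leib: "right_leibniz (L2_ext n r l s)"
begin

abbreviation "T \<equiv> L2_ext n r l s"
abbreviation "D \<equiv> comb n r"
abbreviation "\<Lambda> \<equiv> comb n l"
abbreviation "B \<equiv> brk T"
abbreviation "N \<equiv> span (e ` {1..n})"
abbreviation "a k \<equiv> r 1 $$ k"
abbreviation "c k \<equiv> r 3 $$ k"

lemmas lz = L2_ext_leibniz[OF leib]

lemma N_iff: "u \<in> N \<longleftrightarrow> (\<forall>k. k \<notin> {1..n} \<longrightarrow> u $$ k = 0)"
  by (rule mem_span_e) simp

lemma B_in_N: "B u v \<in> N" by (rule brk_ext_in_span[OF n data])

lemma B_coord [simp]: "B u v $$ (n + 1) = 0" using B_in_N N_iff by auto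

lemma r_in_N: "i \<in> {1..n} \<Longrightarrow> r i \<in> N" and l_in_N: "i \<in> {1..n} \<Longrightarrow> l i \<in> N" and s_in_N: "s \<in> N"
  using data unfolding ext_data_def by blast+

lemma D_coord [simp]: "D u $$ (n + 1) = 0" and \<Lambda>_coord [simp]: "\<Lambda> u $$ (n + 1) = 0"
  and s_coord [simp]: "s $$ (n + 1) = 0"
  using comb_in_span[of n r "e ` {1..n}" u] comb_in_span[of n l "e ` {1..n}" u] r_in_N l_in_N s_in_N N_iff by auto

lemma e_coord [simp]: "i \<le> n \<Longrightarrow> e i $$ (n + 1) = 0"
  by (simp add: coord_e)

lemma B_N: "u $$ (n + 1) = 0 \<Longrightarrow> v $$ (n + 1) = 0 \<Longrightarrow> B u v = nb n u v"
  by (simp add: brk_L2_ext)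

lemma nb_x [simp]: "nb n u (e (n + 1)) = 0" "nb n (e (n + 1)) u = 0"
  by (rule vec0_eqI; use n in \<open>auto simp: coord_nb coord_e\<close>)+

lemma comb_x [simp]: "comb n w (e (n + 1)) = 0"
  unfolding comb_def by (intro sum.neutral) (auto simp: coord_e)

lemma B_x: "u $$ (n + 1) = 0 \<Longrightarrow> B u (e (n + 1)) = D u" "u $$ (n + 1) = 0 \<Longrightarrow> B (e (n + 1)) u = \<Lambda> u"
  "B (e (n + 1)) (e (n + 1)) = s"
  unfolding brk_L2_ext by (simp_all add: coord_e)

lemma nb_coord [simp]: "nb n u v $$ (n + 1) = 0"
  using n by (simp add: coord_nb)

text \<open>The Leibniz identity for the different ways of placing \<open>e (n + 1)\<close> among
  its three arguments.\<close>

lemma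
  assumes u: "u $$ (n + 1) = 0" and v: "v $$ (n + 1) = 0"
  shows D_nb: "D (nb n u v) = nb n (D u) v + nb n u (D v)"
    and nb_D_\<Lambda>: "nb n u (D v + \<Lambda> v) = 0"
    and \<Lambda>_nb: "nb n (\<Lambda> u) v = nb n (\<Lambda> v) u + \<Lambda> (nb n u v)"
    and nb_s_right: "nb n u s = 0"
    and D_\<Lambda>: "D (\<Lambda> u) = nb n s u + \<Lambda> (D u)"
    and nb_s_left: "nb n s u = D (\<Lambda> u) + \<Lambda> (\<Lambda> u)"
    and \<Lambda>_s: "\<Lambda> s = 0"
proof -
  let ?x = "e (n + 1)"
  show 1: "D (nb n u v) = nb n (D u) v + nb n u (D v)"
    using lz[of u v ?x] u v by (simp add: B_N B_x)
  show "nb n u (D v + \<Lambda> v) = 0"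
    using lz[of u ?x v] 1 u v by (simp add: B_N B_x)
  show "nb n (\<Lambda> u) v = nb n (\<Lambda> v) u + \<Lambda> (nb n u v)"
    using lz[of ?x u v] u v by (simp add: B_N B_x)
  show "nb n u s = 0" using lz[of u ?x ?x] u by (simp add: B_N B_x)
  show "D (\<Lambda> u) = nb n s u + \<Lambda> (D u)" using lz[of ?x u ?x] u by (simp add: B_N B_x)
  show "nb n s u = D (\<Lambda> u) + \<Lambda> (\<Lambda> u)" using lz[of ?x ?x u] u by (simp add: B_N B_x)
  show "\<Lambda> s = 0" using lz[of ?x ?x ?x] by (simp add: B_N B_x)
qed

lemma D_e: "i \<in> {1..n} \<Longrightarrow> D (e i) = r i" and \<Lambda>_e: "i \<in> {1..n} \<Longrightarrow> \<Lambda> (e i) = l i"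
  by (simp_all add: comb_e)

lemma annihilator:
  assumes z: "z \<in> N" and "nb n (e 1) z = 0" "nb n (e 3) z = 0"
  shows "z = z $$ 2 *\<^sub>R e 2 + z $$ n *\<^sub>R e n"
proof -
  have z1: "z $$ 1 = 0"
    using arg_cong[OF assms(3), of "\<lambda>u. u $$ 4"] n by (simp add: coord_nb coord_e)
  have zk: "z $$ k = 0" if "3 \<le> k" "k < n" for k
    using arg_cong[OF assms(2), of "\<lambda>u. u $$ (Suc k)"] that n z1 by (simp add: coord_nb coord_e split: if_splits)
  show ?thesis
  proof (rule vec0_eqI)
    fix k
    have "k \<notin> {1..n} \<or> k = 1 \<or> k = 2 \<or> 3 \<le> k \<and> k < n \<or> k = n" by (simp, arith)
    thus "z $$ k = (z $$ 2 *\<^sub>R e 2 + z $$ n *\<^sub>R e n) $$ k"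
      using z z1 zk[of k] n by (auto simp: coord_e N_iff)
  qed
qed

text \<open>Apply D to [\<open>e 3\<close>,\<open>e 3\<close>] = 0 and read off coordinate
  2.\<close>

lemma c1: "c 1 = 0"
proof -
  have z: "nb n (e 3) (e 3) = 0" by (rule vec0_eqI) (use n in \<open>auto simp: coord_nb coord_e\<close>)
  have "D (nb n (e 3) (e 3)) = nb n (D (e 3)) (e 3) + nb n (e 3) (D (e 3))" by (rule D_nb) (use n in auto)
  hence "0 = (nb n (r 3) (e 3) + nb n (e 3) (r 3)) $$ 2"
    using n by (simp add: z D_e linear_0[OF linear_comb])
  thus ?thesis using n by (simp add: coord_nb coord_e)
qed

lemma nb_e: "nb n (e 1) (e 1) = e 2" "nb n (e 1) (e 3) = e 2 - e 4"
  "3 \<le> i \<Longrightarrow> i < n \<Longrightarrow> nb n (e i) (e 1) = e (i + 1)"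
  by (rule vec0_eqI, use n in \<open>auto simp: coord_nb coord_e\<close>)+

lemma r2: "r 2 = (2 * a 1 + a 3) *\<^sub>R e 2"
proof -
  have "r 2 = D (nb n (e 1) (e 1))" using n by (simp add: nb_e D_e)
  also have "\<dots> = nb n (r 1) (e 1) + nb n (e 1) (r 1)" using n by (subst D_nb) (simp_all add: D_e)
  also have "\<dots> = (2 * a 1 + a 3) *\<^sub>R e 2"
    by (rule vec0_eqI) (use n in \<open>auto simp: coord_nb coord_e\<close>)
  finally show ?thesis .
qed

lemma r_Suc: "3 \<le> i \<Longrightarrow> i < n \<Longrightarrow> r (i + 1) = nb n (r i) (e 1) + nb n (e i) (r 1)"
proof -
  assume i: "3 \<le> i" "i < n"
  hence "r (i + 1) = D (nb n (e i) (e 1))" by (simp add: nb_e D_e)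
  also have "\<dots> = nb n (r i) (e 1) + nb n (e i) (r 1)" using n i by (subst D_nb) (simp_all add: D_e)
  finally show ?thesis .
qed

text \<open>Apply D to [\<open>e 1\<close>,\<open>e 3\<close>] = \<open>e 2\<close> -
  \<open>e 4\<close>: coordinate 2 equates \<open>a 1 + c 3\<close> with the weight 2
  \<open>a 1\<close> + \<open>a 3\<close> of \<open>e 2\<close>.\<close>

lemma c3: "c 3 = a 1 + a 3"
proof -
  have "nb n (r 1) (e 3) + nb n (e 1) (r 3) = D (nb n (e 1) (e 3))"
    using n by (subst D_nb) (simp_all add: D_e)
  also have "\<dots> = r 2 - r 4" using n by (simp add: nb_e linear_diff[OF linear_comb] D_e)
  finally have "(nb n (r 1) (e 3) + nb n (e 1) (r 3)) $$ 2 = (r 2 - r 4) $$ 2" by simp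
  moreover have "r 4 $$ 2 = 0" using r_Suc[of 3] n c1 by (simp add: coord_nb coord_e)
  ultimately show ?thesis using n c1 by (simp add: coord_nb coord_e r2)
qed

text \<open>\<open>e (i + 1)\<close> = [\<open>e i\<close>,\<open>e 1\<close>], so D is carried
  along the shift: each step raises the weight by \<open>a 1\<close>, moves the entries of
  \<open>r 3\<close> up by one, and loses the \<open>e 2\<close>-component at once.\<close>

lemma r_coord:
  assumes "3 \<le> i" "i \<le> n"
  shows "r i $$ k = (if k = i then c 3 + (real i - 3) * a 1
    else if i < k \<and> k \<le> n then c (k - i + 3) else if i = 3 \<and> k = 2 then c 2 else 0)"
  using assms
proof (induction i arbitrary: k rule: dec_induct)
  case base
  have "k = 0 \<or> k = 1 \<or> k = 2 \<or> 3 \<le> k \<and> k \<le> n \<or> k \<notin> {1..n}" by (simp, arith)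
  thus ?case using c1 r_in_N[of 3] n by (auto simp: N_iff)
next
  case (step i)
  have 1: "r i $$ 1 = 0" using step c1 n by auto
  have e1: "e i $$ 1 = 0" using step by (simp add: coord_e)
  have "r (Suc i) = nb n (r i) (e 1) + nb n (e i) (r 1)"
    using r_Suc[of i] step unfolding Suc_eq_plus1[symmetric] Suc_le_eq by blast
  hence "r (Suc i) $$ k = (if 4 \<le> k \<and> k \<le> n then r i $$ (k - 1) + e i $$ (k - 1) * a 1 else 0)"
    using step n 1 e1 by (simp add: coord_nb coord_e)
  also have "\<dots> = (if k = Suc i then c 3 + (real (Suc i) - 3) * a 1
    else if Suc i < k \<and> k \<le> n then c (k - Suc i + 3) else if Suc i = 3 \<and> k = 2 then c 2 else 0)"
  proof (cases "4 \<le> k \<and> k \<le> n")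
    case True
    hence "k - 1 = i \<longleftrightarrow> k = Suc i" "i < k - 1 \<longleftrightarrow> Suc i < k" "k - 1 \<le> n" "k - 1 - i = k - Suc i" "k - 1 \<noteq> 2" by auto
    thus ?thesis using True step by (simp add: coord_e algebra_simps)
  next
    case False
    thus ?thesis using step n by auto
  qed
  finally show ?case .
qed

abbreviation "\<mu> \<equiv> 2 * a 1 + a 3"
abbreviation "\<nu> \<equiv> a 3 + (real n - 2) * a 1"

lemma rn: "r n = \<nu> *\<^sub>R e n"
proof (rule vec0_eqI)
  fix k
  show "r n $$ k = (\<nu> *\<^sub>R e n) $$ k"
    unfolding r_coord[OF order.trans[of 3 4 n, OF _ n] order_refl, simplified] c3
    using n by (simp add: coord_e algebra_simps)
qed

lemma l2: "l 2 = 0"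
proof -
  have "nb n (l 1) (e 1) = nb n (l 1) (e 1) + l 2"
    using \<Lambda>_nb[of "e 1" "e 1"] n by (simp add: nb_e \<Lambda>_e)
  thus ?thesis by simp
qed

definition "\<phi> i = r i + l i" for i :: nat

lemma \<phi>_ann: "i \<in> {1..n} \<Longrightarrow> \<phi> i = \<phi> i $$ 2 *\<^sub>R e 2 + \<phi> i $$ n *\<^sub>R e n"
proof (rule annihilator)
  assume i: "i \<in> {1..n}"
  show "\<phi> i \<in> N" unfolding \<phi>_def using r_in_N l_in_N i by (intro span_add)
  have "D (e i) + \<Lambda> (e i) = \<phi> i" using i by (simp add: \<phi>_def D_e \<Lambda>_e)
  thus "nb n (e 1) (\<phi> i) = 0" "nb n (e 3) (\<phi> i) = 0"
    using nb_D_\<Lambda>[of "e 1" "e i"] nb_D_\<Lambda>[of "e 3" "e i"] i n by auto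
qed

lemma nb_\<phi>: "i \<in> {1..n} \<Longrightarrow> nb n (\<phi> i) u = 0"
  using arg_cong[OF \<phi>_ann[of i], of "\<lambda>z. nb n z u"] n by simp

text \<open>The value is the symmetrised product of \<open>e i\<close> with D \<open>e 1\<close>;
  symmetrised products in \<open>L2 n\<close> are multiples of \<open>e 2\<close>.\<close>

lemma \<phi>_Suc:
  assumes i: "3 \<le> i" "i < n"
  shows "\<phi> (i + 1) = (if i = 3 then a 1 else 0) *\<^sub>R e 2"
proof -
  have li: "l i = \<phi> i - r i" "l 1 = \<phi> 1 - r 1" by (simp_all add: \<phi>_def)
  have "nb n (l i) (e 1) = nb n (l 1) (e i) + l (i + 1)"
    using \<Lambda>_nb[of "e i" "e 1"] i n by (simp add: nb_e \<Lambda>_e)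
  hence "l (i + 1) = nb n (r 1) (e i) - nb n (r i) (e 1)"
    unfolding li using i n nb_\<phi>[of i] nb_\<phi>[of 1] by (simp add: algebra_simps)
  hence "\<phi> (i + 1) = nb n (e i) (r 1) + nb n (r 1) (e i)"
    unfolding \<phi>_def r_Suc[OF i] by simp
  also have "\<dots> = (if i = 3 then a 1 else 0) *\<^sub>R e 2"
    by (rule vec0_eqI) (use n i in \<open>auto simp: coord_nb coord_e\<close>)
  finally show ?thesis .
qed

lemma l4: "l 4 = a 1 *\<^sub>R e 2 - r 4"
  using \<phi>_Suc[of 3] n by (simp add: \<phi>_def algebra_simps)

lemma l5: "5 \<le> i \<Longrightarrow> i \<le> n \<Longrightarrow> l i = - r i"
  using \<phi>_Suc[of "i - 1"] by (simp add: \<phi>_def eq_neg_iff_add_eq_0 add.commute)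

lemma s_ann: "s = s $$ 2 *\<^sub>R e 2 + s $$ n *\<^sub>R e n"
  by (rule annihilator[OF s_in_N]) (use nb_s_right[of "e 1" "e 1"] nb_s_right[of "e 3" "e 1"] n in simp_all)

lemma \<phi>_13: "i \<in> {1..n} \<Longrightarrow> \<phi> i $$ 1 = 0" "i \<in> {1..n} \<Longrightarrow> \<phi> i $$ 3 = 0"
  using n arg_cong[OF \<phi>_ann[of i], of "\<lambda>u. u $$ 1"] arg_cong[OF \<phi>_ann[of i], of "\<lambda>u. u $$ 3"]
  by (simp_all add: coord_e)

lemma s_13: "s $$ 1 = 0" "s $$ 3 = 0"
  using n arg_cong[OF s_ann, of "\<lambda>u. u $$ 1"] arg_cong[OF s_ann, of "\<lambda>u. u $$ 3"]
  by (simp_all add: coord_e)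

lemma nb_s: "nb n s u = 0"
  using arg_cong[OF s_ann, of "\<lambda>z. nb n z u"] n by simp

abbreviation "\<Phi> \<equiv> comb n \<phi>"

lemma \<Phi>_eq: "\<Phi> u = D u + \<Lambda> u"
  by (simp add: comb_def \<phi>_def scaleR_add_right sum.distrib)

lemma \<Phi>_linear: "\<Phi> (u + v) = \<Phi> u + \<Phi> v" "\<Phi> (t *\<^sub>R u) = t *\<^sub>R \<Phi> u"
  by (simp_all add: linear_add[OF linear_comb] linear_scale[OF linear_comb])

lemma D_linear: "D (u + v) = D u + D v" "D (t *\<^sub>R u) = t *\<^sub>R D u"
  by (simp_all add: linear_add[OF linear_comb] linear_scale[OF linear_comb])

lemma \<Phi>_explicit: "\<Phi> u = u $$ 1 *\<^sub>R \<phi> 1 + u $$ 3 *\<^sub>R \<phi> 3 + (\<mu> * u $$ 2 + a 1 * u $$ 4) *\<^sub>R e 2"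
proof -
  have un: "{1..n} = insert 1 (insert 2 (insert 3 (insert 4 {5..n})))" using n by auto
  have "(\<Sum>i=5..n. u $$ i *\<^sub>R \<phi> i) = 0"
    by (intro sum.neutral) (auto simp: \<phi>_def l5)
  hence "\<Phi> u = u $$ 1 *\<^sub>R \<phi> 1 + (u $$ 2 *\<^sub>R \<phi> 2 + (u $$ 3 *\<^sub>R \<phi> 3 + u $$ 4 *\<^sub>R \<phi> 4))"
    unfolding comb_def un by simp
  thus ?thesis by (simp add: \<phi>_def[of 2] \<phi>_def[of 4] l2 l4 r2 algebra_simps)
qed

text \<open>The square \<open>s\<close> annihilates N, so D commutes with \<Lambda> and \<Phi>
  \<Lambda> = D \<Lambda> + \<Lambda> \<Lambda> = 0.\<close>

lemma \<Phi>_D: "u $$ (n + 1) = 0 \<Longrightarrow> \<Phi> (D u) = D (\<Phi> u)" "u $$ (n + 1) = 0 \<Longrightarrow> \<Phi> (\<Phi> u) = \<Phi> (D u)"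
proof -
  assume u: "u $$ (n + 1) = 0"
  have L: "D (\<Lambda> u) = \<Lambda> (D u)" using D_\<Lambda>[OF u u] nb_s by simp
  thus "\<Phi> (D u) = D (\<Phi> u)" by (simp add: \<Phi>_eq D_linear)
  have "\<Phi> (\<Lambda> u) = 0" unfolding \<Phi>_eq[of "\<Lambda> u"] using nb_s_left[OF u u] nb_s by simp
  thus "\<Phi> (\<Phi> u) = \<Phi> (D u)" unfolding \<Phi>_eq[of u] \<Phi>_linear by simp
qed

abbreviation "p \<equiv> \<phi> 1 $$ 2"
abbreviation "p' \<equiv> \<phi> 3 $$ 2"

text \<open>All weights vanish, so D becomes strictly triangular and every right multiplication
  raises the same filtration as in \<open>lower_central_N\<close>. This is later played against the
  maximality of the nilradical.\<close>

lemma nilpotent_case: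
  assumes "a 1 = 0" "a 3 = 0"
  shows "\<exists>m. lower_central T m = {0}"
proof -
  have c30: "c 3 = 0" using assms c3 by simp
  have r20: "r 2 = 0" using assms r2 by simp
  have ri0: "r i $$ k = 0" if "4 \<le> i" "i \<le> n" "k \<le> i" for i k
    using r_coord[of i k] that assms c30 by auto
  have "lower_central T (Suc m) \<subseteq> {u. \<forall>k. \<not> (m = 0 \<and> k = 2 \<or> m + 4 \<le> k \<and> k \<le> n) \<longrightarrow> u $$ k = 0}" for m
  proof (induction m)
    case 0
    have Dz: "D u $$ k = 0" if "k = 1 \<or> k = 3" for u k
    proof -
      have "u $$ i * r i $$ k = 0" if i: "i \<in> {1..n}" for i
      proof -
        from i have "i = 1 \<or> i = 2 \<or> i = 3 \<or> 4 \<le> i \<and> i \<le> n" by (simp, arith)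
        thus ?thesis using \<open>k = 1 \<or> k = 3\<close> assms c30 c1 ri0[of i k] r20 by auto
      qed
      thus ?thesis unfolding comb_def coord_simps coord_scaleR by (intro sum.neutral ballI)
    qed
    have \<Phi>z: "\<Phi> u $$ k = 0" if "k = 1 \<or> k = 3" for u k
      using that n \<phi>_13[of 1] \<phi>_13[of 3] by (auto simp: \<Phi>_explicit coord_e)
    have "\<Lambda> u = \<Phi> u - D u" for u by (simp add: \<Phi>_eq)
    hence Lz: "\<Lambda> u $$ k = 0" if "k = 1 \<or> k = 3" for u k using Dz \<Phi>z that by simp
    have sz: "s $$ k = 0" if "k = 1 \<or> k = 3" for k
      using that s_13 by auto
    have "B x y $$ k = 0" if "\<not> (k = 2 \<or> 4 \<le> k \<and> k \<le> n)" for x y k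
    proof (cases "k = 1 \<or> k = 3")
      case True
      thus ?thesis using n Dz[OF True] Lz[OF True] sz[OF True] by (auto simp: brk_L2_ext coord_nb)
    next
      case False
      hence "k \<notin> {1..n}" using that unfolding atLeastAtMost_iff by arith
      thus ?thesis using B_in_N N_iff by blast
    qed
    thus ?case unfolding lower_central.simps
      by (intro brk_span_subset subspace_coords) auto
  next
    case (Suc m)
    have "B x y $$ k = 0" if x: "x \<in> lower_central T (Suc m)" and k: "\<not> (Suc m + 4 \<le> k \<and> k \<le> n)" for x y k
    proof -
      have x0: "x $$ i = 0" if "\<not> (m = 0 \<and> i = 2 \<or> m + 4 \<le> i \<and> i \<le> n)" for i
        using Suc.IH x that by blast
      have x': "x $$ (n + 1) = 0" "x $$ 1 = 0" by (rule x0; use n in simp)+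
      have "D x $$ k = 0" if "k \<le> n"
      proof -
        have "x $$ i * r i $$ k = 0" if "i \<in> {1..n}" for i
        proof (cases "m + 4 \<le> i")
          case True
          thus ?thesis using ri0[of i k] that k \<open>k \<le> n\<close> by auto
        next
          case False
          thus ?thesis using x0[of i] r20 by (cases "i = 2") auto
        qed
        thus ?thesis unfolding comb_def coord_simps coord_scaleR by (intro sum.neutral ballI)
      qed
      moreover have "nb n x y $$ k = 0"
      proof -
        have "x $$ (k - 1) = 0" if "4 \<le> k" "k \<le> n" by (rule x0) (use that k in auto)
        thus ?thesis using n x' by (simp add: coord_nb)
      qed
      moreover have "B x y $$ k = 0" if "\<not> k \<le> n" using that B_in_N N_iff by auto
      ultimately show ?thesis using x' by (cases "k \<le> n") (simp_all add: brk_L2_ext)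
    qed
    thus ?case unfolding lower_central.simps(2)[of _ "Suc m"]
      by (intro brk_span_subset subspace_coords) auto
  qed
  hence "lower_central T (Suc n) \<subseteq> {0}"
    using n by (fastforce intro!: vec0_eqI)
  moreover have "0 \<in> lower_central T (Suc n)" by (simp add: brk_span_def span_zero)
  ultimately show ?thesis by blast
qed

end

section \<open>Constraints for extensions that are not nilpotent\<close>

locale leib_ext_nonnil = leib_ext +
  assumes nonnil: "a 1 \<noteq> 0 \<or> a 3 \<noteq> 0"
begin

text \<open>\<Phi> D = D \<Phi> = \<Phi> \<Phi> has no \<open>e n\<close>-component on
  \<open>e 1\<close> and \<open>e 3\<close>, since \<Phi> sees coordinate n of its result only
  through coordinates 1 and 3. A nonzero component would force both the weight of \<open>e 3\<close>
  and that of \<open>e n\<close> to vanish, or \<open>a 1\<close> = 0 together with weight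
  \<open>a 3\<close> = 0 on \<open>e n\<close>.\<close>

lemma \<phi>_n: "\<phi> 1 $$ n = 0" "\<phi> 3 $$ n = 0"
proof -
  let ?q = "\<phi> 1 $$ n" and ?q' = "\<phi> 3 $$ n"
  have P: "\<Phi> u $$ n = u $$ 1 * ?q + u $$ 3 * ?q'" for u
    using n by (simp add: \<Phi>_explicit coord_e)
  have \<Phi>e: "\<Phi> (e 1) = \<phi> 1" "\<Phi> (e 3) = \<phi> 3" using n by (simp_all add: comb_e)
  have Dn: "D (\<phi> i) $$ n = \<nu> * \<phi> i $$ n" if "i \<in> {1..n}" for i
    by (subst \<phi>_ann[OF that]) (use n that in \<open>simp add: D_linear D_e rn r2 coord_e\<close>)
  have z: "\<Phi> (\<phi> i) $$ n = 0" if "i \<in> {1..n}" for i using \<phi>_13[OF that] by (simp add: P)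
  have m: "1 \<in> {1..n}" "3 \<in> {1..n}" using n by auto
  have k: "\<Phi> (r i) = D (\<phi> i)" "\<Phi> (\<phi> i) = \<Phi> (r i)" if "i \<in> {1..n}" for i
    using \<Phi>_D[of "e i"] that by (simp_all add: comb_e)
  have 1: "a 1 * ?q + a 3 * ?q' = 0" "\<nu> * ?q = 0"
    using P[of "r 1"] z[OF m(1)] Dn[OF m(1)] unfolding k(2)[OF m(1)] by (simp_all add: k(1)[OF m(1)])
  have 3: "c 3 * ?q' = 0" "\<nu> * ?q' = 0"
    using P[of "r 3"] z[OF m(2)] Dn[OF m(2)] c1 unfolding k(2)[OF m(2)] by (auto simp: k(1)[OF m(2)])
  show q': "?q' = 0"
  proof (rule ccontr)
    assume "?q' \<noteq> 0"
    hence "a 1 + a 3 = 0" "\<nu> = 0" using 3 c3 by auto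
    hence "a 3 = - a 1" by simp
    hence "(real n - 3) * a 1 = \<nu>" by (simp add: algebra_simps)
    hence "(real n - 3) * a 1 = 0" using \<open>\<nu> = 0\<close> by simp
    hence "a 1 = 0" using n by auto
    with \<open>a 1 + a 3 = 0\<close> nonnil show False by simp
  qed
  hence "a 1 * ?q = 0" using 1 by simp
  with 1 nonnil show "?q = 0" by auto
qed

lemma \<phi>_e2: "\<phi> 1 = p *\<^sub>R e 2" "\<phi> 3 = p' *\<^sub>R e 2"
  using \<phi>_ann[of 1] \<phi>_ann[of 3] n unfolding \<phi>_n by simp_all

lemma l1: "l 1 = p *\<^sub>R e 2 - r 1" and l3: "l 3 = p' *\<^sub>R e 2 - r 3"
  using \<phi>_e2 by (simp_all only: \<phi>_def add_diff_cancel_left' eq_diff_eq add.commute)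

text \<open>The \<open>e 2\<close>-components of \<Phi> D = D \<Phi> on \<open>e 1\<close> and on
  \<open>e 3\<close>.\<close>

lemma constraint1: "a 1 * p + a 2 * \<mu> + a 3 * p' + a 4 * a 1 = p * \<mu>"
  and constraint3: "p' * a 1 = c 2 * \<mu> + c 4 * a 1"
proof -
  have \<Phi>e: "\<Phi> (e 1) = \<phi> 1" "\<Phi> (e 3) = \<phi> 3" using n by (simp_all add: comb_e)
  have D2: "D (e 2) = \<mu> *\<^sub>R e 2" using n by (simp add: D_e r2)
  have D\<phi>: "D (\<phi> 1) $$ 2 = p * \<mu>" "D (\<phi> 3) $$ 2 = p' * \<mu>"
    using arg_cong[OF \<phi>_e2(1), of "\<lambda>z. D z $$ 2"] arg_cong[OF \<phi>_e2(2), of "\<lambda>z. D z $$ 2"]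
    unfolding D_linear D2 by (simp_all add: coord_e)
  have "\<Phi> (r 1) $$ 2 = D (\<phi> 1) $$ 2" using \<Phi>_D(1)[of "e 1"] n by (simp add: \<Phi>e D_e)
  thus "a 1 * p + a 2 * \<mu> + a 3 * p' + a 4 * a 1 = p * \<mu>"
    unfolding D\<phi> \<Phi>_explicit by (simp add: coord_e algebra_simps)
  have "\<Phi> (r 3) $$ 2 = D (\<phi> 3) $$ 2" using \<Phi>_D(1)[of "e 3"] n by (simp add: \<Phi>e D_e)
  hence "c 3 * p' + \<mu> * c 2 + a 1 * c 4 = p' * \<mu>"
    unfolding D\<phi> \<Phi>_explicit using c1 by (simp add: coord_e algebra_simps)
  thus "p' * a 1 = c 2 * \<mu> + c 4 * a 1" using c3 by (simp add: algebra_simps)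
qed

text \<open>\<Lambda> \<open>s\<close> = 0 means \<Phi> \<open>s\<close> = D \<open>s\<close>, and
  \<Phi> \<open>s\<close> is a multiple of \<open>e 2\<close>. For n = 4 the
  \<open>e 2\<close>-component adds \<open>a 1\<close> times coordinate 4 of \<open>s\<close> as a
  further obstruction.\<close>

lemma s_constraint: "s $$ n * \<nu> = 0" "n = 4 \<Longrightarrow> s $$ n = 0"
proof -
  have "\<Phi> s = D s" using \<Lambda>_s[of "e 1" "e 1"] n by (simp add: \<Phi>_eq)
  moreover have D: "D s = (s $$ 2 * \<mu>) *\<^sub>R e 2 + (s $$ n * \<nu>) *\<^sub>R e n"
    by (subst s_ann) (use n in \<open>simp add: D_linear D_e r2 rn\<close>)
  ultimately have eq: "(\<mu> * s $$ 2 + a 1 * s $$ 4) *\<^sub>R e 2 = (s $$ 2 * \<mu>) *\<^sub>R e 2 + (s $$ n * \<nu>) *\<^sub>R e n"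
    by (simp add: \<Phi>_explicit s_13)
  show sn: "s $$ n * \<nu> = 0" using arg_cong[OF eq, of "\<lambda>u. u $$ n"] n by (simp add: coord_e)
  assume "n = 4"
  moreover from this have "a 1 * s $$ 4 = 0" using arg_cong[OF eq, of "\<lambda>u. u $$ 2"] n by (simp add: coord_e)
  ultimately show "s $$ n = 0" using sn nonnil by auto
qed

end

section \<open>Change of basis\<close>

context leib_ext
begin

text \<open>The basis generated by \<open>u = \<eta> *\<^sub>R e 1 + \<zeta> *\<^sub>R e 2\<close> and \<open>v\<close>, with \<open>y\<close> in place of \<open>e (n + 1)\<close>.  The relation
  \<open>[u, v] = [u, u] - [v, u]\<close> forces the third coordinate of \<open>v\<close> to be \<open>\<eta>\<close>.\<close>

definition frame :: "real \<Rightarrow> real \<Rightarrow> vec0 \<Rightarrow> vec0 \<Rightarrow> nat \<Rightarrow> vec0" where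
  "frame \<eta> \<zeta> v y i = (if i = 1 then \<eta> *\<^sub>R e 1 + \<zeta> *\<^sub>R e 2 else if i = 2 then \<eta>\<^sup>2 *\<^sub>R e 2
     else if i = n + 1 then y else ((\<lambda>z. nb n z (\<eta> *\<^sub>R e 1 + \<zeta> *\<^sub>R e 2)) ^^ (i - 3)) v)"

lemma frame_simps:
  shows "frame \<eta> \<zeta> v y 1 = \<eta> *\<^sub>R e 1 + \<zeta> *\<^sub>R e 2" "frame \<eta> \<zeta> v y 2 = \<eta>\<^sup>2 *\<^sub>R e 2"
    "frame \<eta> \<zeta> v y 3 = v" "frame \<eta> \<zeta> v y (n + 1) = y"
    "3 \<le> i \<Longrightarrow> i < n \<Longrightarrow> frame \<eta> \<zeta> v y (i + 1) = nb n (frame \<eta> \<zeta> v y i) (\<eta> *\<^sub>R e 1 + \<zeta> *\<^sub>R e 2)"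
proof -
  assume i: "3 \<le> i" "i < n"
  hence "i + 1 - 3 = Suc (i - 3)" by simp
  thus "frame \<eta> \<zeta> v y (i + 1) = nb n (frame \<eta> \<zeta> v y i) (\<eta> *\<^sub>R e 1 + \<zeta> *\<^sub>R e 2)"
    using i by (simp add: frame_def)
qed (use n in \<open>simp_all add: frame_def\<close>)

text \<open>Right multiplication by \<eta> \<open>e 1\<close> + \<zeta> \<open>e 2\<close> is \<eta>
  times the shift on vectors without coordinate 1; \<zeta> is invisible because \<open>e 2\<close>
  annihilates.\<close>

lemma frame_coord:
  assumes v: "v \<in> N" "v $$ 1 = 0" "v $$ 3 = \<eta>" and i: "3 \<le> i" "i \<le> n"
  shows "frame \<eta> \<zeta> v y i $$ k = (if i \<le> k \<and> k \<le> n then \<eta> ^ (i - 3) * v $$ (k - (i - 3))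
     else if i = 3 \<and> k = 2 then v $$ 2 else 0)"
  using i
proof (induction i arbitrary: k rule: dec_induct)
  case base
  have "k = 0 \<or> k = 1 \<or> k = 2 \<or> 3 \<le> k \<and> k \<le> n \<or> k \<notin> {1..n}" by (simp, arith)
  thus ?case using v by (auto simp: frame_simps N_iff)
next
  case (step i)
  let ?w = "frame \<eta> \<zeta> v y"
  have i: "3 \<le> i" "i < n" using step by auto
  have 1: "?w i $$ 1 = 0" using step by simp
  have 2: "?w i $$ (k - 1) = (if i \<le> k - 1 \<and> k - 1 \<le> n then \<eta> ^ (i - 3) * v $$ (k - 1 - (i - 3)) else 0)"
    if "4 \<le> k"
  proof -
    have "k - 1 \<noteq> 2" using that by simp
    thus ?thesis using step by simp
  qed
  have "?w (Suc i) = nb n (?w i) (\<eta> *\<^sub>R e 1 + \<zeta> *\<^sub>R e 2)"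
    using frame_simps(5)[OF i] unfolding Suc_eq_plus1[symmetric] .
  hence "?w (Suc i) $$ k = (if 4 \<le> k \<and> k \<le> n then ?w i $$ (k - 1) * \<eta> else 0)"
    using n 1 by (simp add: coord_nb coord_e)
  also have "\<dots> = (if Suc i \<le> k \<and> k \<le> n then \<eta> ^ (Suc i - 3) * v $$ (k - (Suc i - 3))
     else if Suc i = 3 \<and> k = 2 then v $$ 2 else 0)"
  proof (cases "4 \<le> k \<and> k \<le> n")
    case True
    have "i \<le> k - 1 \<longleftrightarrow> Suc i \<le> k" "k - 1 \<le> n" "k - 1 - (i - 3) = k - (Suc i - 3)" "Suc i - 3 = Suc (i - 3)"
      using True i by auto
    thus ?thesis using True i by (simp add: 2)
  next
    case False
    thus ?thesis using i by auto
  qed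
  finally show ?case .
qed

lemma frame_nb:
  assumes v: "v \<in> N" "v $$ 1 = 0" "v $$ 3 = \<eta>" and ij: "i \<in> {1..n}" "j \<in> {1..n}"
  shows "nb n (frame \<eta> \<zeta> v y i) (frame \<eta> \<zeta> v y j) = comb n (frame \<eta> \<zeta> v y) (L2_table n i j)"
proof -
  let ?w = "frame \<eta> \<zeta> v y" and ?u = "\<eta> *\<^sub>R e 1 + \<zeta> *\<^sub>R e 2"
  note lin = linear_add[OF linear_comb] linear_diff[OF linear_comb] linear_neg[OF linear_comb] linear_0[OF linear_comb]
  note wc = frame_coord[OF v, of _ \<zeta> y]
  have w1: "?w k $$ 1 = 0" if "3 \<le> k" "k \<le> n" for k using that by (simp add: wc)
  have uu: "nb n ?u ?u = \<eta>\<^sup>2 *\<^sub>R e 2"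
    using n by (intro vec0_eqI) (auto simp: coord_nb coord_e power2_eq_square)
  have wu: "nb n (?w k) ?u = (if k < n then ?w (k + 1) else 0)" if k: "3 \<le> k" "k \<le> n" for k
  proof (cases "k < n")
    case True
    thus ?thesis using k frame_simps(5)[of k \<eta> \<zeta> v y] by simp
  next
    case False
    with k have k: "k = n" by simp
    show ?thesis
    proof (rule vec0_eqI)
      fix m
      have "?w n $$ (m - 1) = 0" if "4 \<le> m" "m \<le> n"
      proof -
        have "\<not> n \<le> m - 1" "n \<noteq> 3" using that by auto
        thus ?thesis using n by (simp add: wc)
      qed
      thus "nb n (?w k) ?u $$ m = (if k < n then ?w (k + 1) else 0) $$ m"
        using n w1[of n] unfolding k by (simp add: coord_nb coord_e)
    qed
  qed
  \<comment> \<open>Here coordinate 3 of \<open>v\<close> equal to \<eta> is used: coordinate 2 of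
    [u,v] has to be \<eta> squared, as in [u,u].\<close>
  have uw: "nb n ?u (?w k) = (if k = 3 then \<eta>\<^sup>2 *\<^sub>R e 2 else 0) - nb n (?w k) ?u" if k: "3 \<le> k" "k \<le> n" for k
  proof (rule vec0_eqI)
    fix m
    show "nb n ?u (?w k) $$ m = ((if k = 3 then \<eta>\<^sup>2 *\<^sub>R e 2 else 0) - nb n (?w k) ?u) $$ m"
      using n w1[OF k] k v by (simp add: coord_nb coord_e wc[OF k, of 3] power2_eq_square)
  qed
  have ww: "nb n (?w k) (?w m) = 0" if "3 \<le> k" "k \<le> n" "3 \<le> m" "m \<le> n" for k m
    using w1 that n by (intro vec0_eqI) (simp add: coord_nb)
  have tab: "comb n ?w (e k) = ?w k" if "1 \<le> k" "k \<le> n" for k using that by (simp add: comb_e)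
  have ic: "i = 1 \<or> i = 2 \<or> 3 \<le> i \<and> i \<le> n" and jc: "j = 1 \<or> j = 2 \<or> 3 \<le> j \<and> j \<le> n"
    using ij by (simp_all, arith+)
  show ?thesis
  proof (cases "i = 2 \<or> j = 2")
    case True
    thus ?thesis using n ic jc by (auto simp: frame_simps L2_table_def lin)
  next
    case False
    then consider "i = 1" "j = 1" | "i = 1" "3 \<le> j" "j \<le> n" | "3 \<le> i" "i \<le> n" "j = 1"
      | "3 \<le> i" "i \<le> n" "3 \<le> j" "j \<le> n" using ic jc by blast
    thus ?thesis
    proof cases
      case 1
      thus ?thesis using n uu tab[of 2] by (simp add: frame_simps L2_table_def)
    next
      case 2
      have "j = 3 \<or> 4 \<le> j \<and> j \<le> n - 1 \<or> j = n \<and> j > 3" using 2 n by arith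
      thus ?thesis
      proof (elim disjE)
        assume j: "j = 3"
        have "?w (3 + 1) = ?w 4" by simp
        thus ?thesis using n uw[of 3] wu[of 3] tab[of 2] tab[of 4] 2 j
          by (simp add: frame_simps(1-4) L2_table_def lin)
      next
        assume j: "4 \<le> j \<and> j \<le> n - 1"
        hence "j < n" using n by auto
        thus ?thesis using n uw[of j] wu[of j] tab[of "j + 1"] 2 j
          by (simp add: frame_simps(1-4) L2_table_def lin)
      next
        assume j: "j = n \<and> j > 3"
        hence "\<not> j \<le> n - 1" using n by auto
        thus ?thesis using n uw[of j] wu[of j] 2 j by (simp add: frame_simps(1-4) L2_table_def lin)
      qed
    next
      case 3
      have "i \<le> n - 1 \<longleftrightarrow> i < n" using n by auto
      thus ?thesis using n wu[of i] tab[of "i + 1"] 3 by (simp add: frame_simps(1-4) L2_table_def lin)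
    next
      case 4
      hence "L2_table n i j = 0" by (simp add: L2_table_def)
      thus ?thesis using ww[OF 4] by (simp add: lin)
    qed
  qed
qed

text \<open>The frame is triangular with nonzero leading coefficients, apart from
  \<open>e 2\<close>-components, which are subtracted first.\<close>

lemma frame_span:
  assumes v: "v \<in> N" "v $$ 1 = 0" "v $$ 3 = \<eta>" and \<eta>: "\<eta> \<noteq> 0"
  shows "N \<subseteq> span (frame \<eta> \<zeta> v y ` {1..n})"
proof -
  let ?w = "frame \<eta> \<zeta> v y"
  let ?V = "span (?w ` {1..n})"
  have V: "subspace ?V" by (rule subspace_span)
  have w: "?w i \<in> ?V" if "i \<in> {1..n}" for i using that by (simp add: span_base)
  have "(1 / \<eta>\<^sup>2) *\<^sub>R ?w 2 \<in> ?V" using w[of 2] n by (intro span_scale) simp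
  hence e2: "e 2 \<in> ?V" using \<eta> by (simp add: frame_simps)
  have "(1 / \<eta>) *\<^sub>R (?w 1 - \<zeta> *\<^sub>R e 2) \<in> ?V" using w[of 1] n e2 by (intro span_scale span_diff) simp_all
  hence e1: "e 1 \<in> ?V" using \<eta> by (simp add: frame_simps)
  have e3: "e k \<in> ?V" if "3 \<le> k" "k \<le> n" for k
  proof (rule e_in_subspace_triangular[OF V _ that])
    fix k assume k: "3 \<le> k" "k \<le> n"
    let ?u = "?w k - (if k = 3 then v $$ 2 else 0) *\<^sub>R e 2"
    have "?u \<in> ?V" using w[of k] k e2 by (intro span_diff span_scale) simp_all
    moreover have "?u $$ k \<noteq> 0" "\<forall>j. j \<notin> {k..n} \<longrightarrow> ?u $$ j = 0"
      using k \<eta> v by (auto simp: frame_coord[OF v] coord_e)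
    ultimately show "\<exists>u\<in>?V. u $$ k \<noteq> 0 \<and> (\<forall>j. j \<notin> {k..n} \<longrightarrow> u $$ j = 0)" by blast
  qed
  show ?thesis
  proof (rule span_minimal[OF _ V], safe)
    fix k assume "k \<in> {1..n}"
    hence "k = 1 \<or> k = 2 \<or> 3 \<le> k \<and> k \<le> n" by (simp, arith)
    thus "e k \<in> ?V" using e1 e2 e3 by blast
  qed
qed

lemma frame_in_N:
  assumes v: "v \<in> N" "v $$ 1 = 0" "v $$ 3 = \<eta>" and i: "i \<in> {1..n}"
  shows "frame \<eta> \<zeta> v y i \<in> N"
proof -
  from i have "i = 1 \<or> i = 2 \<or> 3 \<le> i \<and> i \<le> n" by (simp, arith)
  thus ?thesis using n
    by (auto simp: N_iff frame_simps coord_e frame_coord[OF v])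
qed

lemma car_iff: "u \<in> car T \<longleftrightarrow> (\<forall>k. k \<notin> {1..n + 1} \<longrightarrow> u $$ k = 0)"
  unfolding car_L2_ext by (rule mem_span_e) simp

lemma N_car: "N \<subseteq> car T"
  unfolding car_L2_ext by (rule span_e_mono) auto

text \<open>All brackets lie in N, which is the image of \<open>comb n w\<close>, so new structure
  constants exist. They are known only through their images; the injectivity supplied at the end is
  what identifies them.\<close>

lemma reframe:
  fixes v y :: vec0 and \<eta> \<zeta> :: real
  assumes v: "v \<in> N" "v $$ 1 = 0" "v $$ 3 = \<eta>" and \<eta>: "\<eta> \<noteq> 0" and y: "y \<in> car T" "y $$ (n + 1) \<noteq> 0"
  defines "w \<equiv> frame \<eta> \<zeta> v y"
  obtains r' l' s' where "leib_ext n r' l' s'" "T \<cong>\<^sub>L L2_ext n r' l' s'"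
    "\<And>i. i \<in> {1..n} \<Longrightarrow> comb n w (r' i) = B (w i) y"
    "\<And>i. i \<in> {1..n} \<Longrightarrow> comb n w (l' i) = B y (w i)"
    "comb n w s' = B y y"
    "inj_on (comb n w) N"
proof -
  have wN: "w i \<in> N" if "i \<in> {1..n}" for i unfolding w_def by (rule frame_in_N[OF v that])
  have NS: "N \<subseteq> comb n w ` N" unfolding comb_image w_def by (rule frame_span[OF v \<eta>])
  have pre: "\<exists>z. z \<in> N \<and> comb n w z = B p q" for p q
  proof -
    have "B p q \<in> comb n w ` N" by (rule subsetD[OF NS B_in_N])
    thus ?thesis by (auto elim!: imageE)
  qed
  obtain r' where r': "\<And>i. r' i \<in> N" "\<And>i. comb n w (r' i) = B (w i) y"
    using choice[of "\<lambda>i z. z \<in> N \<and> comb n w z = B (w i) y"] pre by blast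
  obtain l' where l': "\<And>i. l' i \<in> N" "\<And>i. comb n w (l' i) = B y (w i)"
    using choice[of "\<lambda>i z. z \<in> N \<and> comb n w z = B y (w i)"] pre by blast
  obtain s' where s': "s' \<in> N" "comb n w s' = B y y" using pre by blast
  have data': "ext_data n r' l' s'" using r' l' s' by (simp add: ext_data_def)
  have wy: "w (n + 1) = y" by (simp add: w_def frame_simps)
  have wcar: "w i \<in> car T" if "i \<in> {1..n + 1}" for i
    using that wN N_car y(1) wy by (cases "i = n + 1") auto
  have sp: "span (w ` {1..n + 1}) = car T"
  proof
    show "span (w ` {1..n + 1}) \<subseteq> car T"
      using wcar by (intro span_minimal) (auto simp: subspace_span)
    have NV: "N \<subseteq> span (w ` {1..n + 1})"
      using NS[unfolded comb_image] span_mono[of "w ` {1..n}" "w ` {1..n + 1}"] by fastforce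
    define z where "z = y - y $$ (n + 1) *\<^sub>R e (n + 1)"
    have "z $$ k = 0" if k: "k \<notin> {1..n}" for k
    proof (cases "k = n + 1")
      case True
      thus ?thesis by (simp add: z_def coord_e)
    next
      case False
      hence "k \<notin> {1..n + 1}" using k by (simp, arith)
      thus ?thesis using y(1) False by (simp add: z_def car_iff coord_e del: car_L2_ext)
    qed
    hence "z \<in> N" unfolding N_iff by blast
    hence "z \<in> span (w ` {1..n + 1})" using NV by blast
    moreover have "y \<in> span (w ` {1..n + 1})" using wy[symmetric] by (auto intro: span_base)
    ultimately have "(1 / y $$ (n + 1)) *\<^sub>R (y - z) \<in> span (w ` {1..n + 1})" by (intro span_scale span_diff)
    hence ex: "e (n + 1) \<in> span (w ` {1..n + 1})" using y(2) by (simp add: z_def)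
    show "car T \<subseteq> span (w ` {1..n + 1})" unfolding car_L2_ext
    proof (rule span_minimal[OF _ subspace_span], safe)
      fix k assume k: "k \<in> {1..n + 1}"
      show "e k \<in> span (w ` {1..n + 1})"
      proof (cases "k = n + 1")
        case False
        hence "e k \<in> N" using k by (intro span_base) auto
        thus ?thesis using NV by blast
      qed (use ex in simp)
    qed
  qed
  have dimT: "dim (car T) = n + 1" using dim_span_e[of "{1..n + 1}"] by simp
  have br: "B (w i) (w j) = comb n w (L2_table n i j)" if i: "i \<in> {1..n}" "j \<in> {1..n}" for i j
  proof -
    have "B (w i) (w j) = nb n (w i) (w j)" using wN[OF i(1)] wN[OF i(2)] by (intro B_N) (simp_all add: N_iff)
    also have "\<dots> = comb n w (L2_table n i j)" unfolding w_def by (rule frame_nb[OF v i])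
    finally show ?thesis .
  qed
  have bx: "B (w i) (w (n + 1)) = comb n w (r' i)" "B (w (n + 1)) (w i) = comb n w (l' i)"
    "B (w (n + 1)) (w (n + 1)) = comb n w s'" for i
    unfolding wy r'(2) l'(2) s'(2) by (rule refl)+
  note basis = L2_ext_of_basis[OF n algebra_on_L2_ext[OF n data] dimT sp data' br bx]
  have iso: "T \<cong>\<^sub>L L2_ext n r' l' s'" by (rule basis(1))
  have "inj_on (comb n w) N" by (rule basis(2))
  moreover have "leib_ext n r' l' s'"
    by (unfold_locales) (use n data' right_leibniz_iso[OF leib iso algebra_on_L2_ext[OF n data']] in auto)
  ultimately show ?thesis using iso r'(2) l'(2) s'(2) by (intro that[of r' l' s']) simp_all
qed

end

section \<open>Normal forms\<close>

text \<open>\<open>e 1\<close> and \<open>e 3\<close> generate \<open>L2 n\<close>, and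
  \<open>l 2\<close>, \<open>l 4\<close>, \<open>l 5\<close>, ... are determined as well. Equality,
  not merely isomorphism, follows because table entries outside the index range are never
  evaluated.\<close>

lemma L2_ext_determined:
  assumes "leib_ext_nonnil n r l s" "leib_ext_nonnil n r' l' s"
    and "r 1 = r' 1" "r 3 = r' 3" "l 1 = l' 1" "l 3 = l' 3"
  shows "L2_ext n r l s = L2_ext n r' l' s"
proof -
  interpret A: leib_ext_nonnil n r l s by fact
  interpret A': leib_ext_nonnil n r' l' s by fact
  have r2: "r 2 = r' 2" unfolding A.r2 A'.r2 assms(3) ..
  have rk: "r i = r' i" if "3 \<le> i" "i \<le> n" for i
    by (rule vec0_eqI) (simp add: A.r_coord[OF that] A'.r_coord[OF that] assms(3,4))
  have "r i = r' i \<and> l i = l' i" if "i \<in> {1..n}" for i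
  proof -
    from that have "i = 1 \<or> i = 2 \<or> i = 3 \<or> i = 4 \<or> 5 \<le> i \<and> i \<le> n" by (simp, arith)
    thus ?thesis
      using assms r2 rk[of 4] A.n A.l2 A'.l2 A.l4 A'.l4 A.l5[of i] A'.l5[of i] rk[of i]
      by (elim disjE) simp_all
  qed
  thus ?thesis unfolding L2_ext_def by (intro table_alg_cong) auto
qed

lemma (in std_ext) leib_ext_nonnil: "leib_ext_nonnil n r l s"
  using n ext_data right_leibniz nz by unfold_locales (auto simp: r1)

context leib_ext
begin

lemma B_y: "u $$ (n + 1) = 0 \<Longrightarrow> B u y = nb n u y + y $$ (n + 1) *\<^sub>R D u"
  "u $$ (n + 1) = 0 \<Longrightarrow> B y u = nb n y u + y $$ (n + 1) *\<^sub>R \<Lambda> u"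
  "B y y = nb n y y + y $$ (n + 1) *\<^sub>R \<Phi> y + (y $$ (n + 1))\<^sup>2 *\<^sub>R s"
  by (simp_all add: brk_L2_ext \<Phi>_eq scaleR_add_right power2_eq_square)

lemma \<Lambda>_linear: "\<Lambda> (u + v) = \<Lambda> u + \<Lambda> v" "\<Lambda> (t *\<^sub>R u) = t *\<^sub>R \<Lambda> u"
  by (simp_all add: linear_add[OF linear_comb] linear_scale[OF linear_comb])

lemma DL_e:
  "D (e 1) = r 1" "D (e 2) = \<mu> *\<^sub>R e 2" "D (e 3) = r 3" "\<Lambda> (e 1) = l 1" "\<Lambda> (e 2) = 0" "\<Lambda> (e 3) = l 3"
  using n r2 l2 by (simp_all add: D_e \<Lambda>_e)

lemma coord_comb_frame:
  assumes v: "v \<in> N" "v $$ 1 = 0" "v $$ 3 = \<eta>"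
  shows "comb n (frame \<eta> \<zeta> v y) z $$ 1 = \<eta> * z $$ 1"
proof -
  have "comb n (frame \<eta> \<zeta> v y) z $$ 1 = (\<Sum>i=1..n. if i = 1 then \<eta> * z $$ 1 else 0)"
    unfolding comb_def coord_simps coord_scaleR
  proof (rule sum.cong[OF refl])
    fix i assume "i \<in> {1..n}"
    hence "i = 1 \<or> i = 2 \<or> 3 \<le> i \<and> i \<le> n" by (simp, arith)
    thus "z $$ i * frame \<eta> \<zeta> v y i $$ 1 = (if i = 1 then \<eta> * z $$ 1 else 0)"
      by (auto simp: frame_simps frame_coord[OF v] coord_e)
  qed
  thus ?thesis using n by simp
qed

text \<open>For \<open>v\<close> in the span of \<open>e 3\<close> and \<open>e 2\<close> the change
  of basis is diagonal, with \<open>e k\<close> scaled by \<eta> to the power k - 2 for k \<ge> 3,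
  except for contributions to coordinate 2.\<close>

lemma comb_frame:
  assumes z: "z \<in> N"
  shows "comb n (frame \<eta> \<zeta> (\<eta> *\<^sub>R e 3 + \<tau> *\<^sub>R e 2) y) z $$ k =
    (if k = 1 then \<eta> * z $$ 1 else if k = 2 then \<eta>\<^sup>2 * z $$ 2 + \<zeta> * z $$ 1 + \<tau> * z $$ 3
     else if 3 \<le> k \<and> k \<le> n then \<eta> ^ (k - 2) * z $$ k else 0)"
proof -
  let ?v = "\<eta> *\<^sub>R e 3 + \<tau> *\<^sub>R e 2"
  let ?w = "frame \<eta> \<zeta> ?v y"
  have v: "?v \<in> N" "?v $$ 1 = 0" "?v $$ 3 = \<eta>" using n by (auto simp: N_iff coord_e)
  have w: "?w i $$ k = (if i = 1 then \<eta> * e 1 $$ k + \<zeta> * e 2 $$ k else if i = 2 then \<eta>\<^sup>2 * e 2 $$ k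
     else \<eta> ^ (i - 2) * e i $$ k + (if i = 3 then \<tau> * e 2 $$ k else 0))" if i: "i \<in> {1..n}" for i
  proof -
    from i have "i = 1 \<or> i = 2 \<or> 3 \<le> i \<and> i \<le> n" by (simp, arith)
    thus ?thesis
    proof (elim disjE)
      assume i: "3 \<le> i \<and> i \<le> n"
      have "k - (i - 3) = 3 \<longleftrightarrow> k = i" if "i \<le> k" using i that by arith
      moreover have "k - (i - 3) \<noteq> 2" if "i \<le> k" using i that by arith
      moreover have "i - 2 = Suc (i - 3)" using i by arith
      ultimately show ?thesis using i n by (auto simp: frame_coord[OF v] coord_e)
    qed (auto simp: frame_simps)
  qed
  have "comb n ?w z $$ k = (\<Sum>i=1..n. (if i = 1 then z $$ 1 * (\<eta> * e 1 $$ k + \<zeta> * e 2 $$ k) else 0)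
     + (if i = 2 then z $$ 2 * (\<eta>\<^sup>2 * e 2 $$ k) else 0) + (if i = 3 then z $$ 3 * (\<tau> * e 2 $$ k) else 0)
     + (if i = k then (if 3 \<le> k then \<eta> ^ (k - 2) * z $$ k else 0) else 0))"
    unfolding comb_def coord_simps coord_scaleR
    by (rule sum.cong[OF refl]) (use w in \<open>auto simp: coord_e algebra_simps\<close>)
  thus ?thesis using n by (auto simp: sum.distrib coord_e)
qed

text \<open>For \<open>a 1\<close> \<noteq> 0 the weight \<open>c 3\<close> of \<open>e 3\<close>
  differs from those of \<open>e 4\<close>, ..., \<open>e n\<close> and of \<open>e 2\<close>, so
  \<open>e 3\<close> can be corrected to an eigenvector.\<close>

lemma make_r3_diagonal:
  assumes a1: "a 1 \<noteq> 0"
  obtains r' l' s' t where "leib_ext n r' l' s'" "T \<cong>\<^sub>L L2_ext n r' l' s'"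
    "r' 1 $$ 1 = 1" "r' 3 = t *\<^sub>R e 3"
proof -
  \<comment> \<open>D - \<open>c 3\<close> is triangular on \<open>e 4\<close>, ...,
    \<open>e n\<close> with diagonal entries (m - 3) \<open>a 1\<close> \<noteq> 0; induction on the
    number of coordinates left.\<close>
  have solve: "\<exists>z. (\<forall>k. k \<notin> {m..n} \<longrightarrow> z $$ k = 0) \<and> D z - c 3 *\<^sub>R z = y"
    if "4 \<le> m" "\<forall>k. k \<notin> {m..n} \<longrightarrow> y $$ k = 0" for m y
    using that
  proof (induction "n + 1 - m" arbitrary: m y)
    case 0
    hence "y = 0" by (intro vec0_eqI) auto
    thus ?case by (intro exI[of _ 0]) (simp add: linear_0[OF linear_comb])
  next
    case (Suc j)
    hence m: "4 \<le> m" "m \<le> n" by auto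
    define t where "t = y $$ m / ((real m - 3) * a 1)"
    define y' where "y' = y - t *\<^sub>R (r m - c 3 *\<^sub>R e m)"
    have nz: "(real m - 3) * a 1 \<noteq> 0" using a1 m by auto
    have rm: "r m $$ k = (if k = m then c 3 + (real m - 3) * a 1
      else if m < k \<and> k \<le> n then c (k - m + 3) else 0)" for k
      using m by (subst r_coord) auto
    have j: "j = n + 1 - (m + 1)" using Suc.hyps(2) m by arith
    have y'0: "y' $$ k = 0" if k: "k \<notin> {m + 1..n}" for k
    proof (cases "k = m")
      case True
      thus ?thesis using nz by (simp add: y'_def rm coord_e t_def)
    next
      case False
      hence k': "k \<notin> {m..n}" "\<not> (m < k \<and> k \<le> n)" using k by auto
      have "r m $$ k = 0" unfolding rm using False k'(2) by (simp only: if_False)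
      thus ?thesis using Suc.prems(2) k'(1) False by (simp add: y'_def coord_e)
    qed
    have "\<exists>z. (\<forall>k. k \<notin> {m + 1..n} \<longrightarrow> z $$ k = 0) \<and> D z - c 3 *\<^sub>R z = y'"
      by (rule Suc.hyps(1)[OF j]) (use m y'0 in simp_all)
    then obtain z where z: "\<forall>k. k \<notin> {m + 1..n} \<longrightarrow> z $$ k = 0" "D z - c 3 *\<^sub>R z = y'" by blast
    have "D (z + t *\<^sub>R e m) - c 3 *\<^sub>R (z + t *\<^sub>R e m) = y"
      using z(2) m by (simp add: D_linear D_e y'_def algebra_simps)
    moreover have "(z + t *\<^sub>R e m) $$ k = 0" if "k \<notin> {m..n}" for k
      using z(1) that m by (auto simp: coord_e)
    ultimately show ?case by blast
  qed
  define y0 where "y0 = r 3 - c 3 *\<^sub>R e 3 - c 2 *\<^sub>R e 2"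
  have "y0 $$ k = 0" if "k \<notin> {4..n}" for k
  proof -
    have "k = 0 \<or> k = 1 \<or> k = 2 \<or> k = 3 \<or> k \<notin> {1..n}" using that by (simp, arith)
    thus ?thesis using c1 r_in_N[of 3] n by (auto simp: y0_def coord_e N_iff)
  qed
  then obtain z where z: "\<forall>k. k \<notin> {4..n} \<longrightarrow> z $$ k = 0" "D z - c 3 *\<^sub>R z = y0"
    using solve[of 4 y0] by auto
  \<comment> \<open>The divisor for \<open>e 2\<close> is \<mu> - \<open>c 3\<close> =
    \<open>a 1\<close>.\<close>
  define v where "v = e 3 - z - (c 2 / a 1) *\<^sub>R e 2"
  have v: "v \<in> N" "v $$ 1 = 0" "v $$ 3 = 1" using z(1) n by (auto simp: v_def N_iff coord_e)
  have Dz: "D z = y0 + c 3 *\<^sub>R z" using z(2) by (simp add: algebra_simps)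
  have "D v = r 3 - D z - (c 2 / a 1) *\<^sub>R (\<mu> *\<^sub>R e 2)"
    unfolding v_def by (simp add: linear_diff[OF linear_comb] D_linear DL_e)
  also have "\<dots> = c 3 *\<^sub>R v"
    unfolding Dz y0_def v_def
    by (rule vec0_eqI) (use a1 c3 in \<open>simp add: field_simps\<close>)
  finally have Dv: "D v = c 3 *\<^sub>R v" .
  \<comment> \<open>This scaling makes the weight of \<open>e 1\<close> equal to 1.\<close>
  define y where "y = (1 / a 1) *\<^sub>R e (n + 1)"
  have y: "y \<in> car T" "y $$ (n + 1) \<noteq> 0" using a1 by (auto simp: y_def car_iff coord_e simp del: car_L2_ext)
  obtain r' l' s' where R: "leib_ext n r' l' s'" "T \<cong>\<^sub>L L2_ext n r' l' s'"
    "\<And>i. i \<in> {1..n} \<Longrightarrow> comb n (frame 1 0 v y) (r' i) = B (frame 1 0 v y i) y"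
    "inj_on (comb n (frame 1 0 v y)) N"
    by (rule reframe[OF v one_neq_zero y, where \<zeta> = 0]) (rule that; assumption)
  interpret E: leib_ext n r' l' s' by fact
  have Bu: "B u y = (1 / a 1) *\<^sub>R D u" if "u $$ (n + 1) = 0" for u
    using B_y(1)[OF that] by (simp add: y_def coord_e)
  have "comb n (frame 1 0 v y) (r' 1) $$ 1 = 1"
    using R(3)[of 1] n a1 by (simp add: frame_simps Bu D_linear DL_e)
  hence 1: "r' 1 $$ 1 = 1" by (simp add: coord_comb_frame[OF v])
  have "comb n (frame 1 0 v y) (r' 3) = comb n (frame 1 0 v y) ((c 3 / a 1) *\<^sub>R e 3)"
    using R(3)[of 3] n v by (simp add: frame_simps Bu N_iff Dv linear_scale[OF linear_comb] comb_e)
  hence "r' 3 = (c 3 / a 1) *\<^sub>R e 3"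
    using R(4) E.r_in_N[of 3] n by (elim inj_onD) (auto simp: N_iff coord_e)
  with R 1 show ?thesis by (intro that)
qed

end

text \<open>Reduces a normalisation to five bracket equations in the old coordinates; injectivity of
  the frame map then gives the new structure constants.\<close>

lemma (in leib_ext) reframe_standard:
  fixes y :: vec0 and \<eta> \<zeta> \<tau> :: real
  assumes \<eta>: "\<eta> \<noteq> 0" and y: "y \<in> car T" "y $$ (n + 1) \<noteq> 0"
    and N: "\<rho>1 \<in> N" "\<rho>3 \<in> N" "\<kappa>1 \<in> N" "\<kappa>3 \<in> N" "\<sigma> \<in> N"
  defines "g \<equiv> comb n (frame \<eta> \<zeta> (\<eta> *\<^sub>R e 3 + \<tau> *\<^sub>R e 2) y)"
  assumes "B (\<eta> *\<^sub>R e 1 + \<zeta> *\<^sub>R e 2) y = g \<rho>1" "B (\<eta> *\<^sub>R e 3 + \<tau> *\<^sub>R e 2) y = g \<rho>3"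
    "B y (\<eta> *\<^sub>R e 1 + \<zeta> *\<^sub>R e 2) = g \<kappa>1" "B y (\<eta> *\<^sub>R e 3 + \<tau> *\<^sub>R e 2) = g \<kappa>3" "B y y = g \<sigma>"
  obtains r' l' where "leib_ext n r' l' \<sigma>" "T \<cong>\<^sub>L L2_ext n r' l' \<sigma>"
    "r' 1 = \<rho>1" "r' 3 = \<rho>3" "l' 1 = \<kappa>1" "l' 3 = \<kappa>3"
proof -
  let ?v = "\<eta> *\<^sub>R e 3 + \<tau> *\<^sub>R e 2"
  have v: "?v \<in> N" "?v $$ 1 = 0" "?v $$ 3 = \<eta>" using n by (auto simp: N_iff coord_e)
  obtain r' l' s' where R: "leib_ext n r' l' s'" "T \<cong>\<^sub>L L2_ext n r' l' s'"
    "\<And>i. i \<in> {1..n} \<Longrightarrow> g (r' i) = B (frame \<eta> \<zeta> ?v y i) y"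
    "\<And>i. i \<in> {1..n} \<Longrightarrow> g (l' i) = B y (frame \<eta> \<zeta> ?v y i)"
    "g s' = B y y" "inj_on g N"
    by (rule reframe[OF v \<eta> y, where \<zeta> = \<zeta>, folded g_def]) (rule that; assumption)
  interpret E: leib_ext n r' l' s' by fact
  have m: "1 \<in> {1..n}" "3 \<in> {1..n}" using n by auto
  have "r' 1 = \<rho>1" "r' 3 = \<rho>3" "l' 1 = \<kappa>1" "l' 3 = \<kappa>3" "s' = \<sigma>"
    using R(3)[OF m(1)] R(3)[OF m(2)] R(4)[OF m(1)] R(4)[OF m(2)] R(5) assms(10-14)
      E.r_in_N[OF m(1)] E.r_in_N[OF m(2)] E.l_in_N[OF m(1)] E.l_in_N[OF m(2)] E.s_in_N N
    by (auto simp: frame_simps intro: inj_onD[OF R(6)])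
  with R(1,2) show ?thesis by (intro that[of r' l']) simp_all
qed

context leib_ext_nonnil
begin

text \<open>Chosen so that [\<open>e 1\<close>,\<open>shift\<close>] cancels the coordinates 4, ...,
  n of D \<open>e 1\<close>, at the cost of adding \<open>a 4\<close> to coordinate 2.\<close>

definition "shift = (\<Sum>k=4..n. a k *\<^sub>R e (k - 1))"

lemma coord_shift: "shift $$ k = (if 3 \<le> k \<and> k < n then a (k + 1) else 0)"
proof -
  have "shift $$ k = (\<Sum>i=4..n. if i = k + 1 then a (k + 1) * e k $$ k else 0)"
    unfolding shift_def coord_simps coord_scaleR
  proof (rule sum.cong[OF refl])
    fix i assume "i \<in> {4..n}"
    hence "i - 1 = k \<longleftrightarrow> i = k + 1" by auto
    thus "a i * e (i - 1) $$ k = (if i = k + 1 then a (k + 1) * e k $$ k else 0)" by (auto simp: coord_e)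
  qed
  thus ?thesis by (auto simp: coord_e)
qed

text \<open>Adding \<open>shift\<close> to x removes the high coordinates of D \<open>e 1\<close>
  and leaves \<open>r 3\<close> alone, since \<open>shift\<close> has no coordinate 1. \<zeta> = t
  repairs coordinate 2.\<close>

lemma make_r1_linear:
  assumes a1: "a 1 = 1" and c: "\<And>k. k \<noteq> 3 \<Longrightarrow> c k = 0"
  obtains r' l' s' where "leib_ext n r' l' s'" "T \<cong>\<^sub>L L2_ext n r' l' s'"
    "r' 1 = e 1 + a 3 *\<^sub>R e 3" "r' 3 = (a 3 + 1) *\<^sub>R e 3" "l' 1 = - r' 1" "l' 3 = - r' 3"
proof -
  have p': "p' = 0" using constraint3 c a1 by simp
  \<comment> \<open>By \<open>constraint1\<close> this one choice removes the \<open>e 2\<close>-components of both \<open>[u, y]\<close> and \<open>[y, u]\<close>.\<close>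
  define t where "t = a 2 - p"
  have t: "a 2 + a 4 + t * (\<mu> - 1) = 0" using constraint1 p' a1 by (simp add: t_def algebra_simps)
  define y where "y = e (n + 1) + shift"
  have y1: "y $$ (n + 1) = 1" "y $$ 1 = 0" "y $$ 3 = a 4" using n by (auto simp: y_def coord_e coord_shift)
  have yk: "y $$ k = shift $$ k" if "k \<le> n" for k using that by (simp add: y_def coord_e)
  have y: "y \<in> car T" "y $$ (n + 1) \<noteq> 0"
    using y1 by (auto simp: y_def car_iff coord_e coord_shift simp del: car_L2_ext)
  have sh: "shift $$ (k - 1) = a k" if "4 \<le> k" "k \<le> n" for k using that by (auto simp: coord_shift)
  have N: "e 1 + a 3 *\<^sub>R e 3 \<in> N" "(a 3 + 1) *\<^sub>R e 3 \<in> N" "- (e 1 + a 3 *\<^sub>R e 3) \<in> N" "- ((a 3 + 1) *\<^sub>R e 3) \<in> N"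
    using n by (auto simp: N_iff coord_e)
  have r1: "r 1 $$ k = 0" if "k \<notin> {1..n}" for k using r_in_N[of 1] n that by (simp add: N_iff)
  have r3: "r 3 = (a 3 + 1) *\<^sub>R e 3" by (rule vec0_eqI) (use c c3 a1 in \<open>simp add: coord_e\<close>)
  let ?u = "1 *\<^sub>R e 1 + t *\<^sub>R e 2" and ?v = "1 *\<^sub>R e 3 + 0 *\<^sub>R e 2"
  let ?g = "comb n (frame 1 t ?v y)"
  have u: "?u $$ (n + 1) = 0" and v: "?v $$ (n + 1) = 0" using n by (auto simp: coord_e)
  have k: "k = 0 \<or> k = 1 \<or> k = 2 \<or> k = 3 \<or> 4 \<le> k \<and> k \<le> n \<or> k > n \<and> k > 3" for k :: nat by arith
  have D1: "D ?u = r 1 + (t * \<mu>) *\<^sub>R e 2" "\<Lambda> ?u = p *\<^sub>R e 2 - r 1"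
    "D ?v = (a 3 + 1) *\<^sub>R e 3" "\<Lambda> ?v = - ((a 3 + 1) *\<^sub>R e 3)"
    unfolding D_linear \<Lambda>_linear DL_e l1 l3 p' r3 by simp_all
  have 1: "B ?u y = ?g (e 1 + a 3 *\<^sub>R e 3)" unfolding B_y(1)[OF u] y1 D1
  proof (rule vec0_eqI, goal_cases)
    case (1 k)
    show ?case
      unfolding comb_frame[OF N(1)] using k[of k] n t a1 r1 sh
      by (auto simp: coord_nb coord_e y1 yk algebra_simps)
  qed
  have 2: "B ?v y = ?g ((a 3 + 1) *\<^sub>R e 3)" unfolding B_y(1)[OF v] y1 D1
  proof (rule vec0_eqI, goal_cases)
    case (1 k)
    show ?case
      unfolding comb_frame[OF N(2)] using k[of k] n
      by (auto simp: coord_nb coord_e y1)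
  qed
  have 3: "B y ?u = ?g (- (e 1 + a 3 *\<^sub>R e 3))" unfolding B_y(2)[OF u] y1 D1
  proof (rule vec0_eqI, goal_cases)
    case (1 k)
    show ?case
      unfolding comb_frame[OF N(3)] using k[of k] n a1 r1 sh
      by (auto simp: coord_nb coord_e y1 yk t_def algebra_simps)
  qed
  have 4: "B y ?v = ?g (- ((a 3 + 1) *\<^sub>R e 3))" unfolding B_y(2)[OF v] y1 D1
  proof (rule vec0_eqI, goal_cases)
    case (1 k)
    show ?case
      unfolding comb_frame[OF N(4)] using k[of k] n
      by (auto simp: coord_nb coord_e y1)
  qed
  \<comment> \<open>The square is left uncontrolled here; it is treated in the next step of the
    reduction.\<close>
  have "N \<subseteq> ?g ` N" unfolding comb_image by (rule frame_span) (use n in \<open>auto simp: N_iff coord_e\<close>)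
  then obtain \<sigma> where \<sigma>: "\<sigma> \<in> N" "B y y = ?g \<sigma>" using B_in_N[of y y] by blast
  obtain r' l' where "leib_ext n r' l' \<sigma>" "T \<cong>\<^sub>L L2_ext n r' l' \<sigma>"
    "r' 1 = e 1 + a 3 *\<^sub>R e 3" "r' 3 = (a 3 + 1) *\<^sub>R e 3" "l' 1 = - (e 1 + a 3 *\<^sub>R e 3)" "l' 3 = - ((a 3 + 1) *\<^sub>R e 3)"
    by (rule reframe_standard[OF _ y N \<sigma>(1) 1 2 3 4 \<sigma>(2)]) simp_all
  thus ?thesis by (intro that[of r' l' \<sigma>]) simp_all
qed

text \<open>If \<open>\<mu> \<noteq> 0\<close> the \<open>e 2\<close>-component of the square is absorbed by \<open>\<tau>\<close>.  If \<open>\<mu> = 0\<close> it must be absorbed by \<open>\<rho>\<close>,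
  at the price of an \<open>e 5\<close>-component of \<open>[e 1, x]\<close>.\<close>

lemma absorb_square_and_rescale:
  fixes \<eta> \<tau> \<rho> :: real
  assumes r: "r 1 = e 1 + a 3 *\<^sub>R e 3" "r 3 = (a 3 + 1) *\<^sub>R e 3" and l: "l 1 = - r 1" "l 3 = - r 3"
    and \<eta>: "\<eta> \<noteq> 0" and \<tau>\<rho>: "\<tau> * \<mu> + \<rho> + s $$ 2 = 0"
  defines "\<rho>1 \<equiv> e 1 + a 3 *\<^sub>R e 3 - (if n \<ge> 5 then \<rho> / \<eta>\<^sup>2 else 0) *\<^sub>R e 5"
  obtains r' l' where "leib_ext n r' l' ((s $$ n / \<eta> ^ (n - 2)) *\<^sub>R e n)"
    "T \<cong>\<^sub>L L2_ext n r' l' ((s $$ n / \<eta> ^ (n - 2)) *\<^sub>R e n)"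
    "r' 1 = \<rho>1" "r' 3 = (a 3 + 1) *\<^sub>R e 3" "l' 1 = - \<rho>1" "l' 3 = - (a 3 + 1) *\<^sub>R e 3"
proof -
  have a1: "a 1 = 1" using arg_cong[OF r(1), of "\<lambda>u. u $$ 1"] by (simp add: coord_e)
  \<comment> \<open>\<Phi> takes the added vector to (\<mu> \<tau> + \<rho>) \<open>e 2\<close>,
    which changes the square by exactly the required amount.\<close>
  define y where "y = e (n + 1) + \<tau> *\<^sub>R e 2 + \<rho> *\<^sub>R e 4"
  have y1: "y $$ (n + 1) = 1" "y $$ 1 = 0" "y $$ 3 = 0" "y $$ 2 = \<tau>" "y $$ 4 = \<rho>"
    using n by (auto simp: y_def coord_e)
  have yk: "y $$ k = 0" if "k \<noteq> 2" "k \<noteq> 4" "k \<noteq> n + 1" for k using that by (simp add: y_def coord_e)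
  have y: "y \<in> car T" "y $$ (n + 1) \<noteq> 0"
    using n y1 by (auto simp: y_def car_iff coord_e simp del: car_L2_ext)
  let ?\<sigma> = "(s $$ n / \<eta> ^ (n - 2)) *\<^sub>R e n"
  have N: "\<rho>1 \<in> N" "(a 3 + 1) *\<^sub>R e 3 \<in> N" "- \<rho>1 \<in> N" "- (a 3 + 1) *\<^sub>R e 3 \<in> N" "?\<sigma> \<in> N"
    using n by (auto simp: N_iff coord_e \<rho>1_def)
  let ?u = "\<eta> *\<^sub>R e 1 + 0 *\<^sub>R e 2" and ?v = "\<eta> *\<^sub>R e 3 + 0 *\<^sub>R e 2"
  let ?g = "comb n (frame \<eta> 0 ?v y)"
  have u: "?u $$ (n + 1) = 0" and v: "?v $$ (n + 1) = 0" using n by (auto simp: coord_e)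
  have k: "k = 0 \<or> k = 1 \<or> k = 2 \<or> k = 3 \<or> k = 4 \<or> k = 5 \<and> k \<le> n \<or> 6 \<le> k \<and> k \<le> n \<or> k > n \<and> k > 4" for k :: nat
    using n by arith
  have y6: "y $$ (k - 1) = 0" if "6 \<le> k" "k \<le> n" for k using that by (intro yk) auto
  \<comment> \<open>[\<eta> \<open>e 1\<close>, \<rho> \<open>e 4\<close>] = -\<eta> \<rho>
    \<open>e 5\<close> for n \<ge> 5, while the new fifth basis vector is \<eta> cubed times
    \<open>e 5\<close>.\<close>
  have \<eta>3: "\<eta> ^ 3 * (\<rho> / \<eta>\<^sup>2) = \<eta> * \<rho>" using \<eta> by (simp add: power2_eq_square power3_eq_cube)
  have D1: "D ?u = \<eta> *\<^sub>R (e 1 + a 3 *\<^sub>R e 3)" "\<Lambda> ?u = - (\<eta> *\<^sub>R (e 1 + a 3 *\<^sub>R e 3))"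
    "D ?v = \<eta> *\<^sub>R ((a 3 + 1) *\<^sub>R e 3)" "\<Lambda> ?v = - (\<eta> *\<^sub>R ((a 3 + 1) *\<^sub>R e 3))"
    unfolding D_linear \<Lambda>_linear DL_e l using r by simp_all
  have 1: "B ?u y = ?g \<rho>1" unfolding B_y(1)[OF u] y1 D1
  proof (rule vec0_eqI, goal_cases)
    case (1 k)
    show ?case
      unfolding comb_frame[OF N(1)] using k[of k] n y6[of k] \<eta>3
      by (auto simp: coord_nb coord_e y1 \<rho>1_def)
  qed
  have 2: "B ?v y = ?g ((a 3 + 1) *\<^sub>R e 3)" unfolding B_y(1)[OF v] y1 D1
  proof (rule vec0_eqI, goal_cases)
    case (1 k)
    show ?case
      unfolding comb_frame[OF N(2)] using k[of k] n
      by (auto simp: coord_nb coord_e y1)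
  qed
  have 3: "B y ?u = ?g (- \<rho>1)" unfolding B_y(2)[OF u] y1 D1
  proof (rule vec0_eqI, goal_cases)
    case (1 k)
    show ?case
      unfolding comb_frame[OF N(3)] using k[of k] n y6[of k] \<eta>3
      by (auto simp: coord_nb coord_e y1 \<rho>1_def)
  qed
  have 4: "B y ?v = ?g (- (a 3 + 1) *\<^sub>R e 3)" unfolding B_y(2)[OF v] y1 D1
  proof (rule vec0_eqI, goal_cases)
    case (1 k)
    show ?case
      unfolding comb_frame[OF N(4)] using k[of k] n
      by (auto simp: coord_nb coord_e y1 algebra_simps)
  qed
  have \<Phi>y: "\<Phi> y = (\<mu> * \<tau> + \<rho>) *\<^sub>R e 2" unfolding \<Phi>_explicit y1 a1 by simp
  have nby: "nb n y y = 0" by (rule vec0_eqI) (use n y1 in \<open>simp add: coord_nb\<close>)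
  have 5: "B y y = ?g ?\<sigma>" unfolding B_y(3) y1 \<Phi>y nby
  proof (rule vec0_eqI)
    fix k
    have "s $$ k = s $$ 2 * e 2 $$ k + s $$ n * e n $$ k"
      using arg_cong[OF s_ann, of "\<lambda>u. u $$ k"] by simp
    thus "(0 + 1 *\<^sub>R ((\<mu> * \<tau> + \<rho>) *\<^sub>R e 2) + 1\<^sup>2 *\<^sub>R s) $$ k = ?g ?\<sigma> $$ k"
      unfolding comb_frame[OF N(5)] using n \<tau>\<rho> \<eta> by (simp add: coord_e algebra_simps)
  qed
  obtain r' l' where "leib_ext n r' l' ?\<sigma>" "T \<cong>\<^sub>L L2_ext n r' l' ?\<sigma>"
    "r' 1 = \<rho>1" "r' 3 = (a 3 + 1) *\<^sub>R e 3" "l' 1 = - \<rho>1" "l' 3 = - (a 3 + 1) *\<^sub>R e 3"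
    by (rule reframe_standard[OF \<eta> y N 1 2 3 4 5])
  thus ?thesis by (rule that)
qed

end

section \<open>Reduction in the case where \<open>e 1\<close> has weight 0\<close>

context leib_ext_nonnil
begin

lemma abelian_scale:
  assumes a1: "a 1 = 0"
  obtains r' l' s' where "leib_ext n r' l' s'" "T \<cong>\<^sub>L L2_ext n r' l' s'"
    "r' 1 $$ 1 = 0" "r' 1 $$ 3 = 1" "r' 3 $$ 4 = 0"
proof -
  have a3: "a 3 \<noteq> 0" using nonnil a1 by simp
  \<comment> \<open>Division by \<open>a 3\<close> normalises the weight. Since
    [\<open>e 3\<close>,\<open>e 1\<close>] = \<open>e 4\<close>, the multiple of \<open>e 1\<close>
    cancels coordinate 4 of \<open>r 3\<close>; the products it creates with \<open>e 1\<close> lie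
    on \<open>e 2\<close>.\<close>
  define y where "y = (1 / a 3) *\<^sub>R e (n + 1) - (c 4 / a 3) *\<^sub>R e 1"
  have y: "y \<in> car T" "y $$ (n + 1) \<noteq> 0"
    using n a3 by (auto simp: y_def car_iff coord_e simp del: car_L2_ext)
  let ?u = "1 *\<^sub>R e 1 + 0 *\<^sub>R e 2" and ?v = "1 *\<^sub>R e 3 + 0 *\<^sub>R e 2"
  let ?g = "comb n (frame 1 0 ?v y)"
  have g: "?g z = z" if "z \<in> N" for z
  proof (rule vec0_eqI)
    fix k
    show "?g z $$ k = z $$ k" unfolding comb_frame[OF that] using that by (auto simp: N_iff)
  qed
  obtain r' l' where R: "leib_ext n r' l' (B y y)" "T \<cong>\<^sub>L L2_ext n r' l' (B y y)" "r' 1 = B ?u y" "r' 3 = B ?v y"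
    by (rule reframe_standard[OF one_neq_zero y, of "B ?u y" "B ?v y" "B y ?u" "B y ?v" "B y y" 0 0])
      (simp_all only: g B_in_N)
  have "r' 1 = nb n (e 1) y + (1 / a 3) *\<^sub>R r 1"
    using n B_y(1)[of "e 1" y] by (simp add: R(3) DL_e y_def coord_e)
  hence "r' 1 $$ 1 = 0" "r' 1 $$ 3 = 1" using n a1 a3 by (simp_all add: coord_nb)
  moreover have "r' 3 = nb n (e 3) y + (1 / a 3) *\<^sub>R r 3"
    using n B_y(1)[of "e 3" y] by (simp add: R(4) DL_e y_def coord_e)
  hence "r' 3 $$ 4 = 0" using n by (simp add: coord_nb y_def coord_e)
  ultimately show ?thesis using R by (intro that[of r' l' "B y y"])
qed

lemma abelian_straighten:
  assumes a1: "a 1 = 0" and a3: "a 3 = 1" and c4: "c 4 = 0"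
  obtains r' l' where "leib_ext n r' l' 0" "T \<cong>\<^sub>L L2_ext n r' l' 0"
    "r' 1 = e 3" "r' 3 = r 3" "l' 1 = - e 3" "l' 3 = - r 3"
proof -
  have c2: "c 2 = 0" using constraint3 a1 a3 by simp
  have c3': "c 3 = 1" using c3 a1 a3 by simp
  have p: "a 2 + p' = p" using constraint1 a1 a3 by simp
  have sn: "s $$ n = 0" using s_constraint(1) a1 a3 by simp
  \<comment> \<open>With \<tau> = -p', coordinate 2 of [u,y] must equal -p'; it is
    \<open>a 2\<close> + \<open>a 4\<close> + t because \<mu> = 1.\<close>
  define t where "t = - p' - a 2 - a 4"
  \<comment> \<open>The square of \<open>y\<close> has \<open>e 2\<close>-component
    \<open>a 4 * p'\<close> + \<omega> + \<open>s $$ 2\<close>, which this choice makes 0.\<close>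
  define \<omega> where "\<omega> = - s $$ 2 - a 4 * p'"
  define y where "y = e (n + 1) + shift + \<omega> *\<^sub>R e 2"
  have y1: "y $$ (n + 1) = 1" "y $$ 1 = 0" "y $$ 3 = a 4" "y $$ 2 = \<omega>"
    using n by (auto simp: y_def coord_e coord_shift)
  have yk: "y $$ k = shift $$ k" if "k \<le> n" "k \<noteq> 2" for k using that by (simp add: y_def coord_e)
  have y: "y \<in> car T" "y $$ (n + 1) \<noteq> 0"
    using y1 n by (auto simp: y_def car_iff coord_e coord_shift simp del: car_L2_ext)
  have sh: "shift $$ (k - 1) = a k" "k - 1 \<noteq> 2" if "4 \<le> k" "k \<le> n" for k using that by (auto simp: coord_shift)
  have r3N: "r 3 \<in> N" using n by (intro r_in_N) simp
  hence N: "e 3 \<in> N" "r 3 \<in> N" "- e 3 \<in> N" "- r 3 \<in> N" "0 \<in> N"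
    using n by (auto simp: N_iff coord_e)
  have r1: "r 1 $$ k = 0" if "k \<notin> {1..n}" for k using r_in_N[of 1] n that by (simp add: N_iff)
  have r30: "r 3 $$ k = 0" if "k \<notin> {1..n}" for k using r3N that by (simp add: N_iff)
  let ?u = "1 *\<^sub>R e 1 + t *\<^sub>R e 2" and ?v = "1 *\<^sub>R e 3 + (- p') *\<^sub>R e 2"
  let ?g = "comb n (frame 1 t ?v y)"
  have u: "?u $$ (n + 1) = 0" and v: "?v $$ (n + 1) = 0" using n by (auto simp: coord_e)
  have k: "k = 0 \<or> k = 1 \<or> k = 2 \<or> k = 3 \<or> 4 \<le> k \<and> k \<le> n \<or> k > n \<and> k > 3" for k :: nat by arith
  have D1: "D ?u = r 1 + t *\<^sub>R e 2" "\<Lambda> ?u = p *\<^sub>R e 2 - r 1"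
    "D ?v = r 3 - p' *\<^sub>R e 2" "\<Lambda> ?v = p' *\<^sub>R e 2 - r 3"
    unfolding D_linear \<Lambda>_linear DL_e l1 l3 using a1 a3 by simp_all
  have 1: "B ?u y = ?g (e 3)" unfolding B_y(1)[OF u] y1 D1
  proof (rule vec0_eqI, goal_cases)
    case (1 k)
    show ?case
      unfolding comb_frame[OF N(1)] using k[of k] n a1 a3 r1 sh[of k] yk[of "k - 1"]
      by (auto simp: coord_nb coord_e y1 t_def)
  qed
  have 2: "B ?v y = ?g (r 3)" unfolding B_y(1)[OF v] y1 D1
  proof (rule vec0_eqI, goal_cases)
    case (1 k)
    show ?case
      unfolding comb_frame[OF N(2)] using k[of k] n c1 c2 c3' r30
      by (auto simp: coord_nb coord_e y1)
  qed
  have 3: "B y ?u = ?g (- e 3)" unfolding B_y(2)[OF u] y1 D1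
  proof (rule vec0_eqI, goal_cases)
    case (1 k)
    show ?case
      unfolding comb_frame[OF N(3)] using k[of k] n a1 a3 r1 sh[of k] yk[of "k - 1"] p
      by (auto simp: coord_nb coord_e y1)
  qed
  have 4: "B y ?v = ?g (- r 3)" unfolding B_y(2)[OF v] y1 D1
  proof (rule vec0_eqI, goal_cases)
    case (1 k)
    show ?case
      unfolding comb_frame[OF N(4)] using k[of k] n c1 c2 c3' r30
      by (auto simp: coord_nb coord_e y1)
  qed
  have \<phi>3: "a 4 *\<^sub>R \<phi> 3 = (a 4 * p') *\<^sub>R e 2"
    by (rule trans[OF arg_cong[OF \<phi>_e2(2), of "scaleR (a 4)"] scaleR_scaleR])
  have \<Phi>y: "\<Phi> y = (a 4 * p' + \<omega>) *\<^sub>R e 2" unfolding \<Phi>_explicit y1 a1 a3 \<phi>3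
    by (simp add: algebra_simps)
  have nby: "nb n y y = 0" by (rule vec0_eqI) (use n y1 in \<open>simp add: coord_nb\<close>)
  have "B y y = 0" unfolding B_y(3) y1 \<Phi>y nby
  proof (rule vec0_eqI)
    fix k
    have "s $$ k = s $$ 2 * e 2 $$ k + s $$ n * e n $$ k"
      using arg_cong[OF s_ann, of "\<lambda>u. u $$ k"] by simp
    thus "(0 + 1 *\<^sub>R ((a 4 * p' + \<omega>) *\<^sub>R e 2) + 1\<^sup>2 *\<^sub>R s) $$ k = 0 $$ k"
      by (simp add: sn \<omega>_def coord_e)
  qed
  hence 5: "B y y = ?g 0" by (simp add: linear_0[OF linear_comb])
  show ?thesis by (rule reframe_standard[OF one_neq_zero y N 1 2 3 4 5]) (rule that; assumption)
qed

text \<open>The new \<open>e k\<close> is the old one times \<eta> to the power k - 2, so the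
  coefficient of D \<open>e 3\<close> at \<open>e k\<close> is divided by \<eta> to the power k -
  3.\<close>

lemma abelian_rescale:
  fixes \<eta> :: real
  assumes r1: "r 1 = e 3" and l: "l 1 = - e 3" "l 3 = - r 3" and s: "s = 0" and \<eta>: "\<eta> \<noteq> 0"
  defines "z \<equiv> \<Sum>k=3..n. (c k / \<eta> ^ (k - 3)) *\<^sub>R e k"
  obtains r' l' where "leib_ext n r' l' 0" "T \<cong>\<^sub>L L2_ext n r' l' 0"
    "r' 1 = e 3" "r' 3 = z" "l' 1 = - e 3" "l' 3 = - z"
proof -
  have a: "a 1 = 0" "a 3 = 1" by (simp_all add: r1 coord_e)
  have c2: "c 2 = 0" using constraint3 a by simp
  have z: "z $$ k = (if 3 \<le> k \<and> k \<le> n then c k / \<eta> ^ (k - 3) else 0)" for k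
    unfolding z_def by (simp add: coord_e if_distrib cong: if_cong)
  have r30: "r 3 $$ k = 0" if "k \<notin> {1..n}" for k using r_in_N[of 3] n that by (simp add: N_iff)
  define y where "y = e (n + 1)"
  have y: "y \<in> car T" "y $$ (n + 1) \<noteq> 0" by (auto simp: y_def car_iff coord_e simp del: car_L2_ext)
  have N: "e 3 \<in> N" "z \<in> N" "- e 3 \<in> N" "- z \<in> N" "0 \<in> N" using n by (auto simp: N_iff coord_e z)
  let ?u = "\<eta> *\<^sub>R e 1 + 0 *\<^sub>R e 2" and ?v = "\<eta> *\<^sub>R e 3 + 0 *\<^sub>R e 2"
  let ?g = "comb n (frame \<eta> 0 ?v y)"
  have u: "?u $$ (n + 1) = 0" and v: "?v $$ (n + 1) = 0" using n by (auto simp: coord_e)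
  have \<eta>k: "\<eta> ^ (k - 2) * (t / \<eta> ^ (k - 3)) = \<eta> * t" if "3 \<le> k" for k t
  proof -
    have "k - 2 = Suc (k - 3)" using that by arith
    thus ?thesis using \<eta> by simp
  qed
  have k: "k = 0 \<or> k = 1 \<or> k = 2 \<or> 3 \<le> k \<and> k \<le> n \<or> k \<notin> {1..n} \<and> k > 3" for k :: nat
    using n unfolding atLeastAtMost_iff by arith
  have g: "?g z = \<eta> *\<^sub>R r 3"
  proof (rule vec0_eqI)
    fix k
    show "?g z $$ k = (\<eta> *\<^sub>R r 3) $$ k"
      unfolding comb_frame[OF N(2)] using k[of k] c1 c2 r30[of k] \<eta>k[of k "c k"] by (auto simp: z)
  qed
  have g3: "?g (e 3) = \<eta> *\<^sub>R e 3"
  proof (rule vec0_eqI)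
    fix k
    show "?g (e 3) $$ k = (\<eta> *\<^sub>R e 3) $$ k"
      unfolding comb_frame[OF N(1)] using n by (simp add: coord_e)
  qed
  have gm: "?g (- x) = - ?g x" "?g 0 = 0" for x
    by (simp_all add: linear_neg[OF linear_comb] linear_0[OF linear_comb])
  have 1: "B ?u y = ?g (e 3)" unfolding g3 using B_x(1)[OF u] by (simp add: y_def D_linear DL_e r1)
  have 2: "B ?v y = ?g z" unfolding g using B_x(1)[OF v] by (simp add: y_def D_linear DL_e)
  have 3: "B y ?u = ?g (- e 3)" unfolding gm g3 using B_x(2)[OF u] by (simp add: y_def \<Lambda>_linear DL_e l)
  have 4: "B y ?v = ?g (- z)" unfolding gm g using B_x(2)[OF v] by (simp add: y_def \<Lambda>_linear DL_e l)
  have 5: "B y y = ?g 0" unfolding gm(2) unfolding y_def B_x(3) by (rule s)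
  show ?thesis by (rule reframe_standard[OF \<eta> y N 1 2 3 4 5]) (rule that; assumption)
qed

end

section \<open>Identification with the listed algebras\<close>

lemma leib_ext_nonnilI: "leib_ext n r l s \<Longrightarrow> r 1 $$ 1 \<noteq> 0 \<or> r 1 $$ 3 \<noteq> 0 \<Longrightarrow> leib_ext_nonnil n r l s"
  by (simp add: leib_ext_nonnil_def leib_ext_nonnil_axioms_def)

lemma g1_eqI:
  assumes E: "leib_ext n r l 0" and "r 1 = e 1 + (a - 2) *\<^sub>R e 3" "r 3 = (a - 1) *\<^sub>R e 3"
    "l 1 = - (e 1 + (a - 2) *\<^sub>R e 3)" "l 3 = - (a - 1) *\<^sub>R e 3"
  shows "L2_ext n r l 0 = g1 n a"
proof -
  have n: "n \<ge> 4" using E leib_ext_def by blast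
  have "leib_ext_nonnil n r l 0" by (rule leib_ext_nonnilI[OF E]) (simp add: assms(2) coord_e)
  thus ?thesis unfolding g1_def
    by (rule L2_ext_determined[OF _ std_ext.leib_ext_nonnil[OF std_ext_g1[OF n]]])
      (simp_all add: assms algebra_simps)
qed

lemma g2_eqI:
  assumes n: "n \<ge> 5" and E: "leib_ext n r l 0" and "r 1 = e 1 - 2 *\<^sub>R e 3 + \<delta> *\<^sub>R e 5" "r 3 = - e 3"
    "l 1 = - (e 1 - 2 *\<^sub>R e 3 + \<delta> *\<^sub>R e 5)" "l 3 = e 3"
  shows "L2_ext n r l 0 = g2 n \<delta>"
proof -
  have "leib_ext_nonnil n r l 0" by (rule leib_ext_nonnilI[OF E]) (simp add: assms(3) coord_e)
  thus ?thesis unfolding g2_def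
    by (rule L2_ext_determined[OF _ std_ext.leib_ext_nonnil[OF std_ext_g2[OF n]]])
      (simp_all add: assms algebra_simps)
qed

lemma g3_eqI:
  assumes n: "n \<ge> 5" and E: "leib_ext n r l (\<delta> *\<^sub>R e n)" and "r 1 = e 1 + (2 - real n) *\<^sub>R e 3" "r 3 = (3 - real n) *\<^sub>R e 3"
    "l 1 = - (e 1 + (2 - real n) *\<^sub>R e 3)" "l 3 = - (3 - real n) *\<^sub>R e 3"
  shows "L2_ext n r l (\<delta> *\<^sub>R e n) = g3 n \<delta>"
proof -
  have n1: "3 \<le> n - 1" using n by arith
  have "leib_ext_nonnil n r l (\<delta> *\<^sub>R e n)" by (rule leib_ext_nonnilI[OF E]) (simp add: assms(3) coord_e)
  thus ?thesis unfolding g3_def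
    by (rule L2_ext_determined[OF _ std_ext.leib_ext_nonnil[OF std_ext_g3[OF n]]])
      (use n1 in \<open>simp_all add: assms algebra_simps\<close>)
qed

lemma g4_eqI:
  assumes E: "leib_ext n r l 0" and "r 1 = e 3"
    "r 3 = e 3 + (if 3 + 2 \<le> n then \<epsilon> *\<^sub>R e (3 + 2) else 0) + (\<Sum>k=3+3..n. b (k - 3 - 2) *\<^sub>R e k)"
    "l 1 = - e 3" "l 3 = - r 3"
  shows "L2_ext n r l 0 = g4 n \<epsilon> b"
proof -
  have n: "n \<ge> 4" using E leib_ext_def by blast
  have "leib_ext_nonnil n r l 0" by (rule leib_ext_nonnilI[OF E]) (simp add: assms(2) coord_e)
  thus ?thesis unfolding g4_def
    by (rule L2_ext_determined[OF _ std_ext.leib_ext_nonnil[OF std_ext_g4[OF n]]])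
      (simp_all add: assms)
qed

definition listed :: "nat \<Rightarrow> ('a::real_vector) alg \<Rightarrow> bool" where
  "listed n L \<longleftrightarrow> (\<exists>a. L \<cong>\<^sub>L g1 n a)
      \<or> (n \<ge> 5 \<and> (\<exists>\<delta>\<in>{1, -1}. L \<cong>\<^sub>L g2 n \<delta>))
      \<or> (n \<ge> 5 \<and> (\<exists>\<delta>\<in>{1, -1}. L \<cong>\<^sub>L g3 n \<delta>))
      \<or> (\<exists>\<epsilon>\<in>{0, 1, -1}. \<exists>b. L \<cong>\<^sub>L g4 n \<epsilon> b)"

lemma listed_iso: "L \<cong>\<^sub>L M \<Longrightarrow> listed n M \<Longrightarrow> listed n L"
  unfolding listed_def using alg_iso_trans by blast

context leib_ext_nonnil
begin

lemma listed_A3: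
  assumes r: "r 1 = e 1 + a 3 *\<^sub>R e 3" "r 3 = (a 3 + 1) *\<^sub>R e 3" and l: "l 1 = - r 1" "l 3 = - r 3"
  shows "listed n T"
proof -
  have a1: "a 1 = 1" using arg_cong[OF r(1), of "\<lambda>u. u $$ 1"] by (simp add: coord_e)
  show ?thesis
  proof (cases "\<mu> = 0 \<and> n \<ge> 5 \<and> s $$ 2 \<noteq> 0")
    case True
    hence a3: "a 3 = - 2" and n5: "n \<ge> 5" using a1 by auto
    \<comment> \<open>With \<open>a 3\<close> = -2 the weight of \<open>e n\<close> is n - 4,
      nonzero for n \<ge> 5; the two resonances exclude each other.\<close>
    have sn: "s $$ n = 0" using s_constraint(1) a1 a3 n5 by auto
    define \<rho> where "\<rho> = - s $$ 2"
    define \<eta> where "\<eta> = sqrt \<bar>\<rho>\<bar>"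
    have \<rho>: "\<rho> \<noteq> 0" using True by (simp add: \<rho>_def)
    hence \<eta>: "\<eta> \<noteq> 0" by (simp add: \<eta>_def)
    have "\<rho> / \<eta>\<^sup>2 = sgn \<rho>" using \<rho> by (simp add: \<eta>_def sgn_if)
    hence d: "- (\<rho> / \<eta>\<^sup>2) \<in> {1, -1}" "- (\<rho> / \<eta>\<^sup>2) = - sgn \<rho>" using \<rho> by (auto simp: sgn_if)
    have eq: "0 * \<mu> + \<rho> + s $$ 2 = 0" by (simp add: \<rho>_def)
    have \<sigma>: "(s $$ n / \<eta> ^ (n - 2)) *\<^sub>R e n = 0" by (simp add: sn)
    have v: "e 1 + a 3 *\<^sub>R e 3 - (if n \<ge> 5 then \<rho> / \<eta>\<^sup>2 else 0) *\<^sub>R e 5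
        = e 1 - 2 *\<^sub>R e 3 + (- (\<rho> / \<eta>\<^sup>2)) *\<^sub>R e 5" "(a 3 + 1) *\<^sub>R e 3 = - e 3" "- (a 3 + 1) *\<^sub>R e 3 = e 3"
      using n5 by (simp_all add: a3)
    obtain r' l' where R: "leib_ext n r' l' 0" "T \<cong>\<^sub>L L2_ext n r' l' 0"
      "r' 1 = e 1 - 2 *\<^sub>R e 3 + (- (\<rho> / \<eta>\<^sup>2)) *\<^sub>R e 5" "r' 3 = - e 3"
      "l' 1 = - (e 1 - 2 *\<^sub>R e 3 + (- (\<rho> / \<eta>\<^sup>2)) *\<^sub>R e 5)" "l' 3 = e 3"
      by (rule absorb_square_and_rescale[OF r l \<eta> eq, unfolded \<sigma> v]) (rule that; assumption)
    have "L2_ext n r' l' 0 = g2 n (- (\<rho> / \<eta>\<^sup>2))" by (rule g2_eqI[OF n5 R(1) R(3-6)])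
    with R(2) d(1) n5 show ?thesis unfolding listed_def by metis
  next
    case False
    define \<tau> where "\<tau> = (if \<mu> = 0 then 0 else - s $$ 2 / \<mu>)"
    \<comment> \<open>A nonzero \<rho> survives here only for n = 4, where \<open>e 4\<close>
      annihilates N and no \<open>e 5\<close> term is created.\<close>
    define \<rho> where "\<rho> = (if \<mu> = 0 then - s $$ 2 else 0)"
    \<comment> \<open>The square's coefficient at \<open>e n\<close> is divided by \<eta> to the
      power n - 2, which leaves its sign.\<close>
    define \<eta> where "\<eta> = (if s $$ n = 0 then 1 else root (n - 2) \<bar>s $$ n\<bar>)"
    have \<rho>: "\<rho> = 0 \<or> \<not> n \<ge> 5" using False by (auto simp: \<rho>_def)
    have n2: "0 < n - 2" using n by simp
    have \<eta>: "\<eta> \<noteq> 0" using n2 by (simp add: \<eta>_def)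
    have eq: "\<tau> * \<mu> + \<rho> + s $$ 2 = 0" by (simp add: \<tau>_def \<rho>_def)
    let ?\<sigma> = "s $$ n / \<eta> ^ (n - 2)"
    have \<sigma>: "?\<sigma> = sgn (s $$ n)" using n2 by (simp add: \<eta>_def sgn_if real_root_pow_pos2)
    have R0: "e 1 + a 3 *\<^sub>R e 3 - (if n \<ge> 5 then \<rho> / \<eta>\<^sup>2 else 0) *\<^sub>R e 5 = e 1 + a 3 *\<^sub>R e 3" using \<rho> by auto
    obtain r' l' where R: "leib_ext n r' l' (?\<sigma> *\<^sub>R e n)" "T \<cong>\<^sub>L L2_ext n r' l' (?\<sigma> *\<^sub>R e n)"
      "r' 1 = e 1 + a 3 *\<^sub>R e 3" "r' 3 = (a 3 + 1) *\<^sub>R e 3"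
      "l' 1 = - (e 1 + a 3 *\<^sub>R e 3)" "l' 3 = - (a 3 + 1) *\<^sub>R e 3"
      by (rule absorb_square_and_rescale[OF r l \<eta> eq]) (unfold R0, rule that; assumption)
    show ?thesis
    proof (cases "s $$ n = 0")
      case True
      hence \<sigma>0: "?\<sigma> *\<^sub>R e n = 0" by simp
      have "L2_ext n r' l' 0 = g1 n (a 3 + 2)"
        by (rule g1_eqI[OF R(1)[unfolded \<sigma>0]]) (simp_all add: R(3-6))
      with R(2) show ?thesis unfolding \<sigma>0 listed_def by metis
    next
      case False
      hence n5: "n \<ge> 5" using s_constraint(2) n by fastforce
      have a3: "a 3 = 2 - real n" using s_constraint(1) False a1 by simp
      have "L2_ext n r' l' (?\<sigma> *\<^sub>R e n) = g3 n ?\<sigma>"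
        by (rule g3_eqI[OF n5 R(1)]) (simp_all add: R(3-6) a3)
      moreover have "?\<sigma> \<in> {1, -1}" unfolding \<sigma> using False by (auto simp: sgn_if)
      ultimately show ?thesis using R(2) n5 unfolding listed_def by metis
    qed
  qed
qed

lemma listed_B3:
  assumes r1: "r 1 = e 3" and l: "l 1 = - e 3" "l 3 = - r 3" and s: "s = 0" and c4: "c 4 = 0"
  shows "listed n T"
proof -
  have c3': "c 3 = 1" using c3 by (simp add: r1 coord_e)
  define q where "q = (if n \<ge> 5 then c 5 else 0)"
  \<comment> \<open>The coefficient at \<open>e 5\<close> is divided by \<eta> squared, so its
    absolute value becomes 1 and its sign survives as \<epsilon>.\<close>
  define \<eta> where "\<eta> = (if q = 0 then 1 else sqrt \<bar>q\<bar>)"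
  define \<epsilon> where "\<epsilon> = q / \<eta>\<^sup>2"
  \<comment> \<open>Index m stands for \<open>e (m + 5)\<close>, whose rescaling exponent is (m + 5)
    - 3.\<close>
  define b where "b m = c (m + 5) / \<eta> ^ (m + 2)" for m
  define z where "z = (\<Sum>k=3..n. (c k / \<eta> ^ (k - 3)) *\<^sub>R e k)"
  have \<eta>: "\<eta> \<noteq> 0" by (simp add: \<eta>_def)
  have \<epsilon>: "\<epsilon> \<in> {0, 1, -1}" by (auto simp: \<epsilon>_def \<eta>_def abs_if)
  obtain r' l' where R: "leib_ext n r' l' 0" "T \<cong>\<^sub>L L2_ext n r' l' 0"
    "r' 1 = e 3" "r' 3 = z" "l' 1 = - e 3" "l' 3 = - z"
    by (rule abelian_rescale[OF r1 l s \<eta>, folded z_def]) (rule that; assumption)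
  have z: "z = e 3 + (if 3 + 2 \<le> n then \<epsilon> *\<^sub>R e (3 + 2) else 0) + (\<Sum>k=3+3..n. b (k - 3 - 2) *\<^sub>R e k)"
  proof (rule vec0_eqI)
    fix k
    have 1: "z $$ k = (if 3 \<le> k \<and> k \<le> n then c k / \<eta> ^ (k - 3) else 0)"
      unfolding z_def by (simp add: coord_e if_distrib cong: if_cong)
    have 2: "(\<Sum>k=3+3..n. b (k - 3 - 2) *\<^sub>R e k) $$ k = (if 6 \<le> k \<and> k \<le> n then b (k - 3 - 2) else 0)"
      by (simp add: coord_e if_distrib cong: if_cong)
    have 3: "(if 3 + 2 \<le> n then \<epsilon> *\<^sub>R e (3 + 2) else 0) $$ k = (if 5 \<le> n \<and> k = 5 then \<epsilon> else 0)"
      by (simp add: coord_e)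
    have b: "b (k - 3 - 2) = c k / \<eta> ^ (k - 3)" if "6 \<le> k"
    proof -
      have "k - 3 - 2 + 5 = k" "k - 3 - 2 + 2 = k - 3" using that by arith+
      thus ?thesis unfolding b_def by simp
    qed
    have "k < 3 \<or> k = 3 \<or> k = 4 \<or> k = 5 \<or> 6 \<le> k" by arith
    thus "z $$ k = (e 3 + (if 3 + 2 \<le> n then \<epsilon> *\<^sub>R e (3 + 2) else 0) + (\<Sum>k=3+3..n. b (k - 3 - 2) *\<^sub>R e k)) $$ k"
      unfolding coord_simps(1) 1 2 3 using n b c3' c4
      by (elim disjE) (auto simp: coord_e \<epsilon>_def q_def)
  qed
  have "L2_ext n r' l' 0 = g4 n \<epsilon> b" by (rule g4_eqI[OF R(1)]) (simp_all only: R(3-6) z)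
  with R(2) \<epsilon> show ?thesis unfolding listed_def by metis
qed

lemma listed: "listed n T"
proof (cases "a 1 = 0")
  case False
  obtain r1 l1 s1 t where 1: "leib_ext n r1 l1 s1" "T \<cong>\<^sub>L L2_ext n r1 l1 s1" "r1 1 $$ 1 = 1" "r1 3 = t *\<^sub>R e 3"
    by (rule make_r3_diagonal[OF False])
  interpret E1: leib_ext_nonnil n r1 l1 s1 by (rule leib_ext_nonnilI[OF 1(1)]) (simp add: 1)
  have c: "r1 3 $$ k = 0" if "k \<noteq> 3" for k using that by (simp add: 1 coord_e)
  obtain r2 l2 s2 where 2: "leib_ext n r2 l2 s2" "L2_ext n r1 l1 s1 \<cong>\<^sub>L L2_ext n r2 l2 s2"
    "r2 1 = e 1 + r1 1 $$ 3 *\<^sub>R e 3" "r2 3 = (r1 1 $$ 3 + 1) *\<^sub>R e 3" "l2 1 = - r2 1" "l2 3 = - r2 3"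
    by (rule E1.make_r1_linear[OF 1(3) c])
  interpret E2: leib_ext_nonnil n r2 l2 s2 by (rule leib_ext_nonnilI[OF 2(1)]) (simp add: 2 coord_e)
  have "r2 1 $$ 3 = r1 1 $$ 3" by (simp add: 2(3) coord_e)
  hence "listed n (L2_ext n r2 l2 s2)" by (intro E2.listed_A3) (simp_all add: 2)
  thus ?thesis using 1(2) 2(2) listed_iso by blast
next
  case True
  obtain r1 l1 s1 where 1: "leib_ext n r1 l1 s1" "T \<cong>\<^sub>L L2_ext n r1 l1 s1"
    "r1 1 $$ 1 = 0" "r1 1 $$ 3 = 1" "r1 3 $$ 4 = 0"
    by (rule abelian_scale[OF True])
  interpret E1: leib_ext_nonnil n r1 l1 s1 by (rule leib_ext_nonnilI[OF 1(1)]) (simp add: 1)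
  obtain r2 l2 where 2: "leib_ext n r2 l2 0" "L2_ext n r1 l1 s1 \<cong>\<^sub>L L2_ext n r2 l2 0"
    "r2 1 = e 3" "r2 3 = r1 3" "l2 1 = - e 3" "l2 3 = - r1 3"
    by (rule E1.abelian_straighten[OF 1(3-5)])
  interpret E2: leib_ext_nonnil n r2 l2 0 by (rule leib_ext_nonnilI[OF 2(1)]) (simp add: 2 coord_e)
  have "listed n (L2_ext n r2 l2 0)" by (intro E2.listed_B3) (simp_all add: 2 1)
  thus ?thesis using 1(2) 2(2) listed_iso by blast
qed

end

section \<open>From an abstract extension to structure constants\<close>

lemma algebra_on_sub_alg:
  assumes L: "algebra_on L" and N: "ideal_of L N"
  shows "algebra_on (sub_alg L N)"
proof -
  have sub: "subspace N" and NL: "N \<subseteq> car L" and cl: "\<And>x y. x \<in> N \<Longrightarrow> y \<in> N \<Longrightarrow> brk L x y \<in> N"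
    using N unfolding ideal_of_def by blast+
  obtain B0 where B0: "finite B0" "span B0 = car L" using L unfolding algebra_on_def by blast
  obtain B where B: "B \<subseteq> N" "independent B" "N \<subseteq> span B" using maximal_independent_subset[of N] by blast
  have "finite B" using independent_span_bound[OF B0(1) B(2)] B(1) NL B0(2) by blast
  moreover have "span B = N" using B sub by (simp add: span_minimal subset_antisym)
  ultimately have ex: "\<exists>B. finite B \<and> span B = N" by blast
  have lin: "brk L (x + y) z = brk L x z + brk L y z" "brk L x (y + z) = brk L x y + brk L x z"
    "brk L (c *\<^sub>R x) y = c *\<^sub>R brk L x y" "brk L x (c *\<^sub>R y) = c *\<^sub>R brk L x y"
    if "x \<in> N" "y \<in> N" "z \<in> N" for x y z c
    using L subsetD[OF NL that(1)] subsetD[OF NL that(2)] subsetD[OF NL that(3)]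
    unfolding algebra_on_def by blast+
  show ?thesis unfolding algebra_on_def sub_alg_simps
    by (intro conjI sub ex ballI allI cl lin; assumption)
qed

lemma extension_presentation:
  fixes L :: "('a::real_vector) alg"
  assumes n: "n \<ge> 4" and L: "solvable_L2_extension n L"
  shows "\<exists>r l s. leib_ext_nonnil n r l s \<and> L \<cong>\<^sub>L L2_ext n r l s"
proof -
  have leib: "right_leibniz L" and dimL: "dim (car L) = n + 1"
    using L unfolding solvable_L2_extension_def by blast+
  obtain N where nil: "is_nilradical L N" and iso: "sub_alg L N \<cong>\<^sub>L L2 n"
    using L unfolding solvable_L2_extension_def by blast
  have max: "maximal_nilpotent_ideal L N" using nil unfolding is_nilradical_def by blast
  hence N: "ideal_of L N" unfolding maximal_nilpotent_ideal_def by blast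
  have alg: "algebra_on L" by (rule right_leibnizD(1)[OF leib])
  have sL: "subspace (car L)" by (rule algebra_onD(1)[OF alg])
  have sub: "subspace N" and NL: "N \<subseteq> car L" and I: "\<And>x y. x \<in> N \<Longrightarrow> y \<in> car L \<Longrightarrow> brk L x y \<in> N \<and> brk L y x \<in> N"
    using N unfolding ideal_of_def by blast+
  obtain h where h: "bij_betw h (span (e ` {1..n})) N"
     "\<And>x y. x\<in>span (e ` {1..n}) \<Longrightarrow> y\<in>span (e ` {1..n}) \<Longrightarrow> h (x + y) = h x + h y"
     "\<And>c x. x\<in>span (e ` {1..n}) \<Longrightarrow> h (c *\<^sub>R x) = c *\<^sub>R h x"
     "\<And>x y. x\<in>span (e ` {1..n}) \<Longrightarrow> y\<in>span (e ` {1..n}) \<Longrightarrow> h (nb n x y) = brk L (h x) (h y)"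
    using alg_iso_sym[OF algebra_on_sub_alg[OF alg N] iso] unfolding alg_iso_def sub_alg_simps car_L2 by blast
  have hc: "h u = comb n (\<lambda>i. h (e i)) u" if u: "u \<in> span (e ` {1..n})" for u
  proof -
    have "h (\<Sum>i\<in>A. u $$ i *\<^sub>R e i) = (\<Sum>i\<in>A. u $$ i *\<^sub>R h (e i))" if "finite A" "A \<subseteq> {1..n}" for A
      using that
    proof (induction A)
      case empty
      show ?case using h(3)[of 0 0] by (simp add: span_zero)
    next
      case (insert i A)
      have "e i \<in> span (e ` {1..n})" using insert by (intro span_base) auto
      moreover have "(\<Sum>i\<in>A. u $$ i *\<^sub>R e i) \<in> span (e ` {1..n})"
        using insert by (intro span_sum span_scale span_base) auto
      ultimately show ?case using insert by (simp add: h(2,3) span_scale)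
    qed
    hence "h (\<Sum>i=1..n. u $$ i *\<^sub>R e i) = (\<Sum>i=1..n. u $$ i *\<^sub>R h (e i))" by simp
    moreover have "(\<Sum>i=1..n. u $$ i *\<^sub>R e i) = u"
      using u by (intro sum_coord_e) (auto simp: mem_span_e)
    ultimately show ?thesis by (simp add: comb_def)
  qed
  let ?w = "\<lambda>i. h (e i)"
  have N_eq: "N = comb n ?w ` span (e ` {1..n})"
    using bij_betw_imp_surj_on[OF h(1)] hc by (metis image_cong)
  hence spN: "span (?w ` {1..n}) = N" unfolding comb_image by simp
  have inj: "inj_on (comb n ?w) (span (e ` {1..n}))"
    using bij_betw_imp_inj_on[OF h(1)] inj_on_cong[of "span (e ` {1..n})" h "comb n ?w"] hc by blast
  have im: "comb n ?w ` e ` {1..n} = ?w ` {1..n}" by (force simp: comb_e image_iff)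
  have ind: "independent (?w ` {1..n})"
    using linear_independent_injective_image[OF linear_comb independent_e inj] im by simp
  have card: "card (?w ` {1..n}) = n"
  proof -
    have "card (comb n ?w ` e ` {1..n}) = card (e ` {1..n})"
      by (rule card_image) (rule inj_on_subset[OF inj span_superset])
    also have "\<dots> = n" using card_image[OF inj_on_subset[OF inj_e], of "{1..n}"] by simp
    finally show ?thesis unfolding im .
  qed
  have "N \<noteq> car L"
  proof
    assume "N = car L"
    hence "dim N = n + 1" using dimL by simp
    thus False using dim_span_eq_card_independent[OF ind] card spN by simp
  qed
  then obtain x where x: "x \<in> car L" "x \<notin> N" using NL by blast
  define w where "w i = (if i = n + 1 then x else ?w i)" for i
  have w1: "w ` {1..n} = ?w ` {1..n}" by (auto simp: w_def)
  have w2: "w ` {1..n + 1} = insert x (?w ` {1..n})"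
  proof -
    have un: "{1..n + 1} = insert (n + 1) {1..n}" by auto
    have "w (n + 1) = x" by (simp add: w_def)
    thus ?thesis unfolding un image_insert w1 by simp
  qed
  have cn: "comb n w = comb n ?w" unfolding comb_def w_def by (intro ext sum.cong) auto
  obtain B0 where B0: "finite B0" "span B0 = car L" using alg unfolding algebra_on_def by blast
  have sp: "span (w ` {1..n + 1}) = car L"
  proof (rule span_of_independent[OF sL B0])
    have xs: "x \<notin> span (?w ` {1..n})" using x(2) spN by simp
    show "independent (w ` {1..n + 1})" unfolding w2 by (rule independent_insertI[OF xs ind])
    show "w ` {1..n + 1} \<subseteq> car L" unfolding w2 using x(1) NL spN span_superset[of "?w ` {1..n}"] by auto
    have "x \<notin> ?w ` {1..n}" using xs span_superset[of "?w ` {1..n}"] by blast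
    thus "card (w ` {1..n + 1}) = dim (car L)" unfolding w2 dimL using card by simp
  qed
  have wN: "w i \<in> N" if "i \<in> {1..n}" for i
    using span_base[OF imageI[OF that], of w] unfolding w1 spN .
  have pre: "\<exists>z. z \<in> span (e ` {1..n}) \<and> comb n w z = u" if "u \<in> N" for u
    using that unfolding N_eq cn by blast
  \<comment> \<open>Write [x,x] = z + t x with z in \<open>N\<close>. The Leibniz identity gives
    [x,[x,x]] = 0, hence t squared times x lies in \<open>N\<close>, and t = 0.\<close>
  have xx: "brk L x x \<in> N"
  proof -
    have xxL: "brk L x x \<in> car L" by (rule algebra_onD(2)[OF alg x(1) x(1)])
    hence "brk L x x \<in> span (insert x (?w ` {1..n}))" using sp w2 by simp
    then obtain t where t: "brk L x x - t *\<^sub>R x \<in> N" unfolding span_insert spN by blast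
    define z where "z = brk L x x - t *\<^sub>R x"
    have zL: "z \<in> car L" and tx: "t *\<^sub>R x \<in> car L" using t NL x(1) subspace_scale[OF sL] by (auto simp: z_def)
    have "brk L (brk L x x) x = brk L (brk L x x) x + brk L x (brk L x x)"
      by (rule right_leibnizD(2)[OF leib x(1) x(1) x(1)])
    hence "0 = brk L x (z + t *\<^sub>R x)" by (simp add: z_def)
    also have "\<dots> = brk L x z + t *\<^sub>R brk L x x"
      using alg x(1) zL tx unfolding algebra_on_def by metis
    also have "\<dots> = brk L x z + t *\<^sub>R z + (t * t) *\<^sub>R x" by (simp add: z_def algebra_simps)
    finally have "(t * t) *\<^sub>R x = - (brk L x z + t *\<^sub>R z)" by (metis add.inverse_inverse add_eq_0_iff)
    also have "\<dots> \<in> N" using I[of z x] t x(1) sub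
      by (intro subspace_neg subspace_add subspace_scale) (auto simp: z_def)
    finally have "(1 / (t * t)) *\<^sub>R ((t * t) *\<^sub>R x) \<in> N" by (rule subspace_scale[OF sub])
    hence "t = 0" using x(2) by (cases "t = 0") auto
    thus ?thesis using t by simp
  qed
  obtain r where r: "\<And>i. i \<in> {1..n} \<Longrightarrow> r i \<in> span (e ` {1..n})" "\<And>i. i \<in> {1..n} \<Longrightarrow> comb n w (r i) = brk L (w i) x"
    using bchoice[of "{1..n}" "\<lambda>i z. z \<in> span (e ` {1..n}) \<and> comb n w z = brk L (w i) x"] pre I wN x(1) by blast
  obtain l where l: "\<And>i. i \<in> {1..n} \<Longrightarrow> l i \<in> span (e ` {1..n})" "\<And>i. i \<in> {1..n} \<Longrightarrow> comb n w (l i) = brk L x (w i)"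
    using bchoice[of "{1..n}" "\<lambda>i z. z \<in> span (e ` {1..n}) \<and> comb n w z = brk L x (w i)"] pre I wN x(1) by blast
  obtain s where s: "s \<in> span (e ` {1..n})" "comb n w s = brk L x x" using pre[OF xx] by blast
  have data: "ext_data n r l s" using r(1) l(1) s(1) by (simp add: ext_data_def)
  have wx: "w (n + 1) = x" by (simp add: w_def)
  have br: "brk L (w i) (w j) = comb n w (L2_table n i j)" if k: "i \<in> {1..n}" "j \<in> {1..n}" for i j
  proof -
    have ee: "e i \<in> span (e ` {1..n})" "e j \<in> span (e ` {1..n})" using k by (auto intro: span_base)
    have t: "nb n (e i) (e j) = L2_table n i j" unfolding L2_def by (rule table_alg_brk_e[OF k])
    have wij: "w i = h (e i)" "w j = h (e j)" using k by (simp_all add: w_def)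
    have "brk L (w i) (w j) = h (L2_table n i j)" unfolding wij h(4)[OF ee, symmetric] t ..
    also have "\<dots> = comb n w (L2_table n i j)" unfolding cn hc[OF L2_table_in_span[OF n]] ..
    finally show ?thesis .
  qed
  have bx: "i \<in> {1..n} \<Longrightarrow> brk L (w i) (w (n + 1)) = comb n w (r i)"
    "i \<in> {1..n} \<Longrightarrow> brk L (w (n + 1)) (w i) = comb n w (l i)"
    "brk L (w (n + 1)) (w (n + 1)) = comb n w s" for i
    unfolding wx using r(2) l(2) s(2) by simp_all
  note basis = L2_ext_of_basis[OF n alg dimL sp data br bx]
  have iso': "L \<cong>\<^sub>L L2_ext n r l s" by (rule basis(1))
  have E: "leib_ext n r l s"
    using n data right_leibniz_iso[OF leib iso' algebra_on_L2_ext[OF n data]] by unfold_locales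
  \<comment> \<open>Otherwise the whole algebra would be a nilpotent ideal properly containing the
    maximal one.\<close>
  have "leib_ext_nonnil n r l s"
  proof (rule leib_ext_nonnilI[OF E], rule ccontr)
    assume "\<not> (r 1 $$ 1 \<noteq> 0 \<or> r 1 $$ 3 \<noteq> 0)"
    then obtain m where m: "lower_central (L2_ext n r l s) m = {0}"
      using leib_ext.nilpotent_case[OF E] by blast
    have "lower_central L m = comb (n + 1) w ` lower_central (L2_ext n r l s) m"
    proof (rule lower_central_image[OF linear_comb])
      show "comb (n + 1) w ` car (L2_ext n r l s) = car L" unfolding car_L2_ext comb_image by (rule sp)
      show "comb (n + 1) w (brk (L2_ext n r l s) u v) = brk L (comb (n + 1) w u) (comb (n + 1) w v)" for u v
        by (rule basis(3))
    qed
    also have "\<dots> = {0}" unfolding m using linear_0[OF linear_comb] by simp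
    finally have "nilpotent_alg (sub_alg L (car L))" unfolding nilpotent_alg_def sub_alg_def by auto
    moreover have "ideal_of L (car L)" unfolding ideal_of_def using sL algebra_onD(2)[OF alg] by blast
    ultimately have "car L = N" using max NL unfolding maximal_nilpotent_ideal_def by blast
    thus False using x by simp
  qed
  with iso' show ?thesis by blast
qed

lemma classification: "n \<ge> 4 \<Longrightarrow> solvable_L2_extension n L \<Longrightarrow> listed n L"
  using extension_presentation leib_ext_nonnil.listed listed_iso by blast

section \<open>Pairwise non-isomorphism\<close>

lemma iso_preserves:
  fixes L :: "'a::real_vector alg" and M :: "'b::real_vector alg"
  assumes "L \<cong>\<^sub>L M"
  obtains g where "bij_betw g (car L) (car M)"
     "\<And>x y. x\<in>car L \<Longrightarrow> y\<in>car L \<Longrightarrow> g (x + y) = g x + g y"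
     "\<And>c x. x\<in>car L \<Longrightarrow> g (c *\<^sub>R x) = c *\<^sub>R g x"
     "\<And>x y. x\<in>car L \<Longrightarrow> y\<in>car L \<Longrightarrow> g (brk L x y) = brk M (g x) (g y)"
  using assms unfolding alg_iso_def by blast

lemma metabelian_iso:
  assumes L: "algebra_on L" and iso: "L \<cong>\<^sub>L M"
    and M: "\<And>x y z u. brk M (brk M x y) (brk M z u) = 0"
    and x: "x \<in> car L" "y \<in> car L" "z \<in> car L" "u \<in> car L"
  shows "brk L (brk L x y) (brk L z u) = 0"
proof -
  obtain g where g: "bij_betw g (car L) (car M)"
     "\<And>c x. x\<in>car L \<Longrightarrow> g (c *\<^sub>R x) = c *\<^sub>R g x"
     "\<And>x y. x\<in>car L \<Longrightarrow> y\<in>car L \<Longrightarrow> g (brk L x y) = brk M (g x) (g y)"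
    using iso by (rule iso_preserves) (rule that; assumption)
  note cl = algebra_onD(2)[OF L]
  have q: "brk L (brk L x y) (brk L z u) \<in> car L" by (intro cl x)
  have z: "0 \<in> car L" using algebra_onD(1)[OF L] subspace_0 by blast
  have "g (brk L (brk L x y) (brk L z u)) = 0" by (simp add: g(3) cl x M)
  also have "0 = g 0" using g(2)[OF z, of 0] by simp
  finally show ?thesis using bij_betw_imp_inj_on[OF g(1)] q z by (meson inj_onD)
qed

context std_ext
begin

lemma algebra_on: "algebra_on T"
  by (rule algebra_on_L2_ext[OF n ext_data])

lemma e_in_car [simp]: "i \<in> {1..n + 1} \<Longrightarrow> e i \<in> span (e ` {1..n + 1})"
  by (simp add: span_base)

lemma coord_B1: "B u v $$ 1 = \<alpha> * (u $$ 1 * v $$ (n + 1) - u $$ (n + 1) * v $$ 1)"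
  using n by (simp add: coord_B coord_nb coord_D algebra_simps)

lemma metabelian: "\<alpha> = 0 \<Longrightarrow> B (B x y) (B z u) = 0"
proof -
  assume \<alpha>: "\<alpha> = 0"
  have "B x y $$ 1 = 0" "B x y $$ (n + 1) = 0" for x y using coord_B1 \<alpha> by simp_all
  thus ?thesis using n by (intro vec0_eqI) (simp add: B_N coord_nb)
qed

text \<open>Two test products: with r = [\<open>e 1\<close>,x], the product [r,r] has coordinate 2
  equal to 1 + \<open>d 3\<close>, and [r,[\<open>e 3\<close>,\<open>e 1\<close>]] has coordinate 5
  equal to -1 when n \<ge> 5.\<close>

lemma not_iso_metabelian:
  assumes iso: "T \<cong>\<^sub>L M" and M: "\<And>x y z u. brk M (brk M x y) (brk M z u) = 0"
    and \<alpha>: "\<alpha> = 1" and d: "d 3 \<noteq> - 1 \<or> n \<ge> 5 \<and> d 4 = 0 \<and> (\<forall>k. c k = 0)"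
  shows False
proof -
  have m: "1 \<in> {1..n + 1}" "n + 1 \<in> {1..n + 1}" "3 \<in> {1..n + 1}" using n by auto
  note eq = metabelian_iso[OF algebra_on iso M, unfolded car_L2_ext, OF e_in_car e_in_car e_in_car e_in_car]
  have Bx: "B (e 1) (e (n + 1)) = r 1" by (rule B_ex) (use n in simp)
  have B31: "B (e 3) (e 1) = e 4" using B_ee(2)[of 4] n by simp
  have "B (r 1) (r 1) = 0" using eq[OF m(1,2,1,2)] unfolding Bx .
  moreover have r0: "r 1 $$ (n + 1) = 0" using n by (simp add: r1)
  ultimately have "nb n (r 1) (r 1) $$ 2 = 0" by (simp add: B_N)
  hence d3: "d 3 = - 1" using n \<alpha> by (simp add: coord_nb r1)
  hence n5: "n \<ge> 5" using d by simp
  have "B (r 1) (e 4) = 0" using eq[OF m(1,2,3,1)] unfolding Bx B31 .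
  hence "nb n (r 1) (e 4) $$ 5 = 0" using r0 n by (simp add: B_N coord_e)
  thus False using n5 n \<alpha> by (simp add: coord_nb r1 coord_e)
qed

lemma square: "\<sigma> = 0 \<Longrightarrow> B u u = (B u u $$ 2) *\<^sub>R e 2"
proof (rule vec0_eqI)
  fix k assume "\<sigma> = 0"
  thus "B u u $$ k = (B u u $$ 2 *\<^sub>R e 2) $$ k"
    using n by (simp add: coord_B coord_nb coord_e)
qed

end

text \<open>\<open>v\<close> is the image of \<open>e 2\<close>. By \<open>square\<close> it spans
  the line of all squares, and it is an eigenvector with the weight of \<open>e 2\<close> under some
  right multiplication.\<close>

lemma square_line_iso:
  assumes A: "std_ext n \<alpha> 0 d c r l 0" and L: "L2_ext n r l 0 \<cong>\<^sub>L M"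
  obtains v where "v \<in> car M" "\<And>y. y \<in> car M \<Longrightarrow> \<exists>t. brk M y y = t *\<^sub>R v"
    "\<exists>y\<in>car M. brk M v y = (2 * \<alpha> + d 3) *\<^sub>R v" "v \<noteq> 0"
proof -
  interpret A: std_ext n \<alpha> 0 d c r l 0 by fact
  obtain g where g: "bij_betw g (car A.T) (car M)"
     "\<And>c x. x\<in>car A.T \<Longrightarrow> g (c *\<^sub>R x) = c *\<^sub>R g x"
     "\<And>x y. x\<in>car A.T \<Longrightarrow> y\<in>car A.T \<Longrightarrow> g (brk A.T x y) = brk M (g x) (g y)"
    using L by (rule iso_preserves) (rule that; assumption)
  have e2: "e 2 \<in> car A.T" and ex: "e (n + 1) \<in> car A.T" by (rule A.e_car; use A.n in simp)+
  have gM: "g x \<in> car M" if "x \<in> car A.T" for x using g(1) that by (rule bij_betwE[rule_format])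
  show ?thesis
  proof (rule that[of "g (e 2)"])
    show "g (e 2) \<in> car M" by (rule gM[OF e2])
    fix y assume "y \<in> car M"
    then obtain x where x: "x \<in> car A.T" "y = g x" using bij_betw_imp_surj_on[OF g(1)] by blast
    have "brk M y y = g ((brk A.T x x $$ 2) *\<^sub>R e 2)" using A.square[of x] g(3)[OF x(1) x(1)] x(2) by simp
    thus "\<exists>t. brk M y y = t *\<^sub>R g (e 2)" using g(2)[OF e2] by auto
  next
    have "brk A.T (e 2) (e (n + 1)) = (2 * \<alpha> + d 3) *\<^sub>R e 2"
      using A.B_ex[of 2] A.n A.r2 by simp
    hence "brk M (g (e 2)) (g (e (n + 1))) = (2 * \<alpha> + d 3) *\<^sub>R g (e 2)"
      using g(2)[OF e2] g(3)[OF e2 ex] by simp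
    thus "\<exists>y\<in>car M. brk M (g (e 2)) y = (2 * \<alpha> + d 3) *\<^sub>R g (e 2)" using gM[OF ex] by blast
  next
    have z: "0 \<in> car A.T" by (simp add: span_zero)
    have "g 0 = 0" using g(2)[OF z, of 0] by simp
    moreover have "e 2 \<noteq> 0" by (metis coord_e lookup_zero zero_neq_one)
    ultimately show "g (e 2) \<noteq> 0" using bij_betw_imp_inj_on[OF g(1)] e2 z by (metis inj_onD)
  qed
qed

text \<open>The squares of \<open>e 1\<close> and of \<open>e (n + 1)\<close> in the target are
  \<open>e 2\<close> and \<sigma> \<open>e n\<close>, so they cannot lie on one line.\<close>

lemma not_iso_square:
  assumes A: "std_ext n \<alpha> 0 d c r l 0" and A': "std_ext n \<alpha>' \<sigma> d' c' r' l' s'" and "\<sigma> \<noteq> 0"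
    and iso: "L2_ext n r l 0 \<cong>\<^sub>L L2_ext n r' l' s'"
  shows False
proof -
  interpret A': std_ext n \<alpha>' \<sigma> d' c' r' l' s' by fact
  obtain v where v: "\<And>y. y \<in> car A'.T \<Longrightarrow> \<exists>t. brk A'.T y y = t *\<^sub>R v"
    by (rule square_line_iso[OF A iso]) (rule that; assumption)
  obtain t1 where t1: "A'.B (e 1) (e 1) = t1 *\<^sub>R v" using v[OF A'.e_car[of 1]] by auto
  obtain t2 where t2: "A'.B (e (n + 1)) (e (n + 1)) = t2 *\<^sub>R v" using v[OF A'.e_car[of "n + 1"]] by auto
  have 1: "e 2 = t1 *\<^sub>R v" using t1 A'.B_ee(1) by simp
  have ex: "A'.B (e (n + 1)) (e (n + 1)) $$ n = \<sigma>" "A'.B (e (n + 1)) (e (n + 1)) $$ 2 = 0"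
  proof -
    have "A'.D (e (n + 1)) = 0" "A'.\<Lambda> (e (n + 1)) = 0"
      unfolding comb_def by (intro sum.neutral; simp add: coord_e)+
    moreover have "nb n (e (n + 1)) (e (n + 1)) = 0"
      by (rule vec0_eqI) (use A'.n in \<open>auto simp: coord_nb coord_e\<close>)
    ultimately have "A'.B (e (n + 1)) (e (n + 1)) = s'" by (simp add: brk_L2_ext coord_e)
    thus "A'.B (e (n + 1)) (e (n + 1)) $$ n = \<sigma>" "A'.B (e (n + 1)) (e (n + 1)) $$ 2 = 0"
      using A'.n by (simp_all add: A'.s coord_e)
  qed
  have "t1 * v $$ 2 = 1" using arg_cong[OF 1, of "\<lambda>u. u $$ 2"] by (simp add: coord_e)
  moreover have "t1 * v $$ n = 0" using arg_cong[OF 1, of "\<lambda>u. u $$ n"] A'.n by (simp add: coord_e)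
  moreover have "t2 * v $$ n = \<sigma>" "t2 * v $$ 2 = 0" using ex unfolding t2 by simp_all
  ultimately show False using \<open>\<sigma> \<noteq> 0\<close> by auto
qed

text \<open>The line of squares in the target contains [\<open>e 1\<close>,\<open>e 1\<close>] =
  \<open>e 2\<close>, which every right multiplication annihilates when its weight is 0.\<close>

lemma not_iso_weight:
  assumes A: "std_ext n \<alpha> 0 d c r l 0" and A': "std_ext n \<alpha>' 0 d' c' r' l' 0"
    and "2 * \<alpha> + d 3 \<noteq> 0" "2 * \<alpha>' + d' 3 = 0"
    and iso: "L2_ext n r l 0 \<cong>\<^sub>L L2_ext n r' l' 0"
  shows False
proof -
  interpret A': std_ext n \<alpha>' 0 d' c' r' l' 0 by fact
  obtain v where v: "\<And>y. y \<in> car A'.T \<Longrightarrow> \<exists>t. A'.B y y = t *\<^sub>R v"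
    "\<exists>y\<in>car A'.T. A'.B v y = (2 * \<alpha> + d 3) *\<^sub>R v" "v \<noteq> 0"
    by (rule square_line_iso[OF A iso]) (rule that; assumption)
  obtain t1 where "A'.B (e 1) (e 1) = t1 *\<^sub>R v" using v(1)[OF A'.e_car[of 1]] by auto
  hence 1: "e 2 = t1 *\<^sub>R v" using A'.B_ee(1) by simp
  hence "t1 \<noteq> 0" by (metis coord_e lookup_zero scale_zero_left zero_neq_one)
  hence v2: "v = (1 / t1) *\<^sub>R e 2" using 1 by simp
  obtain y where y: "A'.B v y = (2 * \<alpha> + d 3) *\<^sub>R v" using v(2) by blast
  have "A'.B v y = 0"
  proof -
    have "A'.D (e 2) = 0" using A'.D_e2 assms(4) by simp
    hence "A'.B (e 2) y = 0" using A'.n by (simp add: brk_L2_ext coord_e)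
    thus ?thesis unfolding v2 by (simp add: L2_ext_def)
  qed
  thus False using y v(3) assms(3) by simp
qed

text \<open>In \<open>g1 n 0\<close> there are \<open>v = e 1 - e 3\<close> and \<open>x\<close> with \<open>[v, x] = v\<close> and \<open>[x, x] = 0\<close>; in \<open>g2\<close> the same
  equations for the images \<open>V\<close>, \<open>X\<close> force \<open>\<delta> = 0\<close>.\<close>

lemma not_iso_g1_g2:
  assumes n: "n \<ge> 5" and \<delta>: "\<delta> \<noteq> 0"
  shows "\<not> g1 n 0 \<cong>\<^sub>L g2 n \<delta>"
proof
  assume iso: "g1 n 0 \<cong>\<^sub>L g2 n \<delta>"
  have n4: "n \<ge> 4" using n by simp
  obtain r l where A: "std_ext n 1 0 (\<lambda>k. if k = 3 then 0 - 2 else 0) (\<lambda>_. 0) r l 0" and g1: "g1 n 0 = L2_ext n r l 0"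
    using std_ext_g1[OF n4] unfolding g1_def by blast
  obtain r' l' where A': "std_ext n 1 0 (\<lambda>k. if k = 3 then - 2 else if k = 5 then \<delta> else 0) (\<lambda>_. 0) r' l' 0"
    and g2: "g2 n \<delta> = L2_ext n r' l' 0"
    using std_ext_g2[OF n] unfolding g2_def by blast
  interpret A: std_ext n 1 0 "\<lambda>k. if k = 3 then 0 - 2 else 0" "\<lambda>_. 0" r l 0 by (rule A)
  interpret A': std_ext n 1 0 "\<lambda>k. if k = 3 then - 2 else if k = 5 then \<delta> else 0" "\<lambda>_. 0" r' l' 0 by (rule A')
  obtain g where g: "bij_betw g (car A.T) (car A'.T)"
     "\<And>x y. x\<in>car A.T \<Longrightarrow> y\<in>car A.T \<Longrightarrow> g (x + y) = g x + g y"
     "\<And>c x. x\<in>car A.T \<Longrightarrow> g (c *\<^sub>R x) = c *\<^sub>R g x"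
     "\<And>x y. x\<in>car A.T \<Longrightarrow> y\<in>car A.T \<Longrightarrow> g (A.B x y) = A'.B (g x) (g y)"
    using iso unfolding g1 g2 by (rule iso_preserves) (rule that; assumption)
  have car: "e i \<in> car A.T" if "i \<in> {1..n + 1}" for i by (rule A.e_car[OF that])
  have m: "e 1 \<in> car A.T" "e 3 \<in> car A.T" "e 4 \<in> car A.T" "e 5 \<in> car A.T" "e (n + 1) \<in> car A.T"
    by (rule car; use n in simp)+
  have "e 1 + (- 1) *\<^sub>R e 3 \<in> car A.T" using m unfolding car_L2_ext by (intro span_add span_scale)
  hence vc: "e 1 - e 3 \<in> car A.T" by simp
  have "A.B (e 1 - e 3) (e (n + 1)) = e 1 - e 3"
  proof (rule vec0_eqI)
    fix k
    have "A.S (e 1 - e 3) k = 0" by (simp add: A.S_def)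
    thus "A.B (e 1 - e 3) (e (n + 1)) $$ k = (e 1 - e 3) $$ k"
      using n by (auto simp: A.coord_B A.coord_D coord_nb coord_e)
  qed
  moreover have "A.B (e 3) (e (n + 1)) = - e 3"
    by (rule vec0_eqI) (use A.B_ex[of 3] n in \<open>simp add: A.r3 coord_e\<close>)
  moreover have "A.B (e (n + 1)) (e (n + 1)) = 0"
    by (rule vec0_eqI) (use n in \<open>auto simp: A.coord_B A.coord_D A.S_def A.\<phi>_def coord_nb coord_e\<close>)
  moreover have "A.B (e 3) (e 1 - e 3) = e 4" "A.B (e 4) (e 1 - e 3) = e 5"
    by (rule vec0_eqI, use n in \<open>auto simp: A.B_N coord_nb coord_e\<close>)+
  ultimately have R: "A'.B (g (e 1 - e 3)) (g (e (n + 1))) = g (e 1 - e 3)"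
     "A'.B (g (e (n + 1))) (g (e (n + 1))) = g 0"
     "A'.B (g (e 3)) (g (e 1 - e 3)) = g (e 4)" "A'.B (g (e 4)) (g (e 1 - e 3)) = g (e 5)"
     "A'.B (g (e 3)) (g (e (n + 1))) = - g (e 3)"
    using g(4)[OF vc m(5)] g(4)[OF m(5) m(5)] g(4)[OF m(2) vc] g(4)[OF m(3) vc] g(4)[OF m(2) m(5)] g(3)[OF m(2), of "-1"]
    by simp_all
  define V X W where "V = g (e 1 - e 3)" and "X = g (e (n + 1))" and "W = g (e 3)"
  have z: "0 \<in> car A.T" by (simp add: span_zero)
  have g0: "g 0 = 0" using g(3)[OF z, of 0] by simp
  have VX: "A'.B V X = V" and XX: "A'.B X X = 0" and WV: "A'.B (A'.B W V) V = g (e 5)"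
    and W: "A'.B W X = - W"
    using R g0 by (simp_all add: V_def X_def W_def)
  have V': "V $$ (n + 1) = 0" using A'.B_coord[of V X] VX by simp
  have W': "W $$ (n + 1) = 0" using A'.B_coord[of W X] W by simp
  \<comment> \<open>[[\<open>e 3\<close>,v],v] = \<open>e 5\<close> is nonzero, while right
    multiplication by elements of the nilradical without coordinate 1 squares to zero on it.\<close>
  have V1: "V $$ 1 \<noteq> 0"
  proof
    assume V1: "V $$ 1 = 0"
    have "A'.B (A'.B W V) V = 0"
      using V' W' V1 n by (intro vec0_eqI) (simp add: A'.B_N coord_nb)
    hence "g (e 5) = g 0" using WV g0 by simp
    hence "e 5 = 0" using bij_betw_imp_inj_on[OF g(1)] m(4) z by (meson inj_onD)
    thus False by (metis coord_e lookup_zero zero_neq_one)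
  qed
  have S: "A'.S u k = 0" for u k by (simp add: A'.S_def)
  have VXk: "V $$ k = nb n V X $$ k + X $$ (n + 1) * A'.D V $$ k" for k
    using arg_cong[OF VX, of "\<lambda>u. u $$ k"] V' by (simp add: A'.coord_B)
  have X': "X $$ (n + 1) = 1" using VXk[of 1] V1 n by (simp add: coord_nb A'.coord_D)
  have V3: "V $$ 3 = - V $$ 1" using VXk[of 3] n X' S by (simp add: coord_nb A'.coord_D)
  have V4: "V $$ 4 = - V $$ 1 * X $$ 1 - V $$ 1 * X $$ 3" using VXk[of 4] n X' S V3 by (simp add: coord_nb A'.coord_D)
  \<comment> \<open>\<open>e 5\<close> has weight 1 and coordinate n + 1 of \<open>X\<close> is 1,
    so coordinate 5 of \<open>V\<close> cancels and only \<delta> and known terms remain.\<close>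
  have V5: "V $$ 4 * X $$ 1 - V $$ 1 * X $$ 4 + \<delta> * V $$ 1 = 0" using VXk[of 5] n X' S by (simp add: coord_nb A'.coord_D)
  have X2: "X $$ 1 * (X $$ 1 + X $$ 3) + X $$ 4 = 0"
    using arg_cong[OF XX, of "\<lambda>u. u $$ 2"] n X' by (simp add: A'.coord_B coord_nb A'.coord_D A'.\<phi>_def)
  have "V $$ 1 * \<delta> = V $$ 1 * (X $$ 1 * (X $$ 1 + X $$ 3) + X $$ 4)"
    using V5 unfolding V4 by (simp add: algebra_simps)
  thus False using X2 V1 \<delta> by simp
qed

text \<open>For \<open>g1\<close> the weight of \<open>e 3\<close> is 1 + (a - 2) = a - 1, whence
  the exceptional value a = 1.\<close>

lemma g1_series:
  assumes "n \<ge> 4"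
  shows "solvable_L2_extension n (g1 n a) \<and> standard_nilradical n (g1 n a) \<and>
    (a \<noteq> 1 \<longrightarrow> has_DS (g1 n a) [n + 1, n, n - 2, 0] \<and> has_LS (g1 n a) [n + 1, n, n]) \<and>
    (a = 1 \<longrightarrow> has_DS (g1 n a) [n + 1, n - 1, n - 4, 0] \<and> has_LS (g1 n a) [n + 1, n - 1, n - 1])"
proof -
  note S = std_ext_g1[OF assms, of a]
  show ?thesis
    using std_ext.extension[OF S] std_ext.standard[OF S] std_ext.series_nondegenerate[OF S]
      std_ext.series_degenerate[OF S]
    unfolding g1_def[symmetric] by simp
qed

lemma g2_series:
  assumes "n \<ge> 5"
  shows "solvable_L2_extension n (g2 n \<delta>) \<and> standard_nilradical n (g2 n \<delta>) \<and>
    has_DS (g2 n \<delta>) [n + 1, n, n - 2, 0] \<and> has_LS (g2 n \<delta>) [n + 1, n, n]"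
proof -
  note S = std_ext_g2[OF assms, of \<delta>]
  show ?thesis
    using std_ext.extension[OF S] std_ext.standard[OF S] std_ext.series_nondegenerate[OF S]
    unfolding g2_def[symmetric] by simp
qed

lemma g3_series:
  assumes "n \<ge> 5"
  shows "solvable_L2_extension n (g3 n \<delta>) \<and> standard_nilradical n (g3 n \<delta>) \<and>
    has_DS (g3 n \<delta>) [n + 1, n, n - 2, 0] \<and> has_LS (g3 n \<delta>) [n + 1, n, n]"
proof -
  note S = std_ext_g3[OF assms, of \<delta>]
  have "(1::real) + (2 - real n) \<noteq> 0" using assms by simp
  thus ?thesis
    using std_ext.extension[OF S] std_ext.standard[OF S] std_ext.series_nondegenerate[OF S]
    unfolding g3_def[symmetric] by simp
qed

lemma g4_series:
  assumes "n \<ge> 4"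
  shows "solvable_L2_extension n (g4 n \<epsilon> b) \<and> standard_nilradical n (g4 n \<epsilon> b) \<and>
    has_DS (g4 n \<epsilon> b) [n + 1, n - 1, 0] \<and> has_LS (g4 n \<epsilon> b) [n + 1, n - 1, n - 1]"
proof -
  note S = std_ext_g4[OF assms, of \<epsilon> b]
  show ?thesis
    using std_ext.extension[OF S] std_ext.standard[OF S] std_ext.series_abelian[OF S refl]
    unfolding g4_def[symmetric] by simp
qed

lemma g4_metabelian:
  assumes "n \<ge> 4"
  shows "brk (g4 n \<epsilon> b) (brk (g4 n \<epsilon> b) x y) (brk (g4 n \<epsilon> b) z u) = 0"
  using std_ext.metabelian[OF std_ext_g4[OF assms, of \<epsilon> b] refl] unfolding g4_def .

lemma g1_not_g2:
  assumes "n \<ge> 5" "\<delta> \<noteq> 0"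
  shows "\<not> g1 n a \<cong>\<^sub>L g2 n \<delta>"
proof (cases "a = 0")
  case True
  thus ?thesis using not_iso_g1_g2[OF assms] by simp
next
  case False
  have n: "n \<ge> 4" using assms by simp
  show ?thesis unfolding g1_def g2_def
    by (rule notI, rule not_iso_weight[OF std_ext_g1[OF n, of a] std_ext_g2[OF assms(1), of \<delta>]])
      (use False in simp_all)
qed

lemma g1_not_g3:
  assumes "n \<ge> 5" "\<delta> \<noteq> 0"
  shows "\<not> g1 n a \<cong>\<^sub>L g3 n \<delta>"
proof -
  have n: "n \<ge> 4" using assms by simp
  show ?thesis unfolding g1_def g3_def
    by (rule notI, rule not_iso_square[OF std_ext_g1[OF n, of a] std_ext_g3[OF assms(1), of \<delta>] assms(2)])
qed

lemma g2_not_g3: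
  assumes "n \<ge> 5" "\<delta>' \<noteq> 0"
  shows "\<not> g2 n \<delta> \<cong>\<^sub>L g3 n \<delta>'"
  unfolding g2_def g3_def
  by (rule notI, rule not_iso_square[OF std_ext_g2[OF assms(1), of \<delta>] std_ext_g3[OF assms(1), of \<delta>'] assms(2)])

text \<open>The exclusion is genuine: for n = 4 and a = 1 the basis \<open>e 1\<close>,
  \<open>e 2\<close>, \<open>e 1 - e 3\<close>, \<open>e 2 - e 4\<close>, \<open>e 5\<close> of
  \<open>g1\<close> has the bracket table of \<open>g4\<close>.\<close>

lemma g1_not_g4:
  assumes "n \<ge> 4" "n \<ge> 5 \<or> a \<noteq> 1"
  shows "\<not> g1 n a \<cong>\<^sub>L g4 n \<epsilon> b"
proof
  assume "g1 n a \<cong>\<^sub>L g4 n \<epsilon> b"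
  from std_ext.not_iso_metabelian[OF std_ext_g1[OF assms(1)] this[unfolded g1_def] g4_metabelian[OF assms(1)] refl]
  show False using assms(2) by auto
qed

lemma g2_not_g4:
  assumes "n \<ge> 5"
  shows "\<not> g2 n \<delta> \<cong>\<^sub>L g4 n \<epsilon> b"
proof
  assume iso: "g2 n \<delta> \<cong>\<^sub>L g4 n \<epsilon> b"
  have "n \<ge> 4" using assms by simp
  from std_ext.not_iso_metabelian[OF std_ext_g2[OF assms] iso[unfolded g2_def] g4_metabelian[OF this] refl]
  show False by simp
qed

lemma g3_not_g4:
  assumes "n \<ge> 5"
  shows "\<not> g3 n \<delta> \<cong>\<^sub>L g4 n \<epsilon> b"
proof
  assume iso: "g3 n \<delta> \<cong>\<^sub>L g4 n \<epsilon> b"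
  have "n \<ge> 4" using assms by simp
  from std_ext.not_iso_metabelian[OF std_ext_g3[OF assms] iso[unfolded g3_def] g4_metabelian[OF this] refl]
  show False using assms by simp
qed

theorem theorem5p1p3:
  fixes n :: nat
  assumes "n \<ge> 4"
  shows
    "(\<forall>a. solvable_L2_extension n (g1 n a) \<and> standard_nilradical n (g1 n a) \<and>
        (a \<noteq> 1 \<longrightarrow> has_DS (g1 n a) [n + 1, n, n - 2, 0] \<and> has_LS (g1 n a) [n + 1, n, n]) \<and>
        (a = 1 \<longrightarrow> has_DS (g1 n a) [n + 1, n - 1, n - 4, 0] \<and> has_LS (g1 n a) [n + 1, n - 1, n - 1]))
     \<and> (n \<ge> 5 \<longrightarrow> (\<forall>\<delta>\<in>{1, -1}.
        solvable_L2_extension n (g2 n \<delta>) \<and> standard_nilradical n (g2 n \<delta>) \<and>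
        has_DS (g2 n \<delta>) [n + 1, n, n - 2, 0] \<and> has_LS (g2 n \<delta>) [n + 1, n, n]))
     \<and> (n \<ge> 5 \<longrightarrow> (\<forall>\<delta>\<in>{1, -1}.
        solvable_L2_extension n (g3 n \<delta>) \<and> standard_nilradical n (g3 n \<delta>) \<and>
        has_DS (g3 n \<delta>) [n + 1, n, n - 2, 0] \<and> has_LS (g3 n \<delta>) [n + 1, n, n]))
     \<and> (\<forall>\<epsilon>\<in>{0, 1, -1}. \<forall>b.
        solvable_L2_extension n (g4 n \<epsilon> b) \<and> standard_nilradical n (g4 n \<epsilon> b) \<and>
        has_DS (g4 n \<epsilon> b) [n + 1, n - 1, 0] \<and> has_LS (g4 n \<epsilon> b) [n + 1, n - 1, n - 1])
     \<and> (\<forall>L :: ('a::real_vector) alg. solvable_L2_extension n L \<longrightarrow>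
        (\<exists>a. L \<cong>\<^sub>L g1 n a)
      \<or> (n \<ge> 5 \<and> (\<exists>\<delta>\<in>{1, -1}. L \<cong>\<^sub>L g2 n \<delta>))
      \<or> (n \<ge> 5 \<and> (\<exists>\<delta>\<in>{1, -1}. L \<cong>\<^sub>L g3 n \<delta>))
      \<or> (\<exists>\<epsilon>\<in>{0, 1, -1}. \<exists>b. L \<cong>\<^sub>L g4 n \<epsilon> b))
     \<and> (n \<ge> 5 \<longrightarrow> (\<forall>a. \<forall>\<delta>\<in>{1, -1}. \<not> g1 n a \<cong>\<^sub>L g2 n \<delta>))
     \<and> (n \<ge> 5 \<longrightarrow> (\<forall>a. \<forall>\<delta>\<in>{1, -1}. \<not> g1 n a \<cong>\<^sub>L g3 n \<delta>))
     \<and> (n \<ge> 5 \<longrightarrow> (\<forall>\<delta>\<in>{1, -1}. \<forall>\<delta>'\<in>{1, -1}. \<not> g2 n \<delta> \<cong>\<^sub>L g3 n \<delta>'))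
     \<and> (\<forall>a. \<forall>\<epsilon>\<in>{0, 1, -1}. \<forall>b. n \<ge> 5 \<or> a \<noteq> 1 \<longrightarrow> \<not> g1 n a \<cong>\<^sub>L g4 n \<epsilon> b)
     \<and> (n \<ge> 5 \<longrightarrow> (\<forall>\<delta>\<in>{1, -1}. \<forall>\<epsilon>\<in>{0, 1, -1}. \<forall>b. \<not> g2 n \<delta> \<cong>\<^sub>L g4 n \<epsilon> b))
     \<and> (n \<ge> 5 \<longrightarrow> (\<forall>\<delta>\<in>{1, -1}. \<forall>\<epsilon>\<in>{0, 1, -1}. \<forall>b. \<not> g3 n \<delta> \<cong>\<^sub>L g4 n \<epsilon> b))"
proof (intro conjI, goal_cases)
  case 1
  show ?case using g1_series[OF assms] by blast
next
  case 2
  show ?case using g2_series by blast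
next
  case 3
  show ?case using g3_series by blast
next
  case 4
  show ?case using g4_series[OF assms] by blast
next
  case 5
  show ?case using classification[OF assms] unfolding listed_def by blast
next
  case 6
  show ?case using g1_not_g2 by auto
next
  case 7
  show ?case using g1_not_g3 by auto
next
  case 8
  show ?case using g2_not_g3 by auto
next
  case 9
  show ?case using g1_not_g4[OF assms] by blast
next
  case 10
  show ?case using g2_not_g4 by blast
next
  case 11
  show ?case using g3_not_g4 by blast
qed

end
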